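(* Let $R\subset S^2$ be a reduced spherical convex body with $\Delta(R)<\frac{\pi}{2}$. Assume that $M$ is a supporting hemisphere of $R$ such that the intersection of $\mathrm{bd}(M)$ with $\mathrm{bd}(R)$ is a non-degenerate arc $x_1x_2$. Then $\mathrm{width}_M(R)=\Delta(R)$, and the center of $M/M^*$ belongs to $x_1x_2$.
   Context: $S^2$ is the unit sphere in $E^3$ with spherical (geodesic) distance $|ab|$. For non-antipodal $a,b$, the arc $ab$ is the shorter part of the great circle through $a,b$. A set $C\subset S^2$ is convex if it contains no pair of antipodes and $ab\subset C$ for all $a,b\in C$. A convex body is a closed convex set with non-empty interior. A hemisphere is the set of points at distance at most $\frac{\pi}{2}$ from a point (its center). A hemisphere $K$ supports $C$ if $C\subset K$ and $\mathrm{bd}(C)\cap\mathrm{bd}(K)\neq\emptyset$. If hemispheres $G,H$ are different and not opposite (centers not antipodal), $L=G\cap H$ is a lune. It is bounded by two semicircles, $G/H=\mathrm{bd}(G)\cap H$ and $H/G=\mathrm{bd}(H)\cap G$. The center of a semicircle is its midpoint. The thickness $\Delta(L)$ is the spherical distance between the centers of $G/H$ and $H/G$. For a hemisphere $K$ supporting $C$, $K^*$ denotes a hemisphere supporting $C$ such that $K\cap K^*$ has minimum thickness among all lunes $K\cap K'$ with $K'$ supporting $C$. Put $\mathrm{width}_K(C)=\Delta(K\cap K^* )$. The thickness $\Delta(C)$ is the minimum of $\mathrm{width}_K(C)$ over all hemispheres $K$ supporting $C$. A convex body $R$ is reduced if $\Delta(Z)<\Delta(R)$ for every convex body $Z\subset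 R$ with $Z\neq R$. *)

theory Defs
  imports "HOL-Analysis.Analysis"
begin

abbreviation S2 :: "(real ^ 3) set" where
  "S2 \<equiv> sphere 0 1"

definition sdist :: "real ^ 3 \<Rightarrow> real ^ 3 \<Rightarrow> real" where
  "sdist a b = arccos (a \<bullet> b)"

text \<open>Topological notions are relative to the sphere, not to the ambient space.\<close>

definition bd :: "(real ^ 3) set \<Rightarrow> (real ^ 3) set" where
  "bd C = top_of_set S2 frontier_of C"

text \<open>For non-antipodal \<open>a\<close>, \<open>b\<close> on the sphere, the shorter part of the great circle through
  \<open>a\<close> and \<open>b\<close> is cut out of the sphere by the convex cone that they span
  (so it is \<open>{a}\<close> if \<open>a = b\<close>). For antipodal points the value carries no meaning.\<close>

definition great_arc :: "real ^ 3 \<Rightarrow> real ^ 3 \<Rightarrow> (real ^ 3) set" where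
  "great_arc a b = {x \<in> S2. \<exists>s t. 0 \<le> s \<and> 0 \<le> t \<and> x = s *\<^sub>R a + t *\<^sub>R b}"

definition sph_convex :: "(real ^ 3) set \<Rightarrow> bool" where
  "sph_convex C \<longleftrightarrow> C \<subseteq> S2 \<and> (\<forall>a\<in>C. - a \<notin> C) \<and> (\<forall>a\<in>C. \<forall>b\<in>C. great_arc a b \<subseteq> C)"

definition sph_convex_body :: "(real ^ 3) set \<Rightarrow> bool" where
  "sph_convex_body C \<longleftrightarrow> sph_convex C \<and> closedin (top_of_set S2) C \<and>
     top_of_set S2 interior_of C \<noteq> {}"

definition hemisphere_at :: "real ^ 3 \<Rightarrow> (real ^ 3) set" where
  "hemisphere_at c = {x \<in> S2. sdist c x \<le> pi / 2}"

definition hemisphere :: "(real ^ 3) set \<Rightarrow> bool" where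
  "hemisphere K \<longleftrightarrow> (\<exists>c\<in>S2. K = hemisphere_at c)"

definition supports :: "(real ^ 3) set \<Rightarrow> (real ^ 3) set \<Rightarrow> bool" where
  "supports K C \<longleftrightarrow> hemisphere K \<and> C \<subseteq> K \<and> bd C \<inter> bd K \<noteq> {}"

text \<open>A lune is handled through the pair of hemispheres whose intersection it is.\<close>

definition lune_pair :: "(real ^ 3) set \<Rightarrow> (real ^ 3) set \<Rightarrow> bool" where
  "lune_pair G H \<longleftrightarrow>
     (\<exists>g\<in>S2. \<exists>h\<in>S2. G = hemisphere_at g \<and> H = hemisphere_at h \<and> G \<noteq> H \<and> h \<noteq> - g)"

definition semicircle :: "(real ^ 3) set \<Rightarrow> (real ^ 3) set \<Rightarrow> (real ^ 3) set" where
  "semicircle G H = bd G \<inter> H"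

text \<open>The two end points of \<open>semicircle G H\<close> are the two points of \<open>bd G \<inter> bd H\<close>;
  its midpoint is the point on it that is equidistant from them.\<close>

definition semicircle_center :: "(real ^ 3) set \<Rightarrow> (real ^ 3) set \<Rightarrow> real ^ 3" where
  "semicircle_center G H =
     (THE m. m \<in> semicircle G H \<and>
        (\<forall>e \<in> bd G \<inter> bd H. \<forall>f \<in> bd G \<inter> bd H. sdist m e = sdist m f))"

definition lune_thickness :: "(real ^ 3) set \<Rightarrow> (real ^ 3) set \<Rightarrow> real" where
  "lune_thickness G H = sdist (semicircle_center G H) (semicircle_center H G)"

text \<open>\<open>is_star C K K'\<close> says that \<open>K'\<close> is an admissible choice of \<open>K\<^sup>*\<close>, which need not be
  unique.\<close>

definition is_star :: "(real ^ 3) set \<Rightarrow> (real ^ 3) set \<Rightarrow> (real ^ 3) set \<Rightarrow> bool" where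
  "is_star C K = is_arg_min (lune_thickness K) (\<lambda>K'. supports K' C \<and> lune_pair K K')"

text \<open>The width does not depend on the choice of \<open>K\<^sup>*\<close>, all of them giving the same minimum.\<close>

definition width :: "(real ^ 3) set \<Rightarrow> (real ^ 3) set \<Rightarrow> real" where
  "width K C = lune_thickness K (SOME K'. is_star C K K')"

definition thickness :: "(real ^ 3) set \<Rightarrow> real" where
  "thickness C = (LEAST w. \<exists>K. supports K C \<and> w = width K C)"

definition sph_reduced :: "(real ^ 3) set \<Rightarrow> bool" where
  "sph_reduced R \<longleftrightarrow> sph_convex_body R \<and>
     (\<forall>Z. sph_convex_body Z \<and> Z \<subseteq> R \<and> Z \<noteq> R \<longrightarrow> thickness Z < thickness R)"

end

theory Submission
  imports Defs
begin

text \<open>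
  The proof works in the dual of \<open>R\<close>, the set of all centres of hemispheres that contain \<open>R\<close>. If \<open>g\<close>
  and \<open>h\<close> are the centres of two hemispheres, then the lune has thickness \<open>pi\<close> minus the distance of
  \<open>g\<close> and \<open>h\<close>. So the width of \<open>R\<close> with respect to a supporting hemisphere is determined by the
  largest distance in the dual from its centre, and the thickness of \<open>R\<close> by the diameter of the dual
  (\<open>thickness_eq\<close>, \<open>thickness_dual\<close>). Thickness below \<open>pi / 2\<close> means that the diameter exceeds
  \<open>pi / 2\<close>; let \<open>c < 0\<close> be its cosine. Pairs \<open>g\<close>, \<open>h\<close> in the dual that realise the diameter are
  called diametral.

  For a diametral pair the component of \<open>h\<close> orthogonal to \<open>g\<close> is nonnegative on the dual, because
  \<open>c\<close> is negative (\<open>foot_in_body\<close>). Hence its direction, the foot of the pair on \<open>g\<close>, is a point of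
  \<open>R\<close>, and it is also the centre of the semicircle on the boundary of the hemisphere around \<open>g\<close>. This
  gives the second claim as soon as the first one is known: the centre lies in \<open>R\<close> and on the
  boundary of \<open>M\<close>.

  Reducedness is used in one way only: every extreme point of \<open>R\<close> is the foot of a diametral pair
  (\<open>extreme_point_is_foot\<close>). This is seen by cutting off small neighbourhoods of the extreme point.

  For the first claim, suppose that the centre \<open>m\<close> of \<open>M\<close> belongs to no diametral pair. The arc
  \<open>x1 x2\<close> makes \<open>m\<close> a corner of the dual, and the extreme points \<open>x1\<close> and \<open>x2\<close> yield diametral pairs
  \<open>g1\<close>, \<open>h1\<close> and \<open>g2\<close>, \<open>h2\<close> with \<open>g1\<close> and \<open>g2\<close> on the two sides of the dual at \<open>m\<close>; they are taken
  as near to \<open>m\<close> as possible. The chords \<open>g1 h1\<close> and \<open>g2 h2\<close> cross at a point \<open>w\<close>. The ray from \<open>m\<close>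
  through \<open>w\<close> leaves the dual at a point \<open>q\<close>, and a line that supports the dual at \<open>q\<close> comes from an
  extreme point of \<open>R\<close> and so from another diametral pair \<open>g\<close>, \<open>h\<close> with \<open>g\<close> on that line. Diametral
  pairs cross each other (\<open>diametral_pairs_cross\<close>, \<open>diametral_pair_not_on_one_side\<close>). Therefore, if
  \<open>g\<close> lies beyond both chords, then \<open>h\<close> lies on one of the two sides between \<open>g1\<close>, \<open>m\<close> and \<open>g2\<close>,
  contrary to the choice of \<open>g1\<close> and \<open>g2\<close> (\<open>no_pair_near_corner\<close>). Otherwise the line through \<open>q\<close>
  is the perpendicular to one of the chords at \<open>h1\<close> or \<open>h2\<close> (\<open>exit_point_on_opposite_side\<close>), and
  then \<open>m\<close> and \<open>q\<close> are farther apart than the diameter (\<open>perpendicular_chord_too_long\<close>).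
\<close>

section \<open>Unit vectors in space\<close>

definition normalise :: "real ^ 3 \<Rightarrow> real ^ 3" where
  "normalise v = v /\<^sub>R norm v"

lemmas scaleR_lin = scaleR_left_distrib scaleR_right_distrib scaleR_left_diff_distrib scaleR_right_diff_distrib

lemmas inner_lin = inner_add_left inner_add_right inner_diff_left inner_diff_right

lemma normalise_unit: "v \<noteq> 0 \<Longrightarrow> norm (normalise v) = 1"
  by (simp add: normalise_def)

lemma normalise_id: "norm v = 1 \<Longrightarrow> normalise v = v"
  by (simp add: normalise_def)

lemma scale_normalise: "norm v *\<^sub>R normalise v = v"
  by (cases "v = 0") (simp_all add: normalise_def)

lemma normalise_scale: "0 < t \<Longrightarrow> normalise (t *\<^sub>R v) = normalise v"
  by (simp add: normalise_def)

lemma inner_normalise: "g \<bullet> normalise v = (g \<bullet> v) / norm v"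
  by (simp add: normalise_def inverse_eq_divide)

lemma normalise_inner: "normalise v \<bullet> g = (v \<bullet> g) / norm v"
  by (simp add: normalise_def inverse_eq_divide)

lemma unit_inner_self: "norm (a :: real ^ 3) = 1 \<Longrightarrow> a \<bullet> a = 1"
  by (simp add: dot_square_norm)

lemma unit_inner_bound: "norm (a :: real ^ 3) = 1 \<Longrightarrow> norm b = 1 \<Longrightarrow> \<bar>a \<bullet> b\<bar> \<le> 1"
  using Cauchy_Schwarz_ineq2[of a b] by simp

lemma unit_eqI: "norm (a :: real ^ 3) = 1 \<Longrightarrow> norm b = 1 \<Longrightarrow> 1 \<le> a \<bullet> b \<Longrightarrow> a = b"
proof -
  assume a: "norm a = 1" "norm b = 1" "1 \<le> a \<bullet> b"
  have "(a - b) \<bullet> (a - b) \<le> 0"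
    using a unit_inner_self[of a] unit_inner_self[of b] by (simp add: inner_diff inner_commute)
  then show ?thesis by (metis inner_eq_zero_iff inner_ge_zero order_antisym eq_iff_diff_eq_0)
qed

lemma unit_eq_negI: "norm (a :: real ^ 3) = 1 \<Longrightarrow> norm b = 1 \<Longrightarrow> a \<bullet> b \<le> - 1 \<Longrightarrow> a = - b"
  using unit_eqI[of a "- b"] by simp

lemma unit_inner_strict:
  assumes "norm (a :: real ^ 3) = 1" "norm b = 1" "a \<noteq> b" "a \<noteq> - b"
  shows "(a \<bullet> b)\<^sup>2 < 1"
proof -
  have "\<not> 1 \<le> a \<bullet> b" "\<not> a \<bullet> b \<le> - 1"
    using unit_eqI unit_eq_negI assms by blast+
  then have "\<bar>a \<bullet> b\<bar> < 1" by auto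
  then show ?thesis by (simp add: abs_square_less_1)
qed

lemma unit_multiple: "norm (a :: real ^ 3) = 1 \<Longrightarrow> norm b = 1 \<Longrightarrow> b = t *\<^sub>R a \<Longrightarrow> 0 \<le> t \<Longrightarrow> b = a"
  by auto

lemma independent_combination_zero:
  assumes "norm (a :: real ^ 3) = 1" "norm b = 1" "(a \<bullet> b)\<^sup>2 \<noteq> 1"
    and eq: "s *\<^sub>R a + t *\<^sub>R b = 0"
  shows "s = 0 \<and> t = 0"
proof -
  have 1: "s + t * (a \<bullet> b) = 0"
    using arg_cong[OF eq, of "\<lambda>v. v \<bullet> a"] unit_inner_self[OF assms(1)]
    by (simp add: inner_lin inner_commute)
  have 2: "s * (a \<bullet> b) + t = 0"
    using arg_cong[OF eq, of "\<lambda>v. v \<bullet> b"] unit_inner_self[OF assms(2)]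
    by (simp add: inner_lin inner_commute)
  have "t * (1 - (a \<bullet> b)\<^sup>2) = 0" using 1 2 by algebra
  then show ?thesis using assms(3) 1 by auto
qed

lemma orthogonal_to_plane_and_normal:
  fixes a b u w :: "real ^ 3"
  assumes "norm a = 1" "norm b = 1" "(a \<bullet> b)\<^sup>2 \<noteq> 1"
    and "u \<bullet> a = 0" "u \<bullet> b = 0" "w \<bullet> a = 0" "w \<bullet> b = 0" "u \<bullet> w = 0" "w \<noteq> 0"
  shows "u = 0"
proof -
  let ?z = "cross3 a b"
  have "(norm ?z)\<^sup>2 = 1 - (a \<bullet> b)\<^sup>2"
    using norm_cross_dot[of a b] assms(1,2) by simp
  then have z: "?z \<noteq> 0" using assms(3) by auto
  have par: "\<exists>t. v = t *\<^sub>R ?z" if "v \<bullet> a = 0" "v \<bullet> b = 0" for v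
  proof -
    have "cross3 ?z v = (a \<bullet> v) *\<^sub>R b - (b \<bullet> v) *\<^sub>R a"
      by (simp add: cross3_def vec_eq_iff forall_3 inner_vec_def sum_3 algebra_simps)
    then have "cross3 ?z v = 0" using that by (simp add: inner_commute)
    then have "collinear {0, ?z, v}" by (simp add: cross_eq_0)
    then show ?thesis using z by (auto simp: collinear_lemma)
  qed
  obtain t where t: "u = t *\<^sub>R ?z" using par assms by blast
  obtain r where r: "w = r *\<^sub>R ?z" using par assms by blast
  have "t * r * (?z \<bullet> ?z) = 0" using assms(8) unfolding t r by (simp add: mult.commute)
  moreover have "r \<noteq> 0" using r assms(9) by auto
  ultimately have "t = 0" using z by simp
  then show ?thesis using t by simp
qed

lemma exists_unit_orthogonal: "\<exists>w :: real ^ 3. norm w = 1 \<and> w \<bullet> a = 0 \<and> w \<bullet> b = 0"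
proof -
  have "dim {a, b} \<le> card {a, b}" by (simp add: dim_le_card')
  also have "card {a, b} \<le> 2" by (simp add: card_insert_if)
  finally have "dim {a, b} < DIM(real ^ 3)" by simp
  then obtain w where "w \<noteq> 0" "\<And>x. x \<in> span {a, b} \<Longrightarrow> orthogonal w x"
    using orthogonal_to_subspace_exists by blast
  then show ?thesis
    by (intro exI[of _ "normalise w"])
       (simp add: normalise_unit, simp add: normalise_def span_base orthogonal_def)
qed

section \<open>Hemispheres and lunes\<close>

lemma hemisphere_at_iff:
  assumes "norm c = 1"
  shows "x \<in> hemisphere_at c \<longleftrightarrow> norm x = 1 \<and> 0 \<le> c \<bullet> x"
proof (cases "norm x = 1")
  case True
  have b: "\<bar>c \<bullet> x\<bar> \<le> 1" using unit_inner_bound assms True by blast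
  have "arccos (c \<bullet> x) \<le> arccos 0 \<longleftrightarrow> 0 \<le> c \<bullet> x"
    by (rule arccos_le_mono) (use b in auto)
  then show ?thesis using True by (simp add: hemisphere_at_def sdist_def)
qed (simp add: hemisphere_at_def)

lemma hemisphere_at_inj:
  assumes "norm g = 1" "norm h = 1" "hemisphere_at g = hemisphere_at h"
  shows "g = h"
proof (rule ccontr)
  assume ne: "g \<noteq> h"
  let ?v = "normalise (g - h)"
  have n: "norm ?v = 1" using ne normalise_unit by simp
  have lt: "g \<bullet> h < 1" using ne unit_eqI assms by force
  have "g \<bullet> ?v > 0" "h \<bullet> ?v < 0"
    using lt assms unit_inner_self[of g] unit_inner_self[of h] ne
    by (simp_all add: inner_normalise inner_diff_right inner_commute divide_neg_pos)
  then show False using assms n hemisphere_at_iff by (metis less_eq_real_def not_less)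
qed

lemma hemisphere_cases:
  assumes "hemisphere K"
  obtains g where "norm g = 1" "K = hemisphere_at g"
  using assms by (auto simp: hemisphere_def)

lemma points_beyond_great_circle:
  fixes c x :: "real ^ 3"
  assumes c: "norm c = 1" and x: "norm x = 1" "c \<bullet> x = 0" and U: "open U" "x \<in> U"
  obtains y where "y \<in> U" "norm y = 1" "c \<bullet> y < 0"
proof -
  \<comment> \<open>The path starts at \<open>x\<close> and rotates away from \<open>c\<close>.\<close>
  define f where "f t = cos t *\<^sub>R x - sin t *\<^sub>R c" for t
  have nf: "norm (f t) = 1" for t
  proof -
    have "f t \<bullet> f t = (cos t)\<^sup>2 + (sin t)\<^sup>2"
      using x(2) unit_inner_self[OF x(1)] unit_inner_self[OF c]
      by (simp add: f_def inner_diff inner_commute power2_eq_square)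
    then show ?thesis by (simp add: norm_eq_sqrt_inner)
  qed
  have "isCont f 0" unfolding f_def by (intro continuous_intros)
  moreover have "f 0 = x" by (simp add: f_def)
  ultimately have "(f \<longlongrightarrow> x) (at 0)" by (simp add: isCont_def)
  then have "(f \<longlongrightarrow> x) (at_right 0)" by (simp add: filterlim_at_split)
  then have "\<forall>\<^sub>F t in at_right 0. f t \<in> U"
    using topological_tendstoD[OF _ U(1)] U(2) by blast
  moreover have "\<forall>\<^sub>F t::real in at_right 0. 0 < t \<and> t < pi"
    by (rule eventually_at_rightI[of 0 pi]) auto
  ultimately have "\<forall>\<^sub>F t in at_right 0. f t \<in> U \<and> 0 < t \<and> t < pi"
    by eventually_elim auto
  then have "\<exists>t. f t \<in> U \<and> 0 < t \<and> t < pi"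
    by (rule eventually_happens'[OF trivial_limit_at_right_real])
  then obtain t where t: "f t \<in> U" "0 < t" "t < pi" by blast
  moreover have "c \<bullet> f t < 0"
    using x(2) unit_inner_self[OF c] t sin_gt_zero by (simp add: f_def inner_diff_right)
  ultimately show ?thesis using that nf by blast
qed

lemma bd_hemisphere_iff:
  assumes "norm c = 1"
  shows "x \<in> bd (hemisphere_at c) \<longleftrightarrow> norm x = 1 \<and> c \<bullet> x = 0"
proof -
  have eq: "hemisphere_at c = S2 \<inter> {x. 0 \<le> c \<bullet> x}" 
    by (rule set_eqI) (simp add: hemisphere_at_iff[OF assms])
  have cl: "closedin (top_of_set S2) (hemisphere_at c)"
    unfolding eq by (simp add: closedin_closed_Int closed_halfspace_ge)
  have open_pos: "openin (top_of_set S2) (S2 \<inter> {x. 0 < c \<bullet> x})"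
    by (simp add: openin_open_Int open_halfspace_gt)
  have int: "top_of_set S2 interior_of hemisphere_at c = S2 \<inter> {x. 0 < c \<bullet> x}"
  proof
    show "S2 \<inter> {x. 0 < c \<bullet> x} \<subseteq> top_of_set S2 interior_of hemisphere_at c"
      using open_pos by (intro interior_of_maximal) (auto simp: eq)
    show "top_of_set S2 interior_of hemisphere_at c \<subseteq> S2 \<inter> {x. 0 < c \<bullet> x}"
    proof
      fix x assume x: "x \<in> top_of_set S2 interior_of hemisphere_at c"
      then obtain T where T: "openin (top_of_set S2) T" "x \<in> T" "T \<subseteq> hemisphere_at c"
        by (auto simp: interior_of_def)
      obtain U where U: "open U" "T = S2 \<inter> U" using T(1) by (auto simp: openin_open)
      have "x \<in> S2 \<inter> {x. 0 \<le> c \<bullet> x}" using T(2,3) unfolding eq by blast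
      then have xs: "norm x = 1" "0 \<le> c \<bullet> x" by simp_all
      have "c \<bullet> x \<noteq> 0"
      proof
        assume 0: "c \<bullet> x = 0"
        obtain y where "y \<in> U" "norm y = 1" "c \<bullet> y < 0"
          using points_beyond_great_circle[OF assms xs(1) 0 U(1)] U(2) T(2) by blast
        moreover from this have "y \<in> hemisphere_at c" using T(3) U(2) by auto
        ultimately show False using eq by auto
      qed
      then show "x \<in> S2 \<inter> {x. 0 < c \<bullet> x}" using xs by auto
    qed
  qed
  have bd: "bd (hemisphere_at c) = hemisphere_at c - S2 \<inter> {x. 0 < c \<bullet> x}"
    unfolding bd_def frontier_of_def int using cl by (simp add: closure_of_closedin)
  show ?thesis unfolding bd Diff_iff hemisphere_at_iff[OF assms] by auto
qed

text \<open>The projection of \<open>h\<close> to the plane orthogonal to \<open>g\<close>, scaled to the sphere. When \<open>g\<close> and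
  \<open>h\<close> are the centres of two hemispheres, it is the midpoint of the semicircle on the boundary of
  the hemisphere around \<open>g\<close>.\<close>

definition foot :: "real ^ 3 \<Rightarrow> real ^ 3 \<Rightarrow> real ^ 3" where
  "foot g h = (h - (g \<bullet> h) *\<^sub>R g) /\<^sub>R sqrt (1 - (g \<bullet> h)\<^sup>2)"

lemma foot_props:
  assumes g: "norm g = 1" and h: "norm h = 1" and k: "(g \<bullet> h)\<^sup>2 < 1"
  shows "norm (foot g h) = 1" "g \<bullet> foot g h = 0" "h \<bullet> foot g h = sqrt (1 - (g \<bullet> h)\<^sup>2)"
    "foot g h \<bullet> foot h g = - (g \<bullet> h)"
    "h = sqrt (1 - (g \<bullet> h)\<^sup>2) *\<^sub>R foot g h + (g \<bullet> h) *\<^sub>R g"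
proof -
  note gg = unit_inner_self[OF g] and hh = unit_inner_self[OF h]
  define s where "s = sqrt (1 - (g \<bullet> h)\<^sup>2)"
  have s: "s > 0" "s\<^sup>2 = 1 - (g \<bullet> h)\<^sup>2" using k by (auto simp: s_def)
  have f: "foot g h = (1/s) *\<^sub>R (h - (g \<bullet> h) *\<^sub>R g)" "foot h g = (1/s) *\<^sub>R (g - (g \<bullet> h) *\<^sub>R h)"
    by (simp_all add: foot_def s_def inner_commute inverse_eq_divide)
  have sq: "(h - (g \<bullet> h) *\<^sub>R g) \<bullet> (h - (g \<bullet> h) *\<^sub>R g) = s\<^sup>2"
    using gg hh s by (simp add: inner_diff inner_commute power2_eq_square)
  have "foot g h \<bullet> foot g h = 1" 
    using sq s(1) unfolding f inner_scaleR_left inner_scaleR_right by (simp add: power2_eq_square)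
  then show "norm (foot g h) = 1" by (simp add: norm_eq_sqrt_inner)
  show "g \<bullet> foot g h = 0" using gg by (simp add: f inner_diff_right)
  have "h \<bullet> foot g h = s\<^sup>2 / s" using hh s(2) by (simp add: f inner_diff_right inner_commute power2_eq_square)
  then show "h \<bullet> foot g h = sqrt (1 - (g \<bullet> h)\<^sup>2)" using s(1) unfolding s_def[symmetric] by (simp add: power2_eq_square)
  have "(h - (g \<bullet> h) *\<^sub>R g) \<bullet> (g - (g \<bullet> h) *\<^sub>R h) = - (g \<bullet> h) * s\<^sup>2"
    unfolding s(2) using gg hh
    by (simp add: inner_lin inner_commute[of h g]) (simp add: power2_eq_square algebra_simps)
  then have "foot g h \<bullet> foot h g = (1/s) * (1/s) * (- (g \<bullet> h) * s\<^sup>2)"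
    unfolding f by (simp only: inner_scaleR_left inner_scaleR_right mult.assoc)
  then show "foot g h \<bullet> foot h g = - (g \<bullet> h)" using s(1) by (simp add: power2_eq_square)
  show "h = sqrt (1 - (g \<bullet> h)\<^sup>2) *\<^sub>R foot g h + (g \<bullet> h) *\<^sub>R g"
    using s(1) unfolding s_def[symmetric] f by simp
qed

lemma semicircle_center_eq:
  assumes g: "norm g = 1" and h: "norm h = 1" and k: "(g \<bullet> h)\<^sup>2 < 1"
  shows "semicircle_center (hemisphere_at g) (hemisphere_at h) = foot g h"
proof -
  note fp = foot_props[OF assms]
  have sp: "sqrt (1 - (g \<bullet> h)\<^sup>2) > 0" using k by simp
  have semi: "m \<in> semicircle (hemisphere_at g) (hemisphere_at h) \<longleftrightarrow>
      norm m = 1 \<and> g \<bullet> m = 0 \<and> 0 \<le> h \<bullet> m" for m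
    by (auto simp: semicircle_def bd_hemisphere_iff[OF g] hemisphere_at_iff[OF h])
  have ends: "e \<in> bd (hemisphere_at g) \<inter> bd (hemisphere_at h) \<longleftrightarrow>
      norm e = 1 \<and> g \<bullet> e = 0 \<and> h \<bullet> e = 0" for e
    by (auto simp: bd_hemisphere_iff[OF g] bd_hemisphere_iff[OF h])
  obtain z where z: "norm z = 1" "z \<bullet> g = 0" "z \<bullet> h = 0" using exists_unit_orthogonal by blast
  show ?thesis
    unfolding semicircle_center_def semi
  proof (rule the_equality)
    have "foot g h \<bullet> e = 0" if "e \<in> bd (hemisphere_at g) \<inter> bd (hemisphere_at h)" for e
      using that unfolding ends by (simp add: foot_def inner_diff_left)
    then show "(norm (foot g h) = 1 \<and> g \<bullet> foot g h = 0 \<and> 0 \<le> h \<bullet> foot g h) \<and>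
      (\<forall>e\<in>bd (hemisphere_at g) \<inter> bd (hemisphere_at h). \<forall>f\<in>bd (hemisphere_at g) \<inter> bd (hemisphere_at h).
        sdist (foot g h) e = sdist (foot g h) f)"
      using fp(1-3) sp by (simp add: sdist_def)
  next
    fix m assume m: "(norm m = 1 \<and> g \<bullet> m = 0 \<and> 0 \<le> h \<bullet> m) \<and>
      (\<forall>e\<in>bd (hemisphere_at g) \<inter> bd (hemisphere_at h). \<forall>f\<in>bd (hemisphere_at g) \<inter> bd (hemisphere_at h).
        sdist m e = sdist m f)"
    \<comment> \<open>Equidistance from the two end points \<open>z\<close> and \<open>- z\<close> is orthogonality to \<open>z\<close>.\<close>
    have "z \<in> bd (hemisphere_at g) \<inter> bd (hemisphere_at h)" "- z \<in> bd (hemisphere_at g) \<inter> bd (hemisphere_at h)"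
      unfolding ends using z by (auto simp: inner_commute)
    then have "arccos (m \<bullet> z) = arccos (m \<bullet> - z)" using m unfolding sdist_def by blast
    moreover have "\<bar>m \<bullet> z\<bar> \<le> 1" using m z unit_inner_bound by blast
    ultimately have mz: "m \<bullet> z = 0" using arccos_eq_iff[of "m \<bullet> z" "m \<bullet> - z"] by simp
    let ?f = "foot g h"
    let ?u = "m - (m \<bullet> ?f) *\<^sub>R ?f"
    have fg: "(g \<bullet> ?f)\<^sup>2 \<noteq> 1" using fp by simp
    have "g \<bullet> z = 0" "h \<bullet> z = 0" using z by (simp_all add: inner_commute)
    then have fz: "?f \<bullet> z = 0" by (simp add: foot_def inner_diff_left)
    have "?u = 0"
      by (rule orthogonal_to_plane_and_normal[OF g fp(1) fg, where w = z])
        (use m fp z mz fz in \<open>auto simp: inner_lin inner_commute unit_inner_self\<close>)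
    then have mf: "m = (m \<bullet> ?f) *\<^sub>R ?f" by simp
    have "0 \<le> h \<bullet> m" using m by simp
    also have "h \<bullet> m = (m \<bullet> ?f) * (h \<bullet> ?f)" by (subst mf) simp
    finally have "0 \<le> m \<bullet> ?f" using fp(3) sp by (simp add: zero_le_mult_iff)
    then show "m = ?f" using unit_multiple[OF fp(1) _ mf] m by simp
  qed
qed

lemma lune_thickness_eq:
  assumes "norm g = 1" "norm h = 1" "(g \<bullet> h)\<^sup>2 < 1"
  shows "lune_thickness (hemisphere_at g) (hemisphere_at h) = arccos (- (g \<bullet> h))"
proof -
  have "(h \<bullet> g)\<^sup>2 < 1" using assms(3) by (subst inner_commute)
  from semicircle_center_eq[OF assms(2,1) this] semicircle_center_eq[OF assms] foot_props(4)[OF assms]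
  show ?thesis unfolding lune_thickness_def sdist_def by simp
qed

lemma lune_pair_iff:
  assumes "norm g = 1" "norm h = 1"
  shows "lune_pair (hemisphere_at g) (hemisphere_at h) \<longleftrightarrow> g \<noteq> h \<and> h \<noteq> - g"
proof
  assume "lune_pair (hemisphere_at g) (hemisphere_at h)"
  then obtain g' h' where "norm g' = 1" "norm h' = 1" "hemisphere_at g = hemisphere_at g'"
    "hemisphere_at h = hemisphere_at h'" "hemisphere_at g \<noteq> hemisphere_at h" "h' \<noteq> - g'"
    unfolding lune_pair_def by - (elim bexE conjE, rule that; (assumption | simp))
  moreover from this have "g = g'" "h = h'" using hemisphere_at_inj assms by blast+
  ultimately show "g \<noteq> h \<and> h \<noteq> - g" by blast
next
  assume "g \<noteq> h \<and> h \<noteq> - g"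
  moreover from this have "hemisphere_at g \<noteq> hemisphere_at h" using hemisphere_at_inj assms by blast
  moreover have "g \<in> S2" "h \<in> S2" using assms by simp_all
  ultimately show "lune_pair (hemisphere_at g) (hemisphere_at h)"
    unfolding lune_pair_def by blast
qed

section \<open>The dual of a spherical convex body\<close>

text \<open>All centres of hemispheres that contain \<open>C\<close>; on the sphere it is the dual cone of the cone over
  \<open>C\<close>.\<close>

definition dual :: "(real ^ 3) set \<Rightarrow> (real ^ 3) set" where
  "dual C = {g \<in> S2. \<forall>x\<in>C. 0 \<le> g \<bullet> x}"

definition support_centres :: "(real ^ 3) set \<Rightarrow> (real ^ 3) set" where
  "support_centres C = {g \<in> dual C. \<exists>x\<in>C. g \<bullet> x = 0}"

lemma dual_unit: "g \<in> dual C \<Longrightarrow> norm g = 1"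
  by (simp add: dual_def)

lemma dual_nonneg: "g \<in> dual C \<Longrightarrow> x \<in> C \<Longrightarrow> 0 \<le> g \<bullet> x"
  by (simp add: dual_def)

lemma normalise_in_dual:
  assumes "q \<noteq> 0" "\<And>x. x \<in> C \<Longrightarrow> 0 \<le> q \<bullet> x"
  shows "normalise q \<in> dual C"
  using assms normalise_unit[of q]
  by (simp add: dual_def normalise_inner)

lemma body_unit: "sph_convex_body C \<Longrightarrow> x \<in> C \<Longrightarrow> norm x = 1"
  by (auto simp: sph_convex_body_def sph_convex_def)

lemma body_no_antipodes: "sph_convex_body C \<Longrightarrow> x \<in> C \<Longrightarrow> - x \<notin> C"
  by (auto simp: sph_convex_body_def sph_convex_def)

lemma body_compact:
  assumes "sph_convex_body C"
  shows "compact C"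
proof -
  have "closedin (top_of_set S2) C" using assms by (simp add: sph_convex_body_def)
  then have "closed C" "C \<subseteq> S2" using closedin_closed_trans closed_sphere closedin_subset by fastforce+
  then show ?thesis using compact_eq_bounded_closed bounded_subset bounded_sphere by blast
qed

lemma body_convex:
  assumes C: "sph_convex_body C" and "x \<in> C" "y \<in> C" "0 \<le> s" "0 \<le> t" "s *\<^sub>R x + t *\<^sub>R y \<noteq> 0"
  shows "normalise (s *\<^sub>R x + t *\<^sub>R y) \<in> C"
proof -
  let ?v = "s *\<^sub>R x + t *\<^sub>R y"
  have "normalise ?v = (s / norm ?v) *\<^sub>R x + (t / norm ?v) *\<^sub>R y"
    by (simp only: normalise_def scaleR_add_right scaleR_scaleR divide_inverse_commute)
  moreover have "0 \<le> s / norm ?v" "0 \<le> t / norm ?v" using assms by simp_all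
  ultimately have "normalise ?v \<in> great_arc x y"
    using normalise_unit[OF assms(6)] unfolding great_arc_def by (simp del: divide_le_0_iff zero_le_divide_iff) blast
  then show ?thesis using C assms(2,3) unfolding sph_convex_body_def sph_convex_def by blast
qed

text \<open>A great circle has no interior, so a convex body is not contained in one.\<close>

lemma body_not_in_great_circle:
  assumes C: "sph_convex_body C" and g: "norm g = 1"
  obtains x where "x \<in> C" "g \<bullet> x \<noteq> 0"
proof -
  have int: "top_of_set S2 interior_of C \<noteq> {}" using C by (simp add: sph_convex_body_def)
  show ?thesis
  proof (rule ccontr)
    assume "\<not> thesis"
    then have all: "g \<bullet> x = 0" if "x \<in> C" for x using that \<open>\<And>x. x \<in> C \<Longrightarrow> g \<bullet> x \<noteq> 0 \<Longrightarrow> thesis\<close> by blast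
    define D where "D = top_of_set S2 interior_of C"
    obtain x where x: "x \<in> D" using int D_def by blast
    have D: "D \<subseteq> C" unfolding D_def by (rule interior_of_subset)
    have "openin (top_of_set S2) D" unfolding D_def by simp
    then obtain U where U: "open U" "D = S2 \<inter> U" by (auto simp: openin_open)
    have nx: "norm x = 1" using x U by simp
    have gx: "g \<bullet> x = 0" using all x D by blast
    obtain y where "y \<in> U" "norm y = 1" "g \<bullet> y < 0"
      using points_beyond_great_circle[OF g nx gx U(1)] U(2) x by blast
    moreover from this have "y \<in> C" using U(2) D by auto
    ultimately show False using all by fastforce
  qed
qed

lemma dual_no_antipodes:
  assumes "sph_convex_body C" "g \<in> dual C"
  shows "- g \<notin> dual C"
proof
  assume n: "- g \<in> dual C"
  obtain x where "x \<in> C" "g \<bullet> x \<noteq> 0"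
    using body_not_in_great_circle[OF assms(1) dual_unit[OF assms(2)]] .
  then show False using dual_nonneg[OF assms(2)] dual_nonneg[OF n] by (force simp: inner_minus_left)
qed

text \<open>As the body contains no antipodes, no positive combination of two of its points vanishes.\<close>

lemma convex_open_cone:
  assumes C: "sph_convex_body C"
  shows "convex {t *\<^sub>R x | t x. 0 < t \<and> x \<in> C}" (is "convex ?K")
proof (rule convexI)
  fix u v and a b :: real
  assume uv: "u \<in> ?K" "v \<in> ?K" and ab: "0 \<le> a" "0 \<le> b" "a + b = 1"
  obtain s x where u: "u = s *\<^sub>R x" "0 < s" "x \<in> C" using uv by blast
  obtain t y where v: "v = t *\<^sub>R y" "0 < t" "y \<in> C" using uv by blast
  let ?w = "(a * s) *\<^sub>R x + (b * t) *\<^sub>R y"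
  have w: "a *\<^sub>R u + b *\<^sub>R v = ?w" using u v by simp
  have "?w \<noteq> 0"
  proof
    assume "?w = 0"
    then have eq: "(a * s) *\<^sub>R x = - ((b * t) *\<^sub>R y)" by (simp add: eq_neg_iff_add_eq_0)
    then have "norm ((a * s) *\<^sub>R x) = norm ((b * t) *\<^sub>R y)" by simp
    then have "a * s = b * t"
      using body_unit[OF C u(3)] body_unit[OF C v(3)] ab u(2) v(2) by simp
    moreover have "a * s \<noteq> 0"
    proof
      assume "a * s = 0"
      then have "a = 0" "b = 0" using calculation u(2) v(2) by auto
      then show False using ab by simp
    qed
    ultimately have "x = - y" using eq by (metis scaleR_minus_right scaleR_cancel_left)
    then show False using body_no_antipodes[OF C v(3)] u(3) by simp
  qed
  then have "normalise ?w \<in> C" "0 < norm ?w"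
    using body_convex[OF C u(3) v(3)] ab u(2) v(2) by simp_all
  then show "a *\<^sub>R u + b *\<^sub>R v \<in> ?K"
    unfolding w by (intro CollectI exI[of _ "norm ?w"] exI[of _ "normalise ?w"]) (simp add: scale_normalise)
qed

lemma body_hull_subset_cone:
  assumes C: "sph_convex_body C"
  shows "convex hull C \<subseteq> {t *\<^sub>R x | t x. 0 < t \<and> x \<in> C}"
proof (rule hull_minimal)
  show "convex {t *\<^sub>R x | t x. 0 < t \<and> x \<in> C}" by (rule convex_open_cone[OF C])
  show "C \<subseteq> {t *\<^sub>R x | t x. 0 < t \<and> x \<in> C}"
  proof
    fix x assume "x \<in> C"
    then have "x = 1 *\<^sub>R x \<and> 0 < (1::real) \<and> x \<in> C" by simp
    then show "x \<in> {t *\<^sub>R x | t x. 0 < t \<and> x \<in> C}" by blast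
  qed
qed

lemma zero_notin_body_hull:
  assumes C: "sph_convex_body C"
  shows "0 \<notin> convex hull C"
proof
  assume "0 \<in> convex hull C"
  then obtain t x where "0 = t *\<^sub>R x" "0 < t" "x \<in> C" using body_hull_subset_cone[OF C] by blast
  then show False using body_unit[OF C] by fastforce
qed

lemma body_in_open_hemisphere:
  assumes C: "sph_convex_body C"
  obtains a where "norm a = 1" "\<And>x. x \<in> C \<Longrightarrow> 0 < a \<bullet> x"
proof -
  have "closed (convex hull C)" using body_compact[OF C] compact_convex_hull compact_imp_closed by blast
  then obtain a b where ab: "a \<noteq> 0" "0 < b" "\<forall>x\<in>convex hull C. a \<bullet> x > b"
    using separating_hyperplane_closed_0[OF convex_convex_hull _ zero_notin_body_hull[OF C]] by blast
  show ?thesis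
  proof
    show "norm (normalise a) = 1" using ab normalise_unit by blast
    fix x assume "x \<in> C"
    then have "b < a \<bullet> x" using ab(3) by (simp add: hull_inc)
    then show "0 < normalise a \<bullet> x" using ab(1,2) by (simp add: normalise_inner)
  qed
qed

text \<open>The body is recovered from its dual (bipolar theorem for the closed convex cone over the
  body).\<close>

lemma bipolar:
  assumes C: "sph_convex_body C" and p: "p \<noteq> 0" "\<And>g. g \<in> dual C \<Longrightarrow> 0 \<le> g \<bullet> p"
  shows "normalise p \<in> C"
proof -
  let ?K = "conic hull (convex hull C)"
  have ne: "C \<noteq> {}" using C by (auto simp: sph_convex_body_def)
  have K: "convex ?K" "closed ?K"
    using body_compact[OF C] compact_convex_hull zero_notin_body_hull[OF C]
    by (auto intro!: convex_conic_hull closed_conic_hull)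
  have "p \<in> ?K"
  proof (rule ccontr)
    assume "p \<notin> ?K"
    then obtain a b where ab: "a \<bullet> p < b" "\<forall>x\<in>?K. a \<bullet> x > b"
      using separating_hyperplane_closed_point[OF K] by blast
    have "0 \<in> ?K" using ne by simp
    then have "b < a \<bullet> 0" using ab by blast
    then have b: "b < 0" by simp
    have pos: "0 \<le> a \<bullet> x" if "x \<in> C" for x
    proof (rule ccontr)
      assume neg: "\<not> 0 \<le> a \<bullet> x"
      have "(b / (a \<bullet> x)) *\<^sub>R x \<in> ?K"
        using that b neg hull_inc[of x C convex] unfolding conic_hull_explicit
        by (intro CollectI exI[of _ "b / (a \<bullet> x)"] exI[of _ x]) (auto intro: divide_nonpos_neg)
      then have "a \<bullet> ((b / (a \<bullet> x)) *\<^sub>R x) > b" using ab by blast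
      then show False using neg by simp
    qed
    have "a \<noteq> 0" using ab b by auto
    then have "0 \<le> normalise a \<bullet> p" using p(2) normalise_in_dual pos by blast
    then have "0 \<le> a \<bullet> p" using \<open>a \<noteq> 0\<close>
      by (simp add: normalise_inner zero_le_divide_iff)
    then show False using ab b by simp
  qed
  then obtain t x where tx: "p = t *\<^sub>R x" "0 \<le> t" "x \<in> convex hull C"
    unfolding conic_hull_explicit by blast
  obtain r y where ry: "x = r *\<^sub>R y" "0 < r" "y \<in> C" using body_hull_subset_cone[OF C] tx(3) by blast
  have "p = (t * r) *\<^sub>R y" using tx ry by simp
  moreover have "0 < t * r" using tx ry p(1) by (cases "t = 0") auto
  ultimately have "normalise p = y" using normalise_scale normalise_id body_unit[OF C ry(3)] by metis
  then show ?thesis using ry by simp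
qed

text \<open>This finds boundary points of the dual: \<open>r *\<^sub>R a - v\<close> is in the dual cone and vanishes at \<open>x\<close>.\<close>

lemma ratio_attains_max:
  assumes C: "sph_convex_body C" and a: "\<And>x. x \<in> C \<Longrightarrow> 0 < a \<bullet> x"
  obtains r x where "x \<in> C" "v \<bullet> x = r * (a \<bullet> x)" "\<And>y. y \<in> C \<Longrightarrow> v \<bullet> y \<le> r * (a \<bullet> y)"
proof -
  have "C \<noteq> {}" using C by (auto simp: sph_convex_body_def)
  moreover have "continuous_on C (\<lambda>y. (v \<bullet> y) / (a \<bullet> y))"
    using a by (intro continuous_intros) fastforce
  ultimately obtain x where x: "x \<in> C" "\<forall>y\<in>C. (v \<bullet> y) / (a \<bullet> y) \<le> (v \<bullet> x) / (a \<bullet> x)"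
    using continuous_attains_sup[OF body_compact[OF C]] by blast
  show ?thesis
  proof (rule that[OF x(1)])
    show "v \<bullet> x = (v \<bullet> x) / (a \<bullet> x) * (a \<bullet> x)" using a[OF x(1)] by simp
    show "v \<bullet> y \<le> (v \<bullet> x) / (a \<bullet> x) * (a \<bullet> y)" if "y \<in> C" for y
      using bspec[OF x(2) that] a[OF that] by (simp only: pos_divide_le_eq)
  qed
qed

lemma compact_dual: "compact (dual C)"
proof -
  have "dual C = S2 \<inter> (\<Inter>x\<in>C. {g. 0 \<le> x \<bullet> g})" by (auto simp: dual_def inner_commute)
  moreover have "closed (\<Inter>x\<in>C. {g. 0 \<le> x \<bullet> g})" by (intro closed_INT ballI closed_halfspace_ge)
  ultimately show ?thesis using compact_Int_closed[OF compact_sphere] by simp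
qed

lemma compact_support_centres:
  assumes C: "sph_convex_body C"
  shows "compact (support_centres C)"
proof -
  have eq: "support_centres C = fst ` ((dual C \<times> C) \<inter> {p. fst p \<bullet> snd p = 0})"
    by (force simp: support_centres_def)
  have "closed {p :: (real^3) \<times> (real^3). fst p \<bullet> snd p = 0}"
    by (intro closed_Collect_eq continuous_intros)
  then have "compact ((dual C \<times> C) \<inter> {p. fst p \<bullet> snd p = 0})"
    using compact_Int_closed[OF compact_Times[OF compact_dual body_compact[OF C]]] by blast
  from compact_continuous_image[OF continuous_on_fst[OF continuous_on_id] this] eq
  show ?thesis by simp
qed

text \<open>Two opposite directions \<open>v\<close> and \<open>- v\<close> orthogonal to an interior point \<open>a\<close> of the dual lead to
  different boundary points. A second supporting hemisphere is what makes \<open>is_star\<close> satisfiable,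
  since the hemisphere itself does not form a lune with itself.\<close>

lemma other_support_centre:
  assumes C: "sph_convex_body C"
  obtains h where "h \<in> support_centres C" "h \<noteq> g"
proof -
  obtain a where a: "norm a = 1" "\<And>x. x \<in> C \<Longrightarrow> 0 < a \<bullet> x" using body_in_open_hemisphere[OF C] by blast
  obtain v where v: "norm v = 1" "v \<bullet> a = 0" using exists_unit_orthogonal[of a a] by blast
  have ex: "\<exists>r. r *\<^sub>R a - w \<noteq> 0 \<and> normalise (r *\<^sub>R a - w) \<in> support_centres C"
    if w: "norm w = 1" "w \<bullet> a = 0" for w
  proof -
    obtain r x where rx: "x \<in> C" "w \<bullet> x = r * (a \<bullet> x)" "\<And>y. y \<in> C \<Longrightarrow> w \<bullet> y \<le> r * (a \<bullet> y)"
      using ratio_attains_max[OF C a(2)] by metis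
    have n: "r *\<^sub>R a - w \<noteq> 0"
    proof
      assume "r *\<^sub>R a - w = 0"
      then have "w \<bullet> w = r * (w \<bullet> a)" by (metis eq_iff_diff_eq_0 inner_scaleR_right)
      then show False using w unit_inner_self by force
    qed
    have "normalise (r *\<^sub>R a - w) \<in> dual C"
      by (rule normalise_in_dual[OF n]) (use rx in \<open>simp add: inner_lin\<close>)
    moreover have "normalise (r *\<^sub>R a - w) \<bullet> x = 0"
      using rx(2) by (simp add: normalise_inner inner_lin)
    ultimately show ?thesis using rx(1) n by (auto simp: support_centres_def)
  qed
  obtain r where r: "r *\<^sub>R a - v \<noteq> 0" "normalise (r *\<^sub>R a - v) \<in> support_centres C" using ex v by blast
  obtain r' where r': "r' *\<^sub>R a - - v \<noteq> 0" "normalise (r' *\<^sub>R a - - v) \<in> support_centres C"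
    using ex[of "- v"] v by auto
  have "normalise (r *\<^sub>R a - v) \<noteq> normalise (r' *\<^sub>R a - - v)"
  proof
    assume eq: "normalise (r *\<^sub>R a - v) = normalise (r' *\<^sub>R a - - v)"
    have "v \<bullet> normalise (r *\<^sub>R a - v) = - 1 / norm (r *\<^sub>R a - v)"
      using v unit_inner_self[OF v(1)] by (simp add: inner_normalise inner_lin)
    moreover have "v \<bullet> normalise (r' *\<^sub>R a - - v) = 1 / norm (r' *\<^sub>R a - - v)"
      using v unit_inner_self[OF v(1)] by (simp add: inner_normalise inner_lin)
    moreover have "- 1 / norm (r *\<^sub>R a - v) < 0" "1 / norm (r' *\<^sub>R a - - v) > 0"
      using r(1) r'(1) by (simp_all add: divide_neg_pos)
    ultimately show False using eq by simp
  qed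
  then show ?thesis using that r r' by metis
qed

section \<open>Thickness in terms of the dual\<close>

text \<open>Minimal inner product means maximal distance on the sphere.\<close>

definition diametral :: "(real ^ 3) set \<Rightarrow> real ^ 3 \<Rightarrow> real ^ 3 \<Rightarrow> bool" where
  "diametral C g h \<longleftrightarrow> g \<in> dual C \<and> h \<in> dual C \<and>
     (\<forall>g'\<in>dual C. \<forall>h'\<in>dual C. g \<bullet> h \<le> g' \<bullet> h')"

lemma diametralD:
  assumes "diametral C g h"
  shows "g \<in> dual C" "h \<in> dual C" "\<And>g' h'. g' \<in> dual C \<Longrightarrow> h' \<in> dual C \<Longrightarrow> g \<bullet> h \<le> g' \<bullet> h'"
  using assms unfolding diametral_def by blast+

lemma bd_subset_body: "sph_convex_body C \<Longrightarrow> bd C \<subseteq> C"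
  unfolding bd_def frontier_of_def sph_convex_body_def by (auto simp: closure_of_closedin)

lemma contact_in_bd:
  assumes C: "sph_convex_body C" and g: "g \<in> dual C" and x: "x \<in> C" "g \<bullet> x = 0"
  shows "x \<in> bd C"
proof -
  have "x \<notin> top_of_set S2 interior_of C"
  proof
    assume "x \<in> top_of_set S2 interior_of C"
    then obtain T where T: "openin (top_of_set S2) T" "x \<in> T" "T \<subseteq> C" by (auto simp: interior_of_def)
    obtain U where U: "open U" "T = S2 \<inter> U" using T(1) by (auto simp: openin_open)
    have "x \<in> U" using U(2) T(2) by blast
    then obtain y where "y \<in> U" "norm y = 1" "g \<bullet> y < 0"
      using points_beyond_great_circle[OF dual_unit[OF g] body_unit[OF C x(1)] x(2) U(1)] by blast
    moreover from this have "y \<in> C" using T(3) U(2) by auto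
    ultimately show False using dual_nonneg[OF g] by fastforce
  qed
  moreover have "top_of_set S2 closure_of C = C"
    using C by (simp add: sph_convex_body_def closure_of_closedin)
  ultimately show ?thesis using x(1) by (simp add: bd_def frontier_of_def)
qed

lemma supports_iff:
  assumes C: "sph_convex_body C"
  shows "supports K C \<longleftrightarrow> (\<exists>g\<in>support_centres C. K = hemisphere_at g)"
proof
  assume s: "supports K C"
  then have "hemisphere K" by (simp add: supports_def)
  then obtain g where g: "norm g = 1" "K = hemisphere_at g" by (rule hemisphere_cases)
  have "C \<subseteq> hemisphere_at g" using s g by (simp add: supports_def)
  then have "g \<in> dual C" using g(1) hemisphere_at_iff[OF g(1)] by (auto simp: dual_def)
  moreover obtain x where "x \<in> bd C" "x \<in> bd (hemisphere_at g)" using s g by (auto simp: supports_def)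
  then have "x \<in> C" "g \<bullet> x = 0" using bd_subset_body[OF C] bd_hemisphere_iff[OF g(1)] by auto
  ultimately show "\<exists>g\<in>support_centres C. K = hemisphere_at g"
    unfolding support_centres_def using g(2) by blast
next
  assume "\<exists>g\<in>support_centres C. K = hemisphere_at g"
  then obtain g x where g: "g \<in> dual C" "K = hemisphere_at g" and x: "x \<in> C" "g \<bullet> x = 0"
    by (auto simp: support_centres_def)
  have n: "norm g = 1" using dual_unit g by blast
  have "hemisphere K" using n g by (auto simp: hemisphere_def)
  moreover have "C \<subseteq> K"
    using g(1) body_unit[OF C] hemisphere_at_iff[OF n] unfolding g(2) by (auto simp: dual_def)
  moreover have "x \<in> bd C" using contact_in_bd[OF C g(1) x] .
  moreover have "x \<in> bd K" unfolding g(2) bd_hemisphere_iff[OF n] using x body_unit[OF C] by blast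
  ultimately show "supports K C" by (auto simp: supports_def)
qed

lemma support_centres_subset_dual: "support_centres C \<subseteq> dual C"
  by (auto simp: support_centres_def)

lemma support_centres_minimum:
  assumes C: "sph_convex_body C"
  obtains h where "h \<in> support_centres C" "\<And>h'. h' \<in> support_centres C \<Longrightarrow> g \<bullet> h \<le> g \<bullet> h'"
proof -
  have "support_centres C \<noteq> {}" using other_support_centre[OF C] by blast
  moreover have "continuous_on (support_centres C) (\<lambda>h. g \<bullet> h)" by (intro continuous_intros)
  ultimately show ?thesis
    using continuous_attains_inf[OF compact_support_centres[OF C]] that by metis
qed

lemma dual_pair_strict:
  assumes C: "sph_convex_body C" and "g \<in> dual C" "h \<in> dual C" "g \<noteq> h"
  shows "(g \<bullet> h)\<^sup>2 < 1"
proof (rule unit_inner_strict)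
  show "g \<noteq> - h" using dual_no_antipodes[OF C assms(3)] assms(2) by blast
qed (use assms dual_unit in auto)

lemma dual_lune_thickness:
  assumes C: "sph_convex_body C" and "g \<in> dual C" "h \<in> dual C" "g \<noteq> h"
  shows "lune_pair (hemisphere_at g) (hemisphere_at h)"
    "lune_thickness (hemisphere_at g) (hemisphere_at h) = arccos (- (g \<bullet> h))"
proof -
  have n: "norm g = 1" "norm h = 1" using assms dual_unit by auto
  have "h \<noteq> - g" using dual_no_antipodes[OF C assms(2)] assms(3) by blast
  then show "lune_pair (hemisphere_at g) (hemisphere_at h)" using lune_pair_iff[OF n] assms(4) by blast
  show "lune_thickness (hemisphere_at g) (hemisphere_at h) = arccos (- (g \<bullet> h))"
    using lune_thickness_eq[OF n dual_pair_strict[OF assms]] .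
qed

lemma is_star_iff:
  assumes C: "sph_convex_body C" and g: "g \<in> support_centres C"
  shows "is_star C (hemisphere_at g) K \<longleftrightarrow>
    (\<exists>h\<in>support_centres C. K = hemisphere_at h \<and> (\<forall>h'\<in>support_centres C. g \<bullet> h \<le> g \<bullet> h'))"
proof
  have gd: "g \<in> dual C" using g support_centres_subset_dual by blast
  note gn = dual_unit[OF gd]
  {
    assume star: "is_star C (hemisphere_at g) K"
    then have K: "supports K C" "lune_pair (hemisphere_at g) K"
      and min: "\<And>K'. supports K' C \<Longrightarrow> lune_pair (hemisphere_at g) K' \<Longrightarrow>
        \<not> lune_thickness (hemisphere_at g) K' < lune_thickness (hemisphere_at g) K"
      by (auto simp: is_star_def is_arg_min_def)
    obtain h where h: "h \<in> support_centres C" "K = hemisphere_at h" using K supports_iff[OF C] by blast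
    have hd: "h \<in> dual C" using h support_centres_subset_dual by blast
    have gh: "g \<noteq> h" using K(2) lune_pair_iff[OF gn dual_unit[OF hd]] h(2) by blast
    have "g \<bullet> h \<le> g \<bullet> h'" if h': "h' \<in> support_centres C" for h'
    proof (cases "h' = g")
      case True
      then show ?thesis
        using unit_inner_bound[OF gn dual_unit[OF hd]] unit_inner_self[OF gn] by simp
    next
      case False
      have h'd: "h' \<in> dual C" using h' support_centres_subset_dual by blast
      have "\<not> arccos (- (g \<bullet> h')) < arccos (- (g \<bullet> h))"
        using min[of "hemisphere_at h'"] dual_lune_thickness[OF C gd h'd] dual_lune_thickness[OF C gd hd gh]
          False h' h(2) supports_iff[OF C] by auto
      then show ?thesis
        using arccos_less_mono[of "- (g \<bullet> h')" "- (g \<bullet> h)"]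
          unit_inner_bound[OF gn dual_unit[OF hd]] unit_inner_bound[OF gn dual_unit[OF h'd]] by simp
    qed
    then show "\<exists>h\<in>support_centres C. K = hemisphere_at h \<and> (\<forall>h'\<in>support_centres C. g \<bullet> h \<le> g \<bullet> h')"
      using h by blast
  }
  {
    assume "\<exists>h\<in>support_centres C. K = hemisphere_at h \<and> (\<forall>h'\<in>support_centres C. g \<bullet> h \<le> g \<bullet> h')"
    then obtain h where h: "h \<in> support_centres C" "K = hemisphere_at h"
      and min: "\<And>h'. h' \<in> support_centres C \<Longrightarrow> g \<bullet> h \<le> g \<bullet> h'" by blast
    have hd: "h \<in> dual C" using h support_centres_subset_dual by blast
    have gh: "g \<noteq> h"
    proof
      assume eq: "g = h"
      obtain h' where h': "h' \<in> support_centres C" "h' \<noteq> g" using other_support_centre[OF C] by blast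
      then have "norm h' = 1" using support_centres_subset_dual dual_unit by blast
      then show False using min[OF h'(1)] unit_eqI[OF gn, of h'] unit_inner_self[OF gn] h'(2) eq by simp
    qed
    show "is_star C (hemisphere_at g) K"
      unfolding is_star_def is_arg_min_def
    proof (intro conjI notI)
      show "supports K C" using h supports_iff[OF C] by blast
      show "lune_pair (hemisphere_at g) K" unfolding h(2) by (rule dual_lune_thickness(1)[OF C gd hd gh])
      assume "\<exists>y. (supports y C \<and> lune_pair (hemisphere_at g) y) \<and>
        lune_thickness (hemisphere_at g) y < lune_thickness (hemisphere_at g) K"
      then obtain K' where K': "supports K' C" "lune_pair (hemisphere_at g) K'"
        "lune_thickness (hemisphere_at g) K' < lune_thickness (hemisphere_at g) K" by blast
      obtain h' where h'S: "h' \<in> support_centres C" "K' = hemisphere_at h'"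
        using supports_iff[OF C] K'(1) by blast
      note h' = h'S(1) K'(2,3)[unfolded h'S(2)]
      have h'd: "h' \<in> dual C" using h' support_centres_subset_dual by blast
      have "g \<noteq> h'" using h'(2) lune_pair_iff[OF gn dual_unit[OF h'd]] by blast
      then have "arccos (- (g \<bullet> h')) < arccos (- (g \<bullet> h))"
        using h'(3) dual_lune_thickness(2)[OF C gd h'd] dual_lune_thickness(2)[OF C gd hd gh] h(2) by simp
      then have "g \<bullet> h' < g \<bullet> h"
        using arccos_less_mono[of "- (g \<bullet> h')" "- (g \<bullet> h)"]
          unit_inner_bound[OF gn dual_unit[OF hd]] unit_inner_bound[OF gn dual_unit[OF h'd]] by simp
      then show False using min[OF h'(1)] by simp
    qed
  }
qed

lemma width_eq:
  assumes C: "sph_convex_body C" and g: "g \<in> support_centres C" and h: "h \<in> support_centres C"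
    and min: "\<And>h'. h' \<in> support_centres C \<Longrightarrow> g \<bullet> h \<le> g \<bullet> h'"
  shows "width (hemisphere_at g) C = arccos (- (g \<bullet> h))"
proof -
  let ?K = "SOME K'. is_star C (hemisphere_at g) K'"
  have "is_star C (hemisphere_at g) (hemisphere_at h)" using is_star_iff[OF C g] h min by blast
  then have star: "is_star C (hemisphere_at g) ?K" by (rule someI)
  then obtain k where k: "k \<in> support_centres C" "?K = hemisphere_at k"
    "\<forall>h'\<in>support_centres C. g \<bullet> k \<le> g \<bullet> h'" using is_star_iff[OF C g] by blast
  have eq: "g \<bullet> k = g \<bullet> h" using k min h by (meson order_antisym)
  have gk: "g \<in> dual C" "k \<in> dual C" using g k support_centres_subset_dual by auto
  have "lune_pair (hemisphere_at g) (hemisphere_at k)"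
    using star k(2) by (simp add: is_star_def is_arg_min_def)
  then have "g \<noteq> k" using lune_pair_iff dual_unit gk by blast
  then show ?thesis
    unfolding width_def k(2) using dual_lune_thickness(2)[OF C gk] eq by simp
qed

lemma thickness_eq:
  assumes C: "sph_convex_body C"
  obtains g h where "g \<in> support_centres C" "h \<in> support_centres C" "thickness C = arccos (- (g \<bullet> h))"
    "\<And>g' h'. g' \<in> support_centres C \<Longrightarrow> h' \<in> support_centres C \<Longrightarrow> g \<bullet> h \<le> g' \<bullet> h'"
proof -
  let ?S = "support_centres C"
  have "?S \<noteq> {}" using other_support_centre[OF C] by blast
  then have "?S \<times> ?S \<noteq> {}" by blast
  moreover have "compact (?S \<times> ?S)" using compact_support_centres[OF C] compact_Times by blast
  moreover have "continuous_on (?S \<times> ?S) (\<lambda>p. fst p \<bullet> snd p)" by (intro continuous_intros)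
  ultimately obtain p where p: "p \<in> ?S \<times> ?S" "\<forall>q\<in>?S \<times> ?S. fst p \<bullet> snd p \<le> fst q \<bullet> snd q"
    using continuous_attains_inf by (metis (no_types, lifting))
  define g h where "g = fst p" and "h = snd p"
  have gh: "g \<in> ?S" "h \<in> ?S" and min: "\<And>g' h'. g' \<in> ?S \<Longrightarrow> h' \<in> ?S \<Longrightarrow> g \<bullet> h \<le> g' \<bullet> h'"
    using p unfolding g_def h_def by (auto simp: mem_Times_iff) 
  have bound: "\<bar>g' \<bullet> h'\<bar> \<le> 1" if "g' \<in> ?S" "h' \<in> ?S" for g' h'
    using that support_centres_subset_dual dual_unit unit_inner_bound by blast
  have "thickness C = arccos (- (g \<bullet> h))"
    unfolding thickness_def
  proof (rule Least_equality)
    show "\<exists>K. supports K C \<and> arccos (- (g \<bullet> h)) = width K C"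
      using width_eq[OF C gh] min gh supports_iff[OF C] by metis
    fix w assume "\<exists>K. supports K C \<and> w = width K C"
    then obtain K where K: "supports K C" "w = width K C" by blast
    then obtain g' where g'S: "g' \<in> ?S" "K = hemisphere_at g'" using supports_iff[OF C] by blast
    note g' = g'S(1) K(2)[unfolded g'S(2)]
    obtain h' where h': "h' \<in> ?S" "\<And>k. k \<in> ?S \<Longrightarrow> g' \<bullet> h' \<le> g' \<bullet> k"
      using support_centres_minimum[OF C] by blast
    have "w = arccos (- (g' \<bullet> h'))" using width_eq[OF C g'(1) h'] g'(2) by simp
    then show "arccos (- (g \<bullet> h)) \<le> w"
      using min[OF g'(1) h'(1)] arccos_le_mono[of "- (g \<bullet> h)" "- (g' \<bullet> h')"] bound gh g'(1) h'(1) by simp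
  qed
  then show ?thesis using that gh min by blast
qed

lemma foot_normalise:
  assumes "norm g = 1" "norm h = 1" "(g \<bullet> h)\<^sup>2 < 1"
  shows "foot g h = normalise (h - (g \<bullet> h) *\<^sub>R g)"
proof -
  let ?s = "sqrt (1 - (g \<bullet> h)\<^sup>2)"
  have "0 < inverse ?s" using assms(3) by simp
  then have "normalise (foot g h) = normalise (h - (g \<bullet> h) *\<^sub>R g)"
    unfolding foot_def by (rule normalise_scale)
  then show ?thesis using foot_props(1)[OF assms] normalise_id by metis
qed

text \<open>On the cone over the dual the function \<open>h \<bullet> q - (g \<bullet> h) * norm q\<close> is convex, as \<open>g \<bullet> h\<close> is
  negative, and has the minimum \<open>0\<close> at \<open>g\<close>. So its gradient \<open>h - (g \<bullet> h) *\<^sub>R g\<close> at \<open>g\<close> is nonnegative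
  on the dual, and the bipolar theorem applies to it.\<close>

lemma foot_in_body:
  assumes C: "sph_convex_body C" and g: "g \<in> dual C" and h: "h \<in> dual C" and neg: "g \<bullet> h < 0"
    and min: "\<And>q. q \<in> dual C \<Longrightarrow> g \<bullet> h \<le> q \<bullet> h"
  shows "foot g h \<in> C"
proof -
  note gn = dual_unit[OF g] and hn = dual_unit[OF h]
  have ne: "g \<noteq> h" using neg unit_inner_self[OF gn] by auto
  note strict = dual_pair_strict[OF C g h ne]
  let ?p = "h - (g \<bullet> h) *\<^sub>R g"
  have p0: "?p \<noteq> 0"
  proof
    assume "?p = 0"
    then have "foot g h = 0" by (simp add: foot_def)
    then show False using foot_props(1)[OF gn hn strict] by simp
  qed
  have "0 \<le> q \<bullet> ?p" if q: "q \<in> dual C" for q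
  proof -
    note qn = dual_unit[OF q]
    have bound: "(g \<bullet> h) * t / 2 \<le> q \<bullet> ?p" if t: "0 < t" for t
    proof -
      let ?v = "g + t *\<^sub>R q"
      have v2: "(norm ?v)\<^sup>2 = 1 + 2 * t * (g \<bullet> q) + t\<^sup>2"
        unfolding power2_norm_eq_inner
        using unit_inner_self[OF gn] unit_inner_self[OF qn]
        by (simp add: inner_lin inner_commute power2_eq_square algebra_simps)
      have "norm ?v \<le> 1 + t * (g \<bullet> q) + t\<^sup>2 / 2"
      proof -
        have "0 \<le> (norm ?v - 1)\<^sup>2" by simp
        then show ?thesis using v2 by (simp add: power2_diff)
      qed
      then have "(g \<bullet> h) * (1 + t * (g \<bullet> q) + t\<^sup>2 / 2) \<le> (g \<bullet> h) * norm ?v"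
        using neg by (simp add: mult_left_mono_neg)
      also have "(g \<bullet> h) * norm ?v \<le> ?v \<bullet> h"
      proof (cases "?v = 0")
        case False
        have "normalise ?v \<in> dual C"
          using normalise_in_dual[OF False] dual_nonneg[OF g] dual_nonneg[OF q] t
          by (simp add: inner_lin)
        then have "g \<bullet> h \<le> (?v \<bullet> h) / norm ?v" using min[of "normalise ?v"] by (simp add: normalise_inner)
        then show ?thesis using False by (simp add: pos_le_divide_eq)
      qed simp
      finally have "t * ((g \<bullet> h) * t / 2) \<le> t * (q \<bullet> ?p)"
        by (simp add: inner_lin inner_commute power2_eq_square algebra_simps)
      then show ?thesis using t by (simp add: mult_le_cancel_left_pos)
    qed
    show ?thesis
    proof (rule ccontr)
      assume n: "\<not> 0 \<le> q \<bullet> ?p"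
      define t where "t = (q \<bullet> ?p) / (g \<bullet> h)"
      have "0 < t" using n neg by (simp add: t_def divide_neg_neg)
      from bound[OF this] show False using n neg by (simp add: t_def)
    qed
  qed
  then have "normalise ?p \<in> C" using bipolar[OF C p0] by blast
  then show ?thesis using foot_normalise[OF gn hn strict] by simp
qed

text \<open>The diameter of the dual is attained at centres of supporting hemispheres, because both feet of
  a diametral pair are points of contact.\<close>

lemma thickness_dual:
  assumes C: "sph_convex_body C" and thin: "thickness C < pi / 2"
  obtains g h where "diametral C g h" "thickness C = arccos (- (g \<bullet> h))" "g \<bullet> h < 0"
proof -
  let ?D = "dual C"
  obtain g0 h0 where S: "g0 \<in> support_centres C" "h0 \<in> support_centres C"
    and t: "thickness C = arccos (- (g0 \<bullet> h0))"
    and Smin: "\<And>g' h'. g' \<in> support_centres C \<Longrightarrow> h' \<in> support_centres C \<Longrightarrow> g0 \<bullet> h0 \<le> g' \<bullet> h'"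
    using thickness_eq[OF C] by blast
  have D0: "g0 \<in> ?D" "h0 \<in> ?D" using S support_centres_subset_dual by auto
  have "\<bar>g0 \<bullet> h0\<bar> \<le> 1" using D0 dual_unit unit_inner_bound by blast
  then have neg: "g0 \<bullet> h0 < 0"
    using thin t arccos_less_mono[of "- (g0 \<bullet> h0)" 0] by simp
  have "?D \<times> ?D \<noteq> {}" using D0 by blast
  moreover have "compact (?D \<times> ?D)" using compact_dual compact_Times by blast
  moreover have "continuous_on (?D \<times> ?D) (\<lambda>p. fst p \<bullet> snd p)" by (intro continuous_intros)
  ultimately obtain p where p: "p \<in> ?D \<times> ?D" "\<forall>q\<in>?D \<times> ?D. fst p \<bullet> snd p \<le> fst q \<bullet> snd q"
    using continuous_attains_inf by (metis (no_types, lifting))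
  define g h where "g = fst p" and "h = snd p"
  have gh: "g \<in> ?D" "h \<in> ?D" and min: "\<And>g' h'. g' \<in> ?D \<Longrightarrow> h' \<in> ?D \<Longrightarrow> g \<bullet> h \<le> g' \<bullet> h'"
    using p unfolding g_def h_def by (auto simp: mem_Times_iff) 
  have negm: "g \<bullet> h < 0" using min[OF D0] neg by simp
  have sym: "h \<bullet> g = g \<bullet> h" by (rule inner_commute)
  have "foot g h \<in> C" using foot_in_body[OF C gh negm] min gh by blast
  moreover have "foot h g \<in> C" using foot_in_body[OF C gh(2,1)] negm min gh unfolding sym by blast
  moreover have "g \<noteq> h" using negm unit_inner_self[OF dual_unit[OF gh(1)]] by auto
  then have "(g \<bullet> h)\<^sup>2 < 1" "(h \<bullet> g)\<^sup>2 < 1" using dual_pair_strict[OF C gh] unfolding sym by blast+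
  then have "g \<bullet> foot g h = 0" "h \<bullet> foot h g = 0" using foot_props(2) gh dual_unit by blast+
  ultimately have "g \<in> support_centres C" "h \<in> support_centres C"
    using gh by (auto simp: support_centres_def)
  then have "g \<bullet> h = g0 \<bullet> h0" using Smin min[OF D0] by (simp add: order_antisym)
  moreover have "diametral C g h" unfolding diametral_def using gh min by blast
  ultimately show ?thesis using that t negm by simp
qed

section \<open>Extreme points of reduced bodies\<close>

definition sph_extreme :: "(real ^ 3) set \<Rightarrow> real ^ 3 \<Rightarrow> bool" where
  "sph_extreme C e \<longleftrightarrow> e \<in> C \<and>
     (\<forall>a\<in>C. \<forall>b\<in>C. \<forall>s t. 0 < s \<and> 0 < t \<and> e = s *\<^sub>R a + t *\<^sub>R b \<longrightarrow> a = e)"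

lemma extreme_point_of_face:
  assumes C: "sph_convex_body C" and q: "q \<noteq> 0" "\<And>y. y \<in> C \<Longrightarrow> 0 \<le> q \<bullet> y"
    and x: "x \<in> C" "q \<bullet> x = 0"
  obtains e where "sph_extreme C e" "q \<bullet> e = 0"
proof -
  obtain a where a: "norm a = 1" "\<And>x. x \<in> C \<Longrightarrow> 0 < a \<bullet> x" using body_in_open_hemisphere[OF C] by blast
  obtain w where w: "norm w = 1" "w \<bullet> q = 0" "w \<bullet> a = 0" using exists_unit_orthogonal by blast
  \<comment> \<open>The face lies in the great circle orthogonal to \<open>q\<close>; the ratio \<open>w \<bullet> y / a \<bullet> y\<close> orders its
    points, and the last one is extreme.\<close>
  let ?F = "C \<inter> {y. q \<bullet> y = 0}"
  have "compact ?F" using body_compact[OF C] closed_hyperplane compact_Int_closed by blast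
  moreover have "?F \<noteq> {}" using x by blast
  moreover have "continuous_on ?F (\<lambda>y. (w \<bullet> y) / (a \<bullet> y))"
    using a(2) by (intro continuous_intros) fastforce
  ultimately obtain e where e: "e \<in> ?F" "\<forall>y\<in>?F. (w \<bullet> y) / (a \<bullet> y) \<le> (w \<bullet> e) / (a \<bullet> e)"
    using continuous_attains_sup[of ?F "\<lambda>y. (w \<bullet> y) / (a \<bullet> y)"] by blast
  define u where "u = w - ((w \<bullet> e) / (a \<bullet> e)) *\<^sub>R a"
  have eC: "e \<in> C" "q \<bullet> e = 0" using e(1) by auto
  have ue: "u \<bullet> e = 0" using a(2)[OF eC(1)] by (simp add: u_def inner_lin)
  have le: "u \<bullet> y \<le> 0" if "y \<in> C" "q \<bullet> y = 0" for y
  proof -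
    have "(w \<bullet> y) / (a \<bullet> y) \<le> (w \<bullet> e) / (a \<bullet> e)" using e(2) that by blast
    then have "w \<bullet> y \<le> (w \<bullet> e) / (a \<bullet> e) * (a \<bullet> y)" using a(2)[OF that(1)] by (simp only: pos_divide_le_eq)
    then show ?thesis by (simp add: u_def inner_lin)
  qed
  have uw: "u \<bullet> w = 1"
    using w unit_inner_self[OF w(1)] by (simp add: u_def inner_lin inner_commute)
  then have u0: "u \<noteq> 0" by auto
  have strict: "(normalise q \<bullet> normalise u)\<^sup>2 \<noteq> 1"
  proof -
    have *: "normalise u \<bullet> w \<noteq> 0" "normalise q \<bullet> w = 0"
      using uw w(2) u0 unfolding normalise_inner by (simp_all add: inner_commute[of q w])
    then have "normalise q \<noteq> normalise u" "normalise q \<noteq> - normalise u" by auto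
    then have "(normalise q \<bullet> normalise u)\<^sup>2 < 1"
      by (rule unit_inner_strict[OF normalise_unit[OF q(1)] normalise_unit[OF u0]])
    then show ?thesis by simp
  qed
  have en: "norm e = 1" using body_unit[OF C eC(1)] .
  have "sph_extreme C e"
    unfolding sph_extreme_def
  proof (intro conjI ballI allI impI)
    show "e \<in> C" by fact
    fix b d s t assume bd: "b \<in> C" "d \<in> C" and st: "0 < s \<and> 0 < t \<and> e = s *\<^sub>R b + t *\<^sub>R d"
    have e_eq: "f \<bullet> e = s * (f \<bullet> b) + t * (f \<bullet> d)" for f using st by (simp add: inner_lin)
    have "s * (q \<bullet> b) + t * (q \<bullet> d) = 0" using e_eq[of q] eC(2) by simp
    moreover have "0 \<le> s * (q \<bullet> b)" "0 \<le> t * (q \<bullet> d)" using q(2) bd st by simp_all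
    ultimately have "s * (q \<bullet> b) = 0" "t * (q \<bullet> d) = 0" by linarith+
    then have qb: "q \<bullet> b = 0" and qd: "q \<bullet> d = 0" using st by auto
    have "s * (u \<bullet> b) + t * (u \<bullet> d) = 0" using e_eq[of u] ue by simp
    moreover have "s * (u \<bullet> b) \<le> 0" "t * (u \<bullet> d) \<le> 0"
      using le[OF bd(1) qb] le[OF bd(2) qd] st by (simp_all add: mult_nonneg_nonpos)
    ultimately have "s * (u \<bullet> b) = 0" by linarith
    then have ub: "u \<bullet> b = 0" using st by auto
    let ?v = "b - (b \<bullet> e) *\<^sub>R e"
    have "?v = 0"
    proof (rule orthogonal_to_plane_and_normal[OF normalise_unit[OF q(1)] normalise_unit[OF u0] strict])
      show "?v \<bullet> normalise q = 0" "e \<bullet> normalise q = 0"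
        using qb eC(2) by (simp_all add: inner_normalise inner_lin inner_commute)
      show "?v \<bullet> normalise u = 0" "e \<bullet> normalise u = 0"
        using ub ue by (simp_all add: inner_normalise inner_lin inner_commute)
      show "?v \<bullet> e = 0" using unit_inner_self[OF en] by (simp add: inner_lin)
      show "e \<noteq> 0" using en by auto
    qed
    then have b: "b = (b \<bullet> e) *\<^sub>R e" by simp
    have "a \<bullet> b = (b \<bullet> e) * (a \<bullet> e)" by (subst b) simp
    then have "0 < b \<bullet> e" using a(2)[OF bd(1)] a(2)[OF eC(1)] by (simp add: zero_less_mult_iff)
    then show "b = e" using unit_multiple[OF en body_unit[OF C bd(1)] b] by simp
  qed
  then show ?thesis using that eC(2) by blast
qed

definition cut :: "(real ^ 3) set \<Rightarrow> real ^ 3 \<Rightarrow> real \<Rightarrow> (real ^ 3) set" where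
  "cut C e \<epsilon> = normalise ` (convex hull (C - ball e \<epsilon>))"

lemma cut_superset:
  assumes "sph_convex_body C"
  shows "C - ball e \<epsilon> \<subseteq> cut C e \<epsilon>"
proof
  fix x assume x: "x \<in> C - ball e \<epsilon>"
  then have "x \<in> convex hull (C - ball e \<epsilon>)" by (rule hull_inc)
  moreover have "x = normalise x" using x normalise_id body_unit[OF assms] by auto
  ultimately show "x \<in> cut C e \<epsilon>" unfolding cut_def by (rule image_eqI[rotated])
qed

text \<open>Extremality says that the ray through \<open>e\<close> can be removed from the cone over \<open>C\<close> without
  destroying convexity; hence the hull of the remaining points does not meet it again.\<close>

lemma cone_without_extreme_ray_convex:
  assumes C: "sph_convex_body C" and e: "sph_extreme C e"
  shows "convex {t *\<^sub>R x | t x. 0 < t \<and> x \<in> C \<and> x \<noteq> e}" (is "convex ?K")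
proof (rule convexI)
  fix u v and a b :: real
  assume uv: "u \<in> ?K" "v \<in> ?K" and ab: "0 \<le> a" "0 \<le> b" "a + b = 1"
  obtain s x where u: "u = s *\<^sub>R x" "0 < s" "x \<in> C" "x \<noteq> e" using uv by blast
  obtain t y where v: "v = t *\<^sub>R y" "0 < t" "y \<in> C" "y \<noteq> e" using uv by blast
  have "u \<in> {t *\<^sub>R x | t x. 0 < t \<and> x \<in> C}" "v \<in> {t *\<^sub>R x | t x. 0 < t \<and> x \<in> C}" using u v by blast+
  then have "a *\<^sub>R u + b *\<^sub>R v \<in> {t *\<^sub>R x | t x. 0 < t \<and> x \<in> C}"
    using convexD[OF convex_open_cone[OF C]] ab by blast
  then obtain r z where z: "a *\<^sub>R u + b *\<^sub>R v = r *\<^sub>R z" "0 < r" "z \<in> C" by blast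
  show "a *\<^sub>R u + b *\<^sub>R v \<in> ?K"
  proof (cases "a = 0 \<or> b = 0")
    case True
    then have "a *\<^sub>R u + b *\<^sub>R v = v \<or> a *\<^sub>R u + b *\<^sub>R v = u" using ab by auto
    then show ?thesis using uv by (elim disjE) (simp_all only:)
  next
    case False
    have "z \<noteq> e"
    proof
      assume "z = e"
      have "z = (1 / r) *\<^sub>R (a *\<^sub>R u + b *\<^sub>R v)" unfolding z(1) using z(2) by simp
      then have "e = (a * s / r) *\<^sub>R x + (b * t / r) *\<^sub>R y"
        unfolding u(1) v(1) \<open>z = e\<close> by (simp add: scaleR_add_right)
      moreover have "0 < a * s / r" "0 < b * t / r" using False ab u(2) v(2) z(2) by auto
      ultimately have "x = e" using e u(3) v(3) unfolding sph_extreme_def by blast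
      then show False using u by blast
    qed
    then show ?thesis using z by auto
  qed
qed

lemma cut_subset:
  assumes C: "sph_convex_body C" and e: "sph_extreme C e" and \<epsilon>: "0 < \<epsilon>"
  shows "convex hull (C - ball e \<epsilon>) \<subseteq> {t *\<^sub>R x | t x. 0 < t \<and> x \<in> C \<and> x \<noteq> e}"
    "cut C e \<epsilon> \<subseteq> C - {e}" "0 \<notin> convex hull (C - ball e \<epsilon>)"
proof -
  show 1: "convex hull (C - ball e \<epsilon>) \<subseteq> {t *\<^sub>R x | t x. 0 < t \<and> x \<in> C \<and> x \<noteq> e}"
  proof (rule hull_minimal)
    show "convex {t *\<^sub>R x | t x. 0 < t \<and> x \<in> C \<and> x \<noteq> e}" by (rule cone_without_extreme_ray_convex[OF C e])
    show "C - ball e \<epsilon> \<subseteq> {t *\<^sub>R x | t x. 0 < t \<and> x \<in> C \<and> x \<noteq> e}"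
    proof
      fix x assume "x \<in> C - ball e \<epsilon>"
      then have "x = 1 *\<^sub>R x \<and> 0 < (1::real) \<and> x \<in> C \<and> x \<noteq> e" using \<epsilon> by auto
      then show "x \<in> {t *\<^sub>R x | t x. 0 < t \<and> x \<in> C \<and> x \<noteq> e}" by blast
    qed
  qed
  show "cut C e \<epsilon> \<subseteq> C - {e}"
  proof
    fix z assume "z \<in> cut C e \<epsilon>"
    then obtain v where v: "v \<in> convex hull (C - ball e \<epsilon>)" "z = normalise v" by (auto simp: cut_def)
    then obtain t x where "v = t *\<^sub>R x" "0 < t" "x \<in> C" "x \<noteq> e" using 1 by blast
    moreover from this have "z = x" using v normalise_scale normalise_id body_unit[OF C] by metis
    ultimately show "z \<in> C - {e}" by simp
  qed
  show "0 \<notin> convex hull (C - ball e \<epsilon>)" using 1 zero_notin_body_hull[OF C] hull_mono[of "C - ball e \<epsilon>" C convex] by blast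
qed

lemma continuous_on_normalise: "0 \<notin> S \<Longrightarrow> continuous_on S normalise"
  unfolding normalise_def by (intro continuous_intros) auto

lemma cut_convex:
  assumes C: "sph_convex_body C" and e: "sph_extreme C e" and \<epsilon>: "0 < \<epsilon>"
  shows "sph_convex (cut C e \<epsilon>)"
proof -
  let ?H = "convex hull (C - ball e \<epsilon>)"
  have sub: "cut C e \<epsilon> \<subseteq> C" using cut_subset[OF assms] by blast
  have n0: "v \<noteq> 0" if "v \<in> ?H" for v using that cut_subset(3)[OF assms] by blast
  have "great_arc a b \<subseteq> cut C e \<epsilon>" if ab: "a \<in> cut C e \<epsilon>" "b \<in> cut C e \<epsilon>" for a b
  proof
    fix x assume "x \<in> great_arc a b"
    then obtain s t where x: "norm x = 1" "0 \<le> s" "0 \<le> t" "x = s *\<^sub>R a + t *\<^sub>R b"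
      by (auto simp: great_arc_def)
    obtain v where v: "v \<in> ?H" "a = normalise v" using ab by (auto simp: cut_def)
    obtain w where w: "w \<in> ?H" "b = normalise w" using ab by (auto simp: cut_def)
    define s' t' where "s' = s / norm v" and "t' = t / norm w"
    have st: "0 \<le> s'" "0 \<le> t'" using x by (simp_all add: s'_def t'_def)
    have xe: "x = s' *\<^sub>R v + t' *\<^sub>R w"
      unfolding x(4) v(2) w(2) s'_def t'_def normalise_def scaleR_scaleR divide_inverse ..
    have pos: "0 < s' + t'"
    proof (rule ccontr)
      assume "\<not> 0 < s' + t'"
      then have "s' = 0" "t' = 0" using st by auto
      then show False using xe x(1) by simp
    qed
    let ?y = "(s' / (s' + t')) *\<^sub>R v + (t' / (s' + t')) *\<^sub>R w"
    have "?y \<in> ?H"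
      by (rule convexD[OF convex_convex_hull v(1) w(1)])
         (use st pos in \<open>simp_all add: add_divide_distrib[symmetric]\<close>)
    moreover have "x = (s' + t') *\<^sub>R ?y" unfolding xe using pos by (simp add: scaleR_add_right)
    then have "x = normalise ?y" using normalise_scale[OF pos] normalise_id[OF x(1)] by metis
    ultimately show "x \<in> cut C e \<epsilon>" unfolding cut_def by blast
  qed
  moreover have "cut C e \<epsilon> \<subseteq> S2" using sub body_unit[OF C] by auto
  moreover have "- a \<notin> cut C e \<epsilon>" if "a \<in> cut C e \<epsilon>" for a
    using that sub body_no_antipodes[OF C] by blast
  ultimately show ?thesis unfolding sph_convex_def by blast
qed

lemma cut_closed:
  assumes C: "sph_convex_body C" and e: "sph_extreme C e" and \<epsilon>: "0 < \<epsilon>"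
  shows "closedin (top_of_set S2) (cut C e \<epsilon>)"
proof -
  have "C - ball e \<epsilon> = C \<inter> (- ball e \<epsilon>)" by blast
  then have "compact (C - ball e \<epsilon>)"
    using compact_Int_closed[OF body_compact[OF C], of "- ball e \<epsilon>"] by (simp add: closed_def)
  then have "compact (convex hull (C - ball e \<epsilon>))" by (rule compact_convex_hull)
  then have "compact (cut C e \<epsilon>)" unfolding cut_def
    using compact_continuous_image continuous_on_normalise cut_subset(3)[OF assms] by blast
  then have "closed (cut C e \<epsilon>)" by (rule compact_imp_closed)
  moreover have "cut C e \<epsilon> \<subseteq> S2" using cut_subset(2)[OF assms] body_unit[OF C] by auto
  ultimately show ?thesis by (simp add: closed_subset)
qed

text \<open>The cut must not swallow the interior of \<open>C\<close>: \<open>\<epsilon>\<close> has to be smaller than the distance from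
  \<open>e\<close> to some other interior point.\<close>

lemma cut_body:
  assumes C: "sph_convex_body C" and e: "sph_extreme C e"
  obtains \<epsilon>0 where "0 < \<epsilon>0" "\<And>\<epsilon>. 0 < \<epsilon> \<Longrightarrow> \<epsilon> < \<epsilon>0 \<Longrightarrow> sph_convex_body (cut C e \<epsilon>)"
proof -
  define D where "D = top_of_set S2 interior_of C"
  have D: "D \<subseteq> C" "D \<noteq> {}" using C by (simp_all add: D_def interior_of_subset sph_convex_body_def)
  have "openin (top_of_set S2) D" unfolding D_def by simp
  then obtain U where U: "open U" "D = S2 \<inter> U" by (auto simp: openin_open)
  have "\<exists>t\<in>D. t \<noteq> e"
  proof (rule ccontr)
    assume n: "\<not> (\<exists>t\<in>D. t \<noteq> e)"
    obtain d where "d \<in> D" using D(2) by blast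
    then have "e \<in> D" using n by auto
    then have eU: "e \<in> U" "norm e = 1" using U by auto
    obtain w where w: "norm w = 1" "w \<bullet> e = 0" using exists_unit_orthogonal by blast
    obtain y where "y \<in> U" "norm y = 1" "w \<bullet> y < 0"
      using points_beyond_great_circle[OF w(1) eU(2) w(2) U(1) eU(1)] by blast
    then show False using n w(2) U(2) by auto
  qed
  then obtain t where t: "t \<in> D" "t \<noteq> e" by blast
  show ?thesis
  proof
    show "0 < dist e t" using t by simp
    fix \<epsilon> assume \<epsilon>: "0 < \<epsilon>" "\<epsilon> < dist e t"
    have "open (U - cball e \<epsilon>)" using U(1) by (simp add: open_Diff)
    then have "openin (top_of_set S2) (S2 \<inter> (U - cball e \<epsilon>))" by (rule openin_open_Int)
    moreover have "S2 \<inter> (U - cball e \<epsilon>) \<subseteq> cut C e \<epsilon>"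
      using U(2) D(1) cut_superset[OF C, of e \<epsilon>] ball_subset_cball[of e \<epsilon>] by blast
    ultimately have "S2 \<inter> (U - cball e \<epsilon>) \<subseteq> top_of_set S2 interior_of cut C e \<epsilon>"
      using interior_of_maximal by blast
    moreover have "t \<in> S2 \<inter> (U - cball e \<epsilon>)" using t \<epsilon>(2) U(2) by auto
    ultimately show "sph_convex_body (cut C e \<epsilon>)"
      unfolding sph_convex_body_def using cut_convex[OF C e \<epsilon>(1)] cut_closed[OF C e \<epsilon>(1)] by blast
  qed
qed

text \<open>A hemisphere that contains the cut body but not \<open>C\<close> can touch the cut body only near \<open>e\<close>: a
  contact point of \<open>C\<close> at distance more than \<open>\<epsilon>\<close> from \<open>e\<close> could be moved slightly towards a point
  outside the hemisphere, and would then lie in the cut body and outside the hemisphere.\<close>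

lemma cut_contact_near:
  assumes C: "sph_convex_body C" and e: "sph_extreme C e" and \<epsilon>: "0 < \<epsilon>"
    and g: "g \<in> dual (cut C e \<epsilon>)" "g \<notin> dual C" and x: "x \<in> cut C e \<epsilon>" "g \<bullet> x = 0"
  shows "norm (x - e) \<le> 2 * \<epsilon>"
proof -
  let ?W = "C - ball e \<epsilon>"
  obtain a where a: "norm a = 1" "\<And>x. x \<in> C \<Longrightarrow> 0 < a \<bullet> x" using body_in_open_hemisphere[OF C] by blast
  have gn: "norm g = 1" using dual_unit g(1) by blast
  have W: "0 \<le> g \<bullet> w" if "w \<in> ?W" for w
    using dual_nonneg[OF g(1)] cut_superset[OF C] that by blast
  obtain r where r: "r \<in> C" "g \<bullet> r < 0" using g(2) gn by (auto simp: dual_def not_le)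
  have near: "w \<in> cball e \<epsilon>" if w: "w \<in> ?W" "g \<bullet> w = 0" for w
  proof (rule ccontr)
    assume far: "w \<notin> cball e \<epsilon>"
    have wC: "w \<in> C" using w by blast
    define f where "f t = normalise ((1 - t) *\<^sub>R w + t *\<^sub>R r)" for t
    have "w \<noteq> 0" using body_unit[OF C wC] by auto
    then have "isCont f 0" unfolding f_def normalise_def by (intro continuous_intros) auto
    moreover have "f 0 = w" using normalise_id[OF body_unit[OF C wC]] by (simp add: f_def)
    ultimately have "(f \<longlongrightarrow> w) (at 0)" by (simp add: isCont_def)
    then have "(f \<longlongrightarrow> w) (at_right 0)" by (simp add: filterlim_at_split)
    moreover have "open (- cball e \<epsilon>)" "w \<in> - cball e \<epsilon>" using far by (simp_all add: open_Compl)
    ultimately have "\<forall>\<^sub>F t in at_right 0. f t \<in> - cball e \<epsilon>" using topological_tendstoD by blast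
    moreover have "\<forall>\<^sub>F t::real in at_right 0. 0 < t \<and> t < 1"
      by (rule eventually_at_rightI[of 0 1]) auto
    ultimately have "\<forall>\<^sub>F t in at_right 0. f t \<in> - cball e \<epsilon> \<and> 0 < t \<and> t < 1"
      by eventually_elim auto
    then have "\<exists>t. f t \<in> - cball e \<epsilon> \<and> 0 < t \<and> t < 1"
      by (rule eventually_happens'[OF trivial_limit_at_right_real])
    then obtain t where t: "f t \<in> - cball e \<epsilon>" "0 < t" "t < 1" by blast
    let ?v = "(1 - t) *\<^sub>R w + t *\<^sub>R r"
    have "0 < a \<bullet> ?v" using a(2)[OF wC] a(2)[OF r(1)] t by (simp add: inner_lin add_pos_pos)
    then have v0: "?v \<noteq> 0" by auto
    then have "f t \<in> C" using body_convex[OF C wC r(1), of "1 - t" t] t by (simp add: f_def)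
    then have "0 \<le> g \<bullet> f t" using W t(1) by auto
    moreover have "g \<bullet> ?v < 0" using w(2) r(2) t(2) by (simp add: inner_lin mult_pos_neg)
    then have "g \<bullet> f t < 0" using v0 by (simp add: f_def inner_normalise divide_neg_pos)
    ultimately show False by simp
  qed
  let ?T = "{v. 0 < g \<bullet> v} \<union> ({v. g \<bullet> v = 0} \<inter> cball e \<epsilon>)"
  have "convex ?T"
  proof (rule convexI)
    fix u v and s t :: real assume uv: "u \<in> ?T" "v \<in> ?T" and st: "0 \<le> s" "0 \<le> t" "s + t = 1"
    show "s *\<^sub>R u + t *\<^sub>R v \<in> ?T"
    proof (cases "s = 0 \<or> t = 0")
      case True
      then have "s *\<^sub>R u + t *\<^sub>R v = v \<or> s *\<^sub>R u + t *\<^sub>R v = u" using st by auto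
      then show ?thesis using uv by (elim disjE) (simp_all only:)
    next
      case False
      then have st': "0 < s" "0 < t" using st by auto
      have gu: "0 \<le> g \<bullet> u" "0 \<le> g \<bullet> v" using uv by auto
      show ?thesis
      proof (cases "0 < g \<bullet> u \<or> 0 < g \<bullet> v")
        case True
        then have "0 < s * (g \<bullet> u) + t * (g \<bullet> v)" using st' gu
          by (auto intro: add_pos_nonneg add_nonneg_pos)
        then show ?thesis by (simp add: inner_lin)
      next
        case False
        then have 0: "g \<bullet> u = 0" "g \<bullet> v = 0" using gu by auto
        then have "u \<in> cball e \<epsilon>" "v \<in> cball e \<epsilon>" using uv by auto
        then have "s *\<^sub>R u + t *\<^sub>R v \<in> cball e \<epsilon>" using convexD[OF convex_cball] st by blast
        then show ?thesis using 0 by (simp add: inner_lin)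
      qed
    qed
  qed
  moreover have "?W \<subseteq> ?T" using W near by force
  ultimately have T: "convex hull ?W \<subseteq> ?T" by (simp add: hull_minimal)
  obtain v where v: "v \<in> convex hull ?W" "x = normalise v" using x(1) by (auto simp: cut_def)
  have "v \<noteq> 0" using v(1) cut_subset(3)[OF C e \<epsilon>] by blast
  then have "g \<bullet> v = 0" using x(2) v(2) by (simp add: inner_normalise)
  then have "v \<in> cball e \<epsilon>" using T v(1) by force
  then have ve: "norm (v - e) \<le> \<epsilon>" by (simp add: dist_norm norm_minus_commute)
  have en: "norm e = 1" using e body_unit[OF C] by (simp add: sph_extreme_def)
  have "x - v = (1 - norm v) *\<^sub>R x" using scale_normalise[of v] v(2) by (simp add: scaleR_left_diff_distrib)
  then have "norm (x - v) = \<bar>1 - norm v\<bar>" using normalise_unit[OF \<open>v \<noteq> 0\<close>] v(2) by simp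
  also have "\<dots> \<le> norm (v - e)" using norm_triangle_ineq3[of v e] en by (simp add: abs_minus_commute)
  finally have "norm (x - v) \<le> \<epsilon>" using ve by simp
  then show ?thesis using norm_triangle_ineq[of "x - v" "v - e"] ve by simp
qed

text \<open>The cut body is thinner than \<open>R\<close>, so one member of its diametral pair is the centre of a
  hemisphere that does not contain \<open>R\<close>; the foot on this member is a point of contact and hence near
  \<open>e\<close>. The pair \<open>g0\<close>, \<open>h0\<close> is there to compare the inner products.\<close>

lemma cut_diametral:
  assumes R: "sph_reduced R" and thin: "thickness R < pi / 2" and e: "sph_extreme R e" and \<epsilon>: "0 < \<epsilon>"
    and Z: "sph_convex_body (cut R e \<epsilon>)" and g0: "g0 \<in> dual R" and h0: "h0 \<in> dual R"
  obtains g h where "norm g = 1" "norm h = 1" "g \<bullet> h < g0 \<bullet> h0" "(g \<bullet> h)\<^sup>2 < 1"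
    "norm (foot g h - e) \<le> 2 * \<epsilon>" "\<And>r. r \<in> R - ball e \<epsilon> \<Longrightarrow> 0 \<le> g \<bullet> r \<and> 0 \<le> h \<bullet> r"
proof -
  let ?Z = "cut R e \<epsilon>"
  have C: "sph_convex_body R" using R by (simp add: sph_reduced_def)
  have "?Z \<subseteq> R - {e}" using cut_subset[OF C e \<epsilon>] by blast
  moreover have "e \<in> R" using e by (simp add: sph_extreme_def)
  ultimately have "?Z \<subseteq> R" "?Z \<noteq> R" by blast+
  then have less: "thickness ?Z < thickness R" using R Z unfolding sph_reduced_def by blast
  then have "thickness ?Z < pi / 2" using thin by simp
  then obtain g h where ghd: "diametral ?Z g h" "thickness ?Z = arccos (- (g \<bullet> h))" "g \<bullet> h < 0"
    using thickness_dual[OF Z] by blast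
  note gh = diametralD(1,2)[OF ghd(1)] ghd(2,3) and min = diametralD(3)[OF ghd(1)]
  obtain g1 h1 where gh1d: "diametral R g1 h1" "thickness R = arccos (- (g1 \<bullet> h1))"
    using thickness_dual[OF C thin] by blast
  note gh1 = diametralD(1,2)[OF gh1d(1)] gh1d(2) and min1 = diametralD(3)[OF gh1d(1)]
  have n: "norm g = 1" "norm h = 1" "norm g1 = 1" "norm h1 = 1" using gh gh1 dual_unit by auto
  have "\<bar>g \<bullet> h\<bar> \<le> 1" "\<bar>g1 \<bullet> h1\<bar> \<le> 1" using n unit_inner_bound by auto
  then have "g \<bullet> h < g1 \<bullet> h1"
    using less arccos_less_mono[of "- (g \<bullet> h)" "- (g1 \<bullet> h1)"] gh(3) gh1(3) by simp
  then have lt: "g \<bullet> h < g' \<bullet> h'" if "g' \<in> dual R" "h' \<in> dual R" for g' h'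
    using min1[OF that] by simp
  have ne: "g \<noteq> h" using gh(4) unit_inner_self[OF n(1)] by auto
  have sym: "h \<bullet> g = g \<bullet> h" by (rule inner_commute)
  note strict = dual_pair_strict[OF Z gh(1,2) ne]
  have strict': "(h \<bullet> g)\<^sup>2 < 1" using strict unfolding sym .
  have f1: "foot g h \<in> ?Z" using foot_in_body[OF Z gh(1,2,4)] min gh by blast
  have f2: "foot h g \<in> ?Z" using foot_in_body[OF Z gh(2,1)] gh(1,4) min[OF _ gh(1)] min unfolding sym by blast
  have W: "0 \<le> g \<bullet> r \<and> 0 \<le> h \<bullet> r" if "r \<in> R - ball e \<epsilon>" for r
    using that cut_superset[OF C] dual_nonneg[OF gh(1)] dual_nonneg[OF gh(2)] by blast
  have "g \<notin> dual R \<or> h \<notin> dual R" using lt by blast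
  then show ?thesis
  proof
    assume "g \<notin> dual R"
    then have "norm (foot g h - e) \<le> 2 * \<epsilon>"
      using cut_contact_near[OF C e \<epsilon> gh(1) _ f1 foot_props(2)[OF n(1,2) strict]] by blast
    then show ?thesis using that[OF n(1,2) lt[OF g0 h0] strict] W by blast
  next
    assume "h \<notin> dual R"
    then have "norm (foot h g - e) \<le> 2 * \<epsilon>"
      using cut_contact_near[OF C e \<epsilon> gh(2) _ f2 foot_props(2)[OF n(2,1) strict']] by blast
    moreover have "h \<bullet> g < g0 \<bullet> h0" using lt[OF g0 h0] unfolding sym .
    ultimately show ?thesis using that[OF n(2,1) _ strict'] W by blast
  qed
qed

text \<open>Cutting off ever smaller neighbourhoods of \<open>e\<close> gives, by reducedness, bodies thinner than \<open>R\<close>.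
  Their diametral pairs have feet near \<open>e\<close> and converge to a diametral pair of \<open>R\<close>. In terms of lunes,
  \<open>e\<close> is the centre of one of the semicircles that bound a lune of minimal thickness around \<open>R\<close>.\<close>

lemma extreme_point_is_foot:
  assumes R: "sph_reduced R" and thin: "thickness R < pi / 2" and e: "sph_extreme R e"
  obtains g h where "diametral R g h" "foot g h = e"
proof -
  have C: "sph_convex_body R" using R by (simp add: sph_reduced_def)
  have en: "norm e = 1" using e body_unit[OF C] by (simp add: sph_extreme_def)
  obtain g0 h0 where d0: "diametral R g0 h0" and neg: "g0 \<bullet> h0 < 0"
    using thickness_dual[OF C thin] by blast
  note gh0 = diametralD(1,2)[OF d0] and min = diametralD(3)[OF d0]
  obtain \<epsilon>0 where \<epsilon>0: "0 < \<epsilon>0" "\<And>\<epsilon>. 0 < \<epsilon> \<Longrightarrow> \<epsilon> < \<epsilon>0 \<Longrightarrow> sph_convex_body (cut R e \<epsilon>)"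
    using cut_body[OF C e] by blast
  define d where "d n = \<epsilon>0 / (real n + 2)" for n
  have d: "0 < d n" "d n < \<epsilon>0" for n using \<epsilon>0(1) by (simp_all add: d_def field_simps add_pos_nonneg)
  have d_lim: "d \<longlonglongrightarrow> 0"
  proof -
    have "(\<lambda>n. \<epsilon>0 / (real (n + 2))) \<longlonglongrightarrow> 0" by (rule LIMSEQ_ignore_initial_segment[OF lim_const_over_n])
    then show ?thesis unfolding d_def by (simp add: add.commute)
  qed
  have "\<exists>p. norm (fst p) = 1 \<and> norm (snd p) = 1 \<and> fst p \<bullet> snd p < g0 \<bullet> h0 \<and> (fst p \<bullet> snd p)\<^sup>2 < 1 \<and>
      norm (foot (fst p) (snd p) - e) \<le> 2 * d n \<and> (\<forall>r\<in>R - ball e (d n). 0 \<le> fst p \<bullet> r \<and> 0 \<le> snd p \<bullet> r)" for n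
  proof -
    obtain g h where "norm g = 1" "norm h = 1" "g \<bullet> h < g0 \<bullet> h0" "(g \<bullet> h)\<^sup>2 < 1"
      "norm (foot g h - e) \<le> 2 * d n" "\<And>r. r \<in> R - ball e (d n) \<Longrightarrow> 0 \<le> g \<bullet> r \<and> 0 \<le> h \<bullet> r"
      using cut_diametral[OF R thin e d(1) \<epsilon>0(2)[OF d] gh0(1,2)] by blast
    then show ?thesis by (intro exI[of _ "(g, h)"]) simp
  qed
  then obtain P where "\<forall>n. norm (fst (P n)) = 1 \<and> norm (snd (P n)) = 1 \<and> fst (P n) \<bullet> snd (P n) < g0 \<bullet> h0 \<and>
      (fst (P n) \<bullet> snd (P n))\<^sup>2 < 1 \<and> norm (foot (fst (P n)) (snd (P n)) - e) \<le> 2 * d n \<and>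
      (\<forall>r\<in>R - ball e (d n). 0 \<le> fst (P n) \<bullet> r \<and> 0 \<le> snd (P n) \<bullet> r)" by metis
  then have Pn: "norm (fst (P n)) = 1" "norm (snd (P n)) = 1" "fst (P n) \<bullet> snd (P n) < g0 \<bullet> h0"
      "(fst (P n) \<bullet> snd (P n))\<^sup>2 < 1" "norm (foot (fst (P n)) (snd (P n)) - e) \<le> 2 * d n"
      "\<And>r. r \<in> R - ball e (d n) \<Longrightarrow> 0 \<le> fst (P n) \<bullet> r \<and> 0 \<le> snd (P n) \<bullet> r" for n by blast+
  have "compact (S2 \<times> S2)" using compact_Times compact_sphere by blast
  moreover have "\<forall>n. P n \<in> S2 \<times> S2" using Pn(1,2) by (simp add: mem_Times_iff)
  ultimately obtain p \<rho> where p: "p \<in> S2 \<times> S2" "strict_mono \<rho>" "(P \<circ> \<rho>) \<longlonglongrightarrow> p"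
    unfolding compact_def by blast
  define g h where "g = fst p" and "h = snd p"
  have gn: "norm g = 1" "norm h = 1" using p(1) by (auto simp: g_def h_def mem_Times_iff)
  let ?g = "\<lambda>n. fst (P (\<rho> n))" and ?h = "\<lambda>n. snd (P (\<rho> n))"
  have lg: "?g \<longlonglongrightarrow> g" using tendsto_fst[OF p(3)] by (simp add: g_def comp_def)
  have lh: "?h \<longlonglongrightarrow> h" using tendsto_snd[OF p(3)] by (simp add: h_def comp_def)
  have dr: "(\<lambda>n. d (\<rho> n)) \<longlonglongrightarrow> 0" using LIMSEQ_subseq_LIMSEQ[OF d_lim p(2)] by (simp add: comp_def)
  have lx: "(\<lambda>n. foot (?g n) (?h n)) \<longlonglongrightarrow> e"
  proof (rule LIM_zero_cancel, rule Lim_null_comparison)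
    show "\<forall>\<^sub>F n in sequentially. norm (foot (?g n) (?h n) - e) \<le> 2 * d (\<rho> n)" using Pn(5) by simp
    show "(\<lambda>n. 2 * d (\<rho> n)) \<longlonglongrightarrow> 0" using tendsto_mult_right_zero[OF dr] by simp
  qed
  have lk: "(\<lambda>n. ?g n \<bullet> ?h n) \<longlonglongrightarrow> g \<bullet> h" by (intro tendsto_intros lg lh)
  have k: "g \<bullet> h \<le> g0 \<bullet> h0"
    by (rule LIMSEQ_le_const2[OF lk]) (use Pn(3) less_imp_le in blast)
  have "(\<lambda>n. ?g n \<bullet> foot (?g n) (?h n)) \<longlonglongrightarrow> g \<bullet> e" by (intro tendsto_intros lg lx)
  moreover have "?g n \<bullet> foot (?g n) (?h n) = 0" for n using foot_props(2) Pn(1,2,4) by blast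
  ultimately have ge: "g \<bullet> e = 0" by (simp add: LIMSEQ_const_iff)
  have "(\<lambda>n. sqrt (1 - (?g n \<bullet> ?h n)\<^sup>2) *\<^sub>R foot (?g n) (?h n) + (?g n \<bullet> ?h n) *\<^sub>R ?g n)
      \<longlonglongrightarrow> sqrt (1 - (g \<bullet> h)\<^sup>2) *\<^sub>R e + (g \<bullet> h) *\<^sub>R g"
    by (intro tendsto_intros lk lg lx)
  moreover have "sqrt (1 - (?g n \<bullet> ?h n)\<^sup>2) *\<^sub>R foot (?g n) (?h n) + (?g n \<bullet> ?h n) *\<^sub>R ?g n = ?h n" for n
    using foot_props(5)[OF Pn(1,2,4)] by simp
  ultimately have h_eq: "h = sqrt (1 - (g \<bullet> h)\<^sup>2) *\<^sub>R e + (g \<bullet> h) *\<^sub>R g"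
    using lh LIMSEQ_unique by simp
  have "\<bar>g \<bullet> h\<bar> \<le> 1" using unit_inner_bound gn by blast
  then have "0 \<le> sqrt (1 - (g \<bullet> h)\<^sup>2)" by (simp add: abs_square_le_1)
  moreover have "h \<bullet> e = sqrt (1 - (g \<bullet> h)\<^sup>2)"
    by (subst h_eq) (simp add: inner_lin ge unit_inner_self[OF en])
  ultimately have he: "0 \<le> h \<bullet> e" by simp
  have nonneg: "0 \<le> g \<bullet> r \<and> 0 \<le> h \<bullet> r" if r: "r \<in> R" for r
  proof (cases "r = e")
    case False
    then have "0 < dist e r" by simp
    then have "\<forall>\<^sub>F n in sequentially. d (\<rho> n) < dist e r" using order_tendstoD(2)[OF dr] by blast
    then have ev: "\<forall>\<^sub>F n in sequentially. 0 \<le> ?g n \<bullet> r \<and> 0 \<le> ?h n \<bullet> r"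
      by eventually_elim (use Pn(6) r in \<open>simp\<close>)
    have lim: "(\<lambda>n. ?g n \<bullet> r) \<longlonglongrightarrow> g \<bullet> r" "(\<lambda>n. ?h n \<bullet> r) \<longlonglongrightarrow> h \<bullet> r" by (intro tendsto_intros lg lh)+
    have "\<forall>\<^sub>F n in sequentially. 0 \<le> ?g n \<bullet> r" "\<forall>\<^sub>F n in sequentially. 0 \<le> ?h n \<bullet> r"
      using ev by (simp_all add: eventually_conj_iff)
    then show ?thesis
      using tendsto_lowerbound[OF lim(1) _ trivial_limit_sequentially]
        tendsto_lowerbound[OF lim(2) _ trivial_limit_sequentially] by blast
  qed (use ge he in simp)
  have D: "g \<in> dual R" "h \<in> dual R" using nonneg gn by (auto simp: dual_def)
  have "diametral R g h" using D k min unfolding diametral_def by (meson order_trans)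
  moreover have "g \<noteq> h" using k neg unit_inner_self[OF gn(1)] by auto
  then have "sqrt (1 - (g \<bullet> h)\<^sup>2) > 0" using dual_pair_strict[OF C D] by simp
  then have "foot g h = e"
    unfolding foot_def by (subst (1) h_eq) simp
  ultimately show ?thesis using that by blast
qed

section \<open>Diametral pairs of a thin body\<close>

text \<open>In a convex quadrilateral \<open>a b c d\<close> with crossing diagonals the diagonals are together longer than
  the sides \<open>a b\<close> and \<open>c d\<close>, so these sides cannot both be diametral unless the quadrilateral
  degenerates. The crossing of the diagonals is the linear relation. Taking its inner products with
  \<open>a\<close>, \<open>b\<close>, \<open>c\<close> and \<open>d\<close> and combining them gives a vanishing sum of nonnegative terms.\<close>

lemma diametral_pairs_cross:
  fixes a b c d :: "real ^ 3"
  assumes n: "norm a = 1" "norm b = 1" "norm c = 1" "norm d = 1"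
    and k: "a \<bullet> b = k" "c \<bullet> d = k" "k \<le> a \<bullet> c" "k \<le> b \<bullet> d"
    and nonneg: "0 \<le> \<alpha>" "0 \<le> \<gamma>" "0 \<le> \<beta>" "0 \<le> \<delta>" and pos: "0 < \<gamma> + \<beta>"
    and rel: "\<alpha> *\<^sub>R a + \<gamma> *\<^sub>R c = \<beta> *\<^sub>R b + \<delta> *\<^sub>R d"
  shows "b = c"
proof -
  have sym: "b \<bullet> a = k" "d \<bullet> c = k" "c \<bullet> a = a \<bullet> c" "d \<bullet> a = a \<bullet> d" "c \<bullet> b = b \<bullet> c" "d \<bullet> b = b \<bullet> d"
    using k by (simp_all add: inner_commute)
  note self = unit_inner_self[OF n(1)] unit_inner_self[OF n(2)] unit_inner_self[OF n(3)] unit_inner_self[OF n(4)]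
  have eq: "\<alpha> * (v \<bullet> a) + \<gamma> * (v \<bullet> c) = \<beta> * (v \<bullet> b) + \<delta> * (v \<bullet> d)" for v
    using arg_cong[OF rel, of "\<lambda>u. v \<bullet> u"] by (simp add: inner_lin)
  have 1: "\<alpha> + \<gamma> * (a \<bullet> c) = \<beta> * k + \<delta> * (a \<bullet> d)" using eq[of a] by (simp add: self k)
  have 2: "\<alpha> * k + \<gamma> * (b \<bullet> c) = \<beta> + \<delta> * (b \<bullet> d)" using eq[of b] by (simp add: self sym)
  have 3: "\<alpha> * (a \<bullet> c) + \<gamma> = \<beta> * (b \<bullet> c) + \<delta> * k" using eq[of c] by (simp add: self sym k)
  have 4: "\<alpha> * (a \<bullet> d) + \<gamma> * k = \<beta> * (b \<bullet> d) + \<delta>" using eq[of d] by (simp add: self sym)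
  have sum: "(\<gamma> + \<beta>) * (1 - b \<bullet> c) + (\<alpha> + \<delta>) * (1 - a \<bullet> d) + (\<delta> + \<beta>) * (b \<bullet> d - k) + (\<alpha> + \<gamma>) * (a \<bullet> c - k) = 0"
    using 1 2 3 4 by algebra
  have "b \<bullet> c \<le> 1" "a \<bullet> d \<le> 1" using n unit_inner_bound abs_le_D1 by blast+
  then have "0 \<le> (\<gamma> + \<beta>) * (1 - b \<bullet> c)" "0 \<le> (\<alpha> + \<delta>) * (1 - a \<bullet> d)"
    "0 \<le> (\<delta> + \<beta>) * (b \<bullet> d - k)" "0 \<le> (\<alpha> + \<gamma>) * (a \<bullet> c - k)" using nonneg k by simp_all
  then have "(\<gamma> + \<beta>) * (1 - b \<bullet> c) = 0" using sum by linarith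
  then have "1 \<le> b \<bullet> c" using pos by simp
  then show ?thesis using unit_eqI n by blast
qed

text \<open>\<open>c\<close> is the cosine and \<open>s\<close> the sine of the diameter of the dual.\<close>

locale thin_body =
  fixes R :: "(real ^ 3) set" and c s :: real
  assumes body: "sph_convex_body R"
    and c: "c < 0" "- 1 < c"
    and s: "0 < s" "s\<^sup>2 = 1 - c\<^sup>2"
    and dual_min: "\<And>g h. g \<in> dual R \<Longrightarrow> h \<in> dual R \<Longrightarrow> c \<le> g \<bullet> h"
begin

definition pair :: "real ^ 3 \<Rightarrow> real ^ 3 \<Rightarrow> bool" where
  "pair g h \<longleftrightarrow> g \<in> dual R \<and> h \<in> dual R \<and> g \<bullet> h = c"

lemma pair_sym: "pair g h \<Longrightarrow> pair h g"
  by (simp add: pair_def inner_commute)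

lemma pairD:
  assumes "pair g h"
  shows "g \<in> dual R" "h \<in> dual R" "g \<bullet> h = c" "h \<bullet> g = c" "norm g = 1" "norm h = 1" "g \<bullet> g = 1" "h \<bullet> h = 1"
  using assms dual_unit unit_inner_self by (auto simp: pair_def inner_commute)

lemma sqrt_s: "sqrt (1 - c\<^sup>2) = s"
  using s by (metis real_sqrt_unique less_imp_le)

lemma c_square: "c\<^sup>2 < 1"
  using s zero_less_power2[of s] by simp

lemma pair_foot:
  assumes "pair g h"
  shows "foot g h \<in> R" "norm (foot g h) = 1" "g \<bullet> foot g h = 0" "h \<bullet> foot g h = s"
    "h = s *\<^sub>R foot g h + c *\<^sub>R g" "foot h g = s *\<^sub>R g - c *\<^sub>R foot g h"
proof -
  note P = pairD[OF assms]
  have st: "(g \<bullet> h)\<^sup>2 < 1" using c_square P by simp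
  note fp = foot_props[OF P(5,6) st]
  show "foot g h \<in> R" using foot_in_body[OF body P(1,2)] P(3) c dual_min P(2) by simp
  show "norm (foot g h) = 1" "g \<bullet> foot g h = 0" using fp by simp_all
  show "h \<bullet> foot g h = s" using fp(3) sqrt_s P(3) by simp
  show h: "h = s *\<^sub>R foot g h + c *\<^sub>R g" using fp(5) unfolding P(3) sqrt_s .
  have "foot h g = (1 / s) *\<^sub>R (g - c *\<^sub>R h)" unfolding foot_def P(4) sqrt_s by (simp add: inverse_eq_divide)
  also have "g - c *\<^sub>R h = (s\<^sup>2) *\<^sub>R g - (c * s) *\<^sub>R foot g h"
    unfolding s(2) by (subst h) (simp add: scaleR_add_right scaleR_left_diff_distrib power2_eq_square)
  finally show "foot h g = s *\<^sub>R g - c *\<^sub>R foot g h"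
    using s(1) by (simp add: scaleR_diff_right power2_eq_square)
qed

lemma R_unit: "x \<in> R \<Longrightarrow> norm x = 1"
  using body_unit[OF body] .

lemma dual_cone_bound:
  assumes g: "g \<in> dual R" and q: "\<And>x. x \<in> R \<Longrightarrow> 0 \<le> q \<bullet> x"
  shows "c * norm q \<le> g \<bullet> q"
proof (cases "q = 0")
  case False
  then have "c \<le> g \<bullet> normalise q" using dual_min[OF g normalise_in_dual] q by blast
  then show ?thesis using False by (simp add: inner_normalise pos_le_divide_eq)
qed simp

text \<open>The foot of \<open>g\<close>, \<open>h'\<close> on \<open>h'\<close> is a point of the body, so it is nonnegative at \<open>h\<close>; as \<open>c < 0\<close>, this
  is only possible if \<open>h\<close> and \<open>h'\<close> coincide.\<close>

lemma pair_unique: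
  assumes "pair g h" "pair g h'"
  shows "h = h'"
proof -
  note P = pairD[OF assms(1)] and P' = pairD[OF assms(2)]
  have "0 \<le> h \<bullet> foot h' g" using dual_nonneg P(2) pair_foot(1)[OF pair_sym[OF assms(2)]] by blast
  also have "h \<bullet> foot h' g = (1 / s) * (c - c * (h \<bullet> h'))"
    unfolding foot_def P'(4) sqrt_s by (simp add: inner_lin P inverse_eq_divide)
  finally have "0 \<le> c - c * (h \<bullet> h')" using s(1) by (simp add: zero_le_divide_iff)
  then have "0 \<le> c * (1 - h \<bullet> h')" by (simp add: algebra_simps)
  then have "1 \<le> h \<bullet> h'" using c(1) by (simp add: zero_le_mult_iff)
  then show ?thesis using unit_eqI P(6) P'(6) by blast
qed

text \<open>Coordinates in the plane of a diametral pair: they are read off from the two feet, so they are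
  nonnegative for points of the dual cone.\<close>

lemma plane_coordinates:
  assumes p: "pair g h" and z: "z \<bullet> g = 0" "z \<bullet> h = 0" "z \<noteq> 0" and v: "z \<bullet> v = 0"
  shows "v = ((foot h g \<bullet> v) / s) *\<^sub>R g + ((foot g h \<bullet> v) / s) *\<^sub>R h"
proof -
  note P = pairD[OF p] and F = pair_foot[OF p] and F' = pair_foot[OF pair_sym[OF p]]
  let ?x = "foot g h" and ?y = "foot h g"
  let ?u = "v - ((?y \<bullet> v) / s) *\<^sub>R g - ((?x \<bullet> v) / s) *\<^sub>R h"
  have xu: "?x \<bullet> ?u = 0" and yu: "?y \<bullet> ?u = 0"
    using F(3,4) F'(3,4) s(1) by (simp_all add: inner_lin inner_commute)
  have "g = (1 / s) *\<^sub>R (?y + c *\<^sub>R ?x)" unfolding F(6) using s(1) by simp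
  then have gu: "g \<bullet> ?u = (1 / s) * (?y \<bullet> ?u + c * (?x \<bullet> ?u))"
    by (metis inner_add_left inner_scaleR_left)
  then have gu: "g \<bullet> ?u = 0" using xu yu by simp
  have "h \<bullet> ?u = s * (?x \<bullet> ?u) + c * (g \<bullet> ?u)" using F(5) by (metis inner_add_left inner_scaleR_left)
  then have hu: "h \<bullet> ?u = 0" using xu gu by simp
  have zu: "z \<bullet> ?u = 0" using z v by (simp add: inner_lin)
  have "?u = 0"
    by (rule orthogonal_to_plane_and_normal[OF P(5,6) _ _ _ z(1,2) _ z(3)])
       (use c_square P(3) gu hu zu in \<open>simp_all add: inner_commute\<close>)
  then show ?thesis unfolding diff_diff_eq eq_iff_diff_eq_0[symmetric] .
qed

text \<open>Two pairs on one side of a plane through one of them do not cross. The sign pattern of the linear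
  relation between the four vectors shows either a pair of opposite sides in a quadrilateral, or one
  vector in the triangle of the others.\<close>

lemma diametral_pair_not_on_one_side:
  assumes p: "pair g h" and p1: "pair g1 h1" and z: "z \<bullet> g1 = 0" "z \<bullet> h1 = 0"
    and neg: "z \<bullet> g < 0" "z \<bullet> h < 0"
  shows False
proof -
  note P = pairD[OF p] and P1 = pairD[OF p1] and F = pair_foot[OF p] and F' = pair_foot[OF pair_sym[OF p]]
  define \<alpha> \<beta> where "\<alpha> = - (z \<bullet> h)" and "\<beta> = - (z \<bullet> g)"
  have ab: "0 < \<alpha>" "0 < \<beta>" using neg by (simp_all add: \<alpha>_def \<beta>_def)
  let ?v = "\<alpha> *\<^sub>R g - \<beta> *\<^sub>R h"
  have z0: "z \<noteq> 0" using neg by auto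
  have "z \<bullet> ?v = 0" by (simp add: \<alpha>_def \<beta>_def inner_lin)
  then obtain \<gamma> \<eta> where v: "?v = \<gamma> *\<^sub>R g1 + \<eta> *\<^sub>R h1" using plane_coordinates[OF p1 z z0] by blast
  have ne: "h \<noteq> g1" "h \<noteq> h1" using z neg by auto
  have dots: "c \<le> u \<bullet> w" if "u \<in> dual R" "w \<in> dual R" for u w using dual_min that .
  consider "\<gamma> \<le> 0" "0 \<le> \<eta>" | "0 \<le> \<gamma>" "\<eta> \<le> 0" | "0 \<le> \<gamma>" "0 \<le> \<eta>" | "\<gamma> \<le> 0" "\<eta> \<le> 0" by linarith
  then show False
  proof cases
    case 1
    have rel: "\<alpha> *\<^sub>R g + (- \<gamma>) *\<^sub>R g1 = \<beta> *\<^sub>R h + \<eta> *\<^sub>R h1" using v by (simp add: algebra_simps)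
    have "h = g1"
      by (rule diametral_pairs_cross[OF P(5,6) P1(5,6) P(3) P1(3) dots[OF P(1) P1(1)] dots[OF P(2) P1(2)] _ _ _ _ _ rel])
         (use ab 1 in simp_all)
    then show False using ne by blast
  next
    case 2
    have rel: "\<alpha> *\<^sub>R g + (- \<eta>) *\<^sub>R h1 = \<beta> *\<^sub>R h + \<gamma> *\<^sub>R g1" using v by (simp add: algebra_simps)
    have "h = h1"
      by (rule diametral_pairs_cross[OF P(5,6) P1(6,5) P(3) P1(4) dots[OF P(1) P1(2)] dots[OF P(2) P1(1)] _ _ _ _ _ rel])
         (use ab 2 in simp_all)
    then show False using ne by blast
  next
    case 3
    \<comment> \<open>Here \<open>g\<close> lies in the triangle of the other three points, which the foot on \<open>g\<close> excludes.\<close>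
    let ?x = "foot g h"
    have "?x \<bullet> ?v = - \<beta> * s" using F(3,4) by (simp add: inner_lin inner_commute)
    moreover have "0 \<le> ?x \<bullet> ?v"
      unfolding v using 3 dual_nonneg[OF P1(1) F(1)] dual_nonneg[OF P1(2) F(1)] by (simp add: inner_lin inner_commute)
    ultimately show False using ab s(1) by (simp add: mult_le_0_iff)
  next
    case 4
    let ?y = "foot h g"
    have "?y \<bullet> ?v = \<alpha> * s" using F'(3,4) by (simp add: inner_lin inner_commute)
    moreover have "?y \<bullet> ?v \<le> 0"
      unfolding v using 4 dual_nonneg[OF P1(1) F'(1)] dual_nonneg[OF P1(2) F'(1)]
      by (simp add: inner_lin inner_commute mult_nonpos_nonneg add_nonpos_nonpos)
    ultimately show False using ab s(1) by (simp add: mult_le_0_iff)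
  qed
qed

text \<open>\<open>q\<close> is the point where the ray from \<open>m\<close> through a point \<open>w\<close> of the chord \<open>g1 h1\<close> leaves the dual,
  and the line orthogonal to \<open>foot g h\<close> supports the dual at \<open>q\<close> and at \<open>g\<close>. If \<open>g\<close> is on the side of
  \<open>m\<close>, then this line meets the plane of the chord in a point of the dual, which must be an end point
  of the chord. It is not \<open>g1\<close>, since \<open>q\<close> is not on the line through \<open>m\<close> and \<open>g1\<close>. So \<open>h1\<close> is between
  \<open>g\<close> and \<open>q\<close>, and the supporting line at \<open>h1\<close> that is perpendicular to the chord passes through \<open>q\<close>.\<close>

lemma exit_point_on_opposite_side:
  assumes p1: "pair g1 h1" and w: "w = \<nu> *\<^sub>R g1 + \<mu> *\<^sub>R h1" "0 < \<nu>" "0 < \<mu>" "\<And>y. y \<in> R \<Longrightarrow> 0 < w \<bullet> y"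
    and z: "z \<bullet> g1 = 0" "z \<bullet> h1 = 0" "0 < z \<bullet> m" and m: "m \<bullet> foot g1 h1 = 0"
    and q: "q = w - \<kappa> *\<^sub>R m" "0 < \<kappa>" "\<And>y. y \<in> R \<Longrightarrow> 0 \<le> q \<bullet> y"
    and p: "pair g h" "q \<bullet> foot g h = 0" and side: "0 \<le> z \<bullet> g"
  shows "q \<bullet> foot h1 g1 = 0"
proof (rule ccontr)
  assume qy: "q \<bullet> foot h1 g1 \<noteq> 0"
  note P = pairD[OF p(1)] and P1 = pairD[OF p1] and F = pair_foot[OF p(1)]
    and F1 = pair_foot[OF p1] and F1' = pair_foot[OF pair_sym[OF p1]]
  let ?x = "foot g h" and ?x1 = "foot g1 h1" and ?y1 = "foot h1 g1"
  define G N where "G = z \<bullet> g" and "N = - (z \<bullet> q)"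
  have zw: "z \<bullet> w = 0" using z w(1) by (simp add: inner_lin)
  have N: "0 < N" using zw z(3) q(2) by (simp add: N_def q(1) inner_lin)
  have G: "0 \<le> G" using side by (simp add: G_def)
  have z0: "z \<noteq> 0" using z(3) by auto
  have qx1: "0 < q \<bullet> ?x1" using w(4)[OF F1(1)] m by (simp add: q(1) inner_lin)
  have qy1: "0 < q \<bullet> ?y1" using q(3)[OF F1'(1)] qy by simp
  define v where "v = G *\<^sub>R q + N *\<^sub>R g"
  have zv: "z \<bullet> v = 0" by (simp add: v_def G_def N_def inner_lin)
  have vR: "v \<bullet> y = G * (q \<bullet> y) + N * (g \<bullet> y)" for y by (simp add: v_def inner_lin)
  have vR0: "0 \<le> v \<bullet> y" if "y \<in> R" for y unfolding vR using G N q(3)[OF that] dual_nonneg[OF P(1) that] by simp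
  have vx: "v \<bullet> ?x = 0" unfolding vR using p(2) F(3) by simp
  define a b where "a = (?y1 \<bullet> v) / s" and "b = (?x1 \<bullet> v) / s"
  have ab: "0 \<le> a" "0 \<le> b" using vR0[OF F1(1)] vR0[OF F1'(1)] s(1) by (simp_all add: a_def b_def inner_commute)
  have v_eq: "v = a *\<^sub>R g1 + b *\<^sub>R h1" unfolding a_def b_def by (rule plane_coordinates[OF p1 z(1,2) z0 zv])
  have "a * (g1 \<bullet> ?x) + b * (h1 \<bullet> ?x) = 0" using vx unfolding v_eq by (simp add: inner_lin)
  moreover have nn: "0 \<le> g1 \<bullet> ?x" "0 \<le> h1 \<bullet> ?x" using dual_nonneg P1 F(1) by blast+
  ultimately have 0: "a * (g1 \<bullet> ?x) = 0" "b * (h1 \<bullet> ?x) = 0"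
    using ab by (simp_all add: add_nonneg_eq_0_iff)
  have "0 < \<nu> * (g1 \<bullet> ?x) + \<mu> * (h1 \<bullet> ?x)" using w(4)[OF F(1)] unfolding w(1) by (simp add: inner_lin)
  then have "a = 0 \<or> b = 0" using 0 by auto
  then show False
  proof
    assume "b = 0"
    then have "v \<bullet> ?x1 = 0" using s(1) by (simp add: b_def inner_commute)
    then have "G * (q \<bullet> ?x1) + N * (g \<bullet> ?x1) = 0" unfolding vR .
    moreover have gx1: "0 \<le> g \<bullet> ?x1" using dual_nonneg[OF P(1) F1(1)] .
    ultimately have "G * (q \<bullet> ?x1) = 0" "N * (g \<bullet> ?x1) = 0"
      using G N qx1 by (simp_all add: add_nonneg_eq_0_iff)
    then have "G = 0" "g \<bullet> ?x1 = 0" using qx1 N by auto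
    then have "g = ((?y1 \<bullet> g) / s) *\<^sub>R g1"
      using plane_coordinates[OF p1 z(1,2) z0, of g] by (simp add: G_def inner_commute)
    moreover have "0 \<le> (?y1 \<bullet> g) / s" using dual_nonneg[OF P(1) F1'(1)] s(1) by (simp add: inner_commute)
    ultimately have "g = g1" using unit_multiple[OF P1(5) P(5)] by blast
    then have "h = h1" using pair_unique p(1) p1 by blast
    then show False using p(2) qx1 \<open>g = g1\<close> by simp
  next
    assume "a = 0"
    then have "v \<bullet> ?y1 = 0" using s(1) by (simp add: a_def inner_commute)
    then have "G * (q \<bullet> ?y1) + N * (g \<bullet> ?y1) = 0" unfolding vR .
    moreover have gy1: "0 \<le> g \<bullet> ?y1" using dual_nonneg[OF P(1) F1'(1)] .
    ultimately have "G * (q \<bullet> ?y1) = 0" "N * (g \<bullet> ?y1) = 0"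
      using G N qy1 by (simp_all add: add_nonneg_eq_0_iff)
    then have "G = 0" "g \<bullet> ?y1 = 0" using qy1 N by auto
    then have "g = ((?x1 \<bullet> g) / s) *\<^sub>R h1"
      using plane_coordinates[OF p1 z(1,2) z0, of g] by (simp add: G_def inner_commute)
    moreover have "0 \<le> (?x1 \<bullet> g) / s" using dual_nonneg[OF P(1) F1(1)] s(1) by (simp add: inner_commute)
    ultimately have "g = h1" using unit_multiple[OF P1(6) P(5)] by blast
    then have "h = g1" using pair_unique p(1) pair_sym[OF p1] by blast
    then show False using p(2) qy \<open>g = h1\<close> by simp
  qed
qed

text \<open>The lines through \<open>m\<close> and \<open>g1\<close> and through \<open>q\<close> and \<open>h1\<close> are both perpendicular to the chord
  \<open>g1 h1\<close>. In the two right triangles with the common vertex \<open>w\<close> the legs on the chord are at most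
  right angles, so the hypotenuses are together longer than the legs. Thus \<open>m\<close> and \<open>q\<close> would be
  farther apart than \<open>g1\<close> and \<open>h1\<close>.\<close>

lemma perpendicular_chord_too_long:
  assumes p1: "pair g1 h1" and w: "w = \<nu> *\<^sub>R g1 + \<mu> *\<^sub>R h1" "0 < \<nu>" "0 < \<mu>"
    and acute: "0 \<le> w \<bullet> g1" "0 \<le> w \<bullet> h1"
    and m: "m \<in> dual R" "m \<bullet> foot g1 h1 = 0" "m \<noteq> g1" "0 \<le> m \<bullet> g1"
    and q: "q = w - \<kappa> *\<^sub>R m" "\<And>y. y \<in> R \<Longrightarrow> 0 \<le> q \<bullet> y" "q \<bullet> foot h1 g1 = 0"
  shows False
proof -
  note P1 = pairD[OF p1] and F1 = pair_foot[OF p1] and F1' = pair_foot[OF pair_sym[OF p1]]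
  define p where "p = m \<bullet> g1"
  have mn: "norm m = 1" using dual_unit[OF m(1)] .
  have "m \<noteq> - g1" using dual_no_antipodes[OF body P1(1)] m(1) by blast
  then have p2: "p\<^sup>2 < 1" unfolding p_def using unit_inner_strict[OF mn P1(5) m(3)] by blast
  have mh: "m \<bullet> h1 = c * p" by (subst F1(5)) (simp add: inner_lin m(2) p_def)
  have "w \<bullet> foot h1 g1 = \<nu> * s" unfolding w(1) using F1'(3,4) by (simp add: inner_lin)
  moreover have "m \<bullet> foot h1 g1 = s * p" unfolding F1(6) using m(2) by (simp add: inner_lin p_def)
  ultimately have "\<nu> * s = \<kappa> * (s * p)" using q(3) by (simp add: q(1) inner_lin)
  then have lam: "\<nu> = \<kappa> * p" using s(1) by simp
  have p: "0 < p" using m(4) lam w(2) by (cases "p = 0") (simp_all add: p_def)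
  have mw: "m \<bullet> w = p * (\<nu> + c * \<mu>)" unfolding w(1) by (simp add: inner_lin p_def[symmetric] mh algebra_simps)
  have ww: "w \<bullet> w = \<nu>\<^sup>2 + \<mu>\<^sup>2 + 2 * c * \<nu> * \<mu>"
    unfolding w(1) by (simp add: inner_lin P1 power2_eq_square algebra_simps)
  define A Q where "A = m \<bullet> q" and "Q = q \<bullet> q"
  have A: "A = p * (\<nu> + c * \<mu>) - \<kappa>"
    unfolding A_def q(1) by (simp add: inner_lin mw unit_inner_self[OF mn])
  have Q: "Q = \<nu>\<^sup>2 + \<mu>\<^sup>2 + 2 * c * \<nu> * \<mu> - 2 * \<kappa> * (p * (\<nu> + c * \<mu>)) + \<kappa>\<^sup>2"
    unfolding Q_def q(1) using mw
    by (simp add: inner_lin unit_inner_self[OF mn] ww inner_commute[of w m] power2_eq_square algebra_simps)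
  have pA: "p * A = - (\<nu> * (1 - p\<^sup>2) - c * p\<^sup>2 * \<mu>)"
    unfolding A lam by (simp add: power2_eq_square algebra_simps)
  have "0 < \<nu> * (1 - p\<^sup>2)" "c * p\<^sup>2 * \<mu> \<le> 0" using w p2 c(1) by (simp_all add: mult_nonpos_nonneg)
  then have "p * A < 0" unfolding pA by linarith
  then have A0: "A < 0" using p by (simp add: mult_less_0_iff)
  have "c * norm q \<le> A" unfolding A_def by (rule dual_cone_bound[OF m(1) q(2)])
  then have "\<bar>A\<bar> \<le> \<bar>c * norm q\<bar>" using A0 by simp
  then have "A\<^sup>2 \<le> (c * norm q)\<^sup>2" by (simp only: abs_le_square_iff)
  then have AQ: "A\<^sup>2 \<le> c\<^sup>2 * Q" unfolding Q_def by (simp add: power_mult_distrib power2_norm_eq_inner)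
  \<comment> \<open>The claim is \<open>A\<^sup>2 > c\<^sup>2 * Q\<close>; after multiplication by \<open>p\<^sup>2\<close> the difference factors.\<close>
  define Y where "Y = \<nu> + c * \<mu>"
  have id: "p\<^sup>2 * A\<^sup>2 - c\<^sup>2 * (p\<^sup>2 * Q) = (1 - p\<^sup>2) * (\<nu>\<^sup>2 * (1 - c\<^sup>2) - p\<^sup>2 * Y\<^sup>2)"
    unfolding A Q Y_def lam by (simp add: power2_eq_square algebra_simps)
  have "w \<bullet> g1 = Y" "w \<bullet> h1 = \<mu> + c * \<nu>" unfolding w(1) Y_def by (simp_all add: inner_lin P1 algebra_simps)
  then have Y0: "0 \<le> Y" and "- c * \<nu> \<le> \<mu>" using acute by simp_all
  then have "c * \<mu> \<le> c * (- c * \<nu>)" using c(1) by (intro mult_left_mono_neg) simp_all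
  then have "Y \<le> \<nu> * (1 - c\<^sup>2)" unfolding Y_def by (simp add: power2_eq_square algebra_simps)
  then have "Y\<^sup>2 \<le> (\<nu> * (1 - c\<^sup>2))\<^sup>2" using Y0 power_mono by blast
  also have "\<dots> = (\<nu>\<^sup>2 * (1 - c\<^sup>2)) * (1 - c\<^sup>2)" by (simp add: power2_eq_square algebra_simps)
  also have "\<dots> < \<nu>\<^sup>2 * (1 - c\<^sup>2)" using w(2) c c_square by simp
  finally have Y2: "Y\<^sup>2 < \<nu>\<^sup>2 * (1 - c\<^sup>2)" .
  have "p\<^sup>2 * Y\<^sup>2 \<le> 1 * Y\<^sup>2" using p2 by (intro mult_right_mono) auto
  then have "0 < \<nu>\<^sup>2 * (1 - c\<^sup>2) - p\<^sup>2 * Y\<^sup>2" using Y2 by simp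
  then have "0 < (1 - p\<^sup>2) * (\<nu>\<^sup>2 * (1 - c\<^sup>2) - p\<^sup>2 * Y\<^sup>2)" using p2 by simp
  then have "0 < p\<^sup>2 * A\<^sup>2 - c\<^sup>2 * (p\<^sup>2 * Q)" unfolding id .
  moreover have "p\<^sup>2 * A\<^sup>2 \<le> p\<^sup>2 * (c\<^sup>2 * Q)" using AQ by (intro mult_left_mono) auto
  ultimately show False by (simp add: algebra_simps)
qed

lemma arc_point_closer:
  assumes n: "norm (m :: real ^ 3) = 1" "norm g = 1" "norm h = 1" and p: "0 \<le> m \<bullet> g" "(m \<bullet> g)\<^sup>2 < 1"
    and h: "h = a *\<^sub>R g + d *\<^sub>R m" "0 < a" "0 < d"
  shows "m \<bullet> g < m \<bullet> h"
proof (rule ccontr)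
  assume "\<not> m \<bullet> g < m \<bullet> h"
  define p where "p = m \<bullet> g"
  have "m \<bullet> h = a * p + d" unfolding h(1) p_def using unit_inner_self[OF n(1)] by (simp add: inner_lin)
  then have le: "d \<le> p * (1 - a)" using \<open>\<not> m \<bullet> g < m \<bullet> h\<close> by (simp add: p_def[symmetric] algebra_simps)
  have p0: "0 \<le> p" "p\<^sup>2 < 1" using p by (simp_all add: p_def)
  have pa: "0 < p * (1 - a)" using le h(3) by simp
  then have a1: "a < 1" using p0(1) by (simp add: zero_less_mult_iff)
  have "1 = h \<bullet> h" using unit_inner_self[OF n(3)] by simp
  also have "h \<bullet> h = a\<^sup>2 + 2 * a * p * d + d\<^sup>2"
    unfolding h(1) p_def using unit_inner_self[OF n(1)] unit_inner_self[OF n(2)]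
    by (simp add: inner_lin inner_commute[of g m] power2_eq_square algebra_simps)
  also have "\<dots> \<le> a\<^sup>2 + 2 * a * p * (p * (1 - a)) + (p * (1 - a))\<^sup>2"
    using le h p0(1) by (intro add_mono mult_left_mono power_mono) auto
  also have "\<dots> = a\<^sup>2 + p\<^sup>2 * (1 - a\<^sup>2)" by (simp add: power2_eq_square algebra_simps)
  also have "p\<^sup>2 * (1 - a\<^sup>2) < 1 * (1 - a\<^sup>2)"
  proof (rule mult_strict_right_mono[OF p0(2)])
    have "\<bar>a\<bar> < 1" using a1 h(2) by simp
    then show "0 < 1 - a\<^sup>2" using abs_square_less_1[of a] by simp
  qed
  finally show False by simp
qed

end

section \<open>A corner of the dual\<close>

text \<open>A hemisphere whose boundary meets the body in a non-degenerate arc \<open>x1 x2\<close> has as its centre a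
  corner \<open>m\<close> of the dual, whose two sides lie on the great circles orthogonal to \<open>x1\<close> and \<open>x2\<close>. The
  assumption that no point of the dual is at maximal distance from \<open>m\<close> will be refuted. The pairs
  \<open>g1\<close>, \<open>h1\<close> and \<open>g2\<close>, \<open>h2\<close> are diametral pairs with feet \<open>x1\<close> and \<open>x2\<close>, chosen such that \<open>g1\<close> and
  \<open>g2\<close> are as near to \<open>m\<close> as possible.\<close>

locale corner = thin_body +
  fixes m x1 x2 g1 h1 g2 h2 :: "real ^ 3"
  assumes m: "m \<in> dual R"
    and mx: "m \<bullet> x1 = 0" "m \<bullet> x2 = 0"
    and indep: "(x1 \<bullet> x2)\<^sup>2 < 1"
    and face: "\<And>y. y \<in> R \<Longrightarrow> m \<bullet> y = 0 \<Longrightarrow> \<exists>u v. 0 \<le> u \<and> 0 \<le> v \<and> y = u *\<^sub>R x1 + v *\<^sub>R x2"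
    and far: "\<And>h. h \<in> dual R \<Longrightarrow> m \<bullet> h \<noteq> c"
    and feet: "\<And>e. sph_extreme R e \<Longrightarrow> \<exists>g h. pair g h \<and> foot g h = e"
    and pair1: "pair g1 h1" "foot g1 h1 = x1"
    and pair2: "pair g2 h2" "foot g2 h2 = x2"
    and closest1: "\<And>g h. pair g h \<Longrightarrow> foot g h = x1 \<Longrightarrow> m \<bullet> g \<le> m \<bullet> g1"
    and closest2: "\<And>g h. pair g h \<Longrightarrow> foot g h = x2 \<Longrightarrow> m \<bullet> g \<le> m \<bullet> g2"
begin

lemma swapped: "corner R c s m x2 x1 g2 h2 g1 h1"
proof (unfold_locales)
  show "(x2 \<bullet> x1)\<^sup>2 < 1" using indep by (simp add: inner_commute)
  show "\<exists>u v. 0 \<le> u \<and> 0 \<le> v \<and> y = u *\<^sub>R x2 + v *\<^sub>R x1" if "y \<in> R" "m \<bullet> y = 0" for y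
    using face[OF that] by (metis add.commute)
qed (use m mx far feet pair1 pair2 closest1 closest2 in blast)+

lemma x_in_R: "x1 \<in> R" "x2 \<in> R"
  using pair_foot(1)[OF pair1(1)] pair_foot(1)[OF pair2(1)] pair1(2) pair2(2) by simp_all

lemma x_unit: "norm x1 = 1" "norm x2 = 1" "x1 \<bullet> x1 = 1" "x2 \<bullet> x2 = 1"
  using R_unit x_in_R unit_inner_self by auto

lemma m_unit: "norm m = 1" "m \<bullet> m = 1"
  using dual_unit[OF m] unit_inner_self by auto

lemma m_ne: "m \<noteq> g1" "m \<noteq> g2"
  using far[OF pairD(2)[OF pair1(1)]] far[OF pairD(2)[OF pair2(1)]] pairD(3)[OF pair1(1)] pairD(3)[OF pair2(1)]
  by auto

lemma orthogonal_to_edges_and_corner: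
  assumes "x1 \<bullet> v = 0" "x2 \<bullet> v = 0" "m \<bullet> v = 0"
  shows "v = 0"
  by (rule orthogonal_to_plane_and_normal[OF x_unit(1,2), where w = m])
     (use indep assms mx m_unit in \<open>auto simp: inner_commute\<close>)

lemma orthogonal_to_edges:
  assumes "y \<in> R" "x1 \<bullet> y = 0" "x2 \<bullet> y = 0"
  shows "y = m"
proof -
  have "x1 \<bullet> m = 0" "x2 \<bullet> m = 0" using mx by (simp_all add: inner_commute)
  then have "y - (m \<bullet> y) *\<^sub>R m = 0"
    by (intro orthogonal_to_edges_and_corner) (simp_all add: inner_lin assms m_unit)
  then have "y = (m \<bullet> y) *\<^sub>R m" by simp
  then show ?thesis using unit_multiple[OF m_unit(1) R_unit[OF assms(1)]] dual_nonneg[OF m assms(1)] by blast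
qed

text \<open>\<open>g1\<close> is on the side of \<open>m\<close> that is orthogonal to \<open>x1\<close>; its coordinates along this side.\<close>

lemma edge_coordinates:
  defines "q \<equiv> (x2 \<bullet> g1) / (1 - (x1 \<bullet> x2)\<^sup>2)"
  shows "g1 = (m \<bullet> g1) *\<^sub>R m + q *\<^sub>R (x2 - (x1 \<bullet> x2) *\<^sub>R x1)" "0 < q" "0 \<le> m \<bullet> g1"
    "(m \<bullet> g1)\<^sup>2 + q\<^sup>2 * (1 - (x1 \<bullet> x2)\<^sup>2) = 1" "x2 \<bullet> g1 = q * (1 - (x1 \<bullet> x2)\<^sup>2)"
    "0 < x2 \<bullet> g1"
proof -
  let ?s = "x1 \<bullet> x2"
  note P = pairD[OF pair1(1)]
  have S: "0 < 1 - ?s\<^sup>2" using indep by simp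
  have x1g: "x1 \<bullet> g1 = 0" using pair_foot(3)[OF pair1(1)] pair1(2) by (simp add: inner_commute)
  show x2g: "x2 \<bullet> g1 = q * (1 - ?s\<^sup>2)" using S by (simp add: q_def)
  let ?u = "g1 - (m \<bullet> g1) *\<^sub>R m - q *\<^sub>R (x2 - ?s *\<^sub>R x1)"
  have "x1 \<bullet> m = 0" "x2 \<bullet> m = 0" "x2 \<bullet> x1 = ?s" using mx by (simp_all add: inner_commute)
  then have "?u = 0"
    by (intro orthogonal_to_edges_and_corner)
       (simp_all add: inner_lin x1g x2g mx m_unit x_unit power2_eq_square algebra_simps)
  then show eq: "g1 = (m \<bullet> g1) *\<^sub>R m + q *\<^sub>R (x2 - ?s *\<^sub>R x1)"
    unfolding diff_diff_eq eq_iff_diff_eq_0[symmetric] .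
  have "0 \<le> x2 \<bullet> g1" using dual_nonneg[OF P(1) x_in_R(2)] by (simp add: inner_commute)
  then have q0: "0 \<le> q" using S by (simp add: q_def)
  have "q \<noteq> 0"
  proof
    assume "q = 0"
    then have g: "g1 = (m \<bullet> g1) *\<^sub>R m" using eq by simp
    then have "\<bar>m \<bullet> g1\<bar> = 1" using P(5) m_unit(1) by (metis norm_scaleR mult.right_neutral)
    then have "g1 = m \<or> g1 = - m" using g by (metis abs_eq_iff abs_1 scaleR_one scaleR_minus1_left)
    then show False using m_ne dual_no_antipodes[OF body m] P(1) by auto
  qed
  then show "0 < q" using q0 by simp
  then show "0 < x2 \<bullet> g1" unfolding x2g using S by simp
  have "0 \<le> foot h1 g1 \<bullet> m" 
    using dual_nonneg[OF m pair_foot(1)[OF pair_sym[OF pair1(1)]]] by (simp add: inner_commute)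
  also have "foot h1 g1 \<bullet> m = s * (m \<bullet> g1)"
    unfolding pair_foot(6)[OF pair1(1)] pair1(2) using mx by (simp add: inner_lin inner_commute)
  finally show "0 \<le> m \<bullet> g1" using s(1) by (simp add: zero_le_mult_iff)
  have "1 = (m \<bullet> g1) * (m \<bullet> g1) + q * (x2 \<bullet> g1 - ?s * (x1 \<bullet> g1))"
    using arg_cong[OF eq, of "\<lambda>v. v \<bullet> g1"] P(7) by (simp add: inner_lin)
  then show "(m \<bullet> g1)\<^sup>2 + q\<^sup>2 * (1 - ?s\<^sup>2) = 1"
    unfolding x1g x2g by (simp add: power2_eq_square algebra_simps)
qed

lemma corner_strict: "(m \<bullet> g1)\<^sup>2 < 1"
proof (rule unit_inner_strict[OF m_unit(1) pairD(5)[OF pair1(1)] m_ne(1)])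
  show "m \<noteq> - g1" using dual_no_antipodes[OF body pairD(1)[OF pair1(1)]] m by blast
qed

text \<open>At a point strictly between \<open>g1\<close> and \<open>m\<close> the only supporting line of the dual is the side
  itself, so a diametral pair at this point has the foot \<open>x1\<close>.\<close>

lemma not_nearer_on_edge:
  assumes p: "pair h g" and h: "h = a *\<^sub>R g1 + d *\<^sub>R m" "0 < a" "0 < d"
  shows False
proof -
  let ?y = "foot h g"
  note P = pairD[OF p] and P1 = pairD[OF pair1(1)] and F = pair_foot[OF p]
  have "a * (g1 \<bullet> ?y) + d * (m \<bullet> ?y) = 0" using F(3) unfolding h(1) by (simp add: inner_lin)
  moreover have nn: "0 \<le> g1 \<bullet> ?y" "0 \<le> m \<bullet> ?y" using dual_nonneg P1 m F(1) by blast+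
  ultimately have "a * (g1 \<bullet> ?y) = 0" "d * (m \<bullet> ?y) = 0" using h by (simp_all add: add_nonneg_eq_0_iff)
  then have 0: "g1 \<bullet> ?y = 0" "m \<bullet> ?y = 0" using h by simp_all
  obtain u v where y: "0 \<le> u" "0 \<le> v" "?y = u *\<^sub>R x1 + v *\<^sub>R x2" using face[OF F(1) 0(2)] by blast
  have "g1 \<bullet> x1 = 0" using pair_foot(3)[OF pair1(1)] pair1(2) by simp
  then have "v * (x2 \<bullet> g1) = 0" using 0(1) unfolding y(3) by (simp add: inner_lin inner_commute)
  moreover have "0 < x2 \<bullet> g1" by (rule edge_coordinates(6))
  ultimately have "?y = u *\<^sub>R x1" using y(3) by simp
  then have "?y = x1" using unit_multiple[OF x_unit(1) F(2)] y(1) by blast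
  then have "m \<bullet> h \<le> m \<bullet> g1" using closest1[OF p] by blast
  moreover have "m \<bullet> g1 < m \<bullet> h"
    by (rule arc_point_closer[OF m_unit(1) P1(5) P(5) edge_coordinates(3) corner_strict h])
  ultimately show False by simp
qed

end

text \<open>\<open>w\<close> is the point where the chords \<open>g1 h1\<close> and \<open>g2 h2\<close> cross. It is an interior point of the
  dual, and seen from \<open>m\<close> it is on the chord \<open>g1 g2\<close> or beyond it. The vectors \<open>z1\<close> and \<open>z2\<close> are
  normals of the planes of the two chords. The case that both chords coincide is included.\<close>

locale crossing_chords = corner +
  fixes w z1 z2 :: "real ^ 3" and l1 u1 l2 u2 a1 a2 d :: real
  assumes w1: "w = l1 *\<^sub>R g1 + u1 *\<^sub>R h1" "0 < l1" "0 < u1"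
    and w2: "w = l2 *\<^sub>R g2 + u2 *\<^sub>R h2" "0 < l2" "0 < u2"
    and wm: "w = a1 *\<^sub>R g1 + a2 *\<^sub>R g2 - d *\<^sub>R m" "0 < a1" "0 < a2" "0 \<le> d"
    and wpos: "\<And>y. y \<in> R \<Longrightarrow> 0 < w \<bullet> y"
    and acute: "0 \<le> w \<bullet> g1" "0 \<le> w \<bullet> h1" "0 \<le> w \<bullet> g2" "0 \<le> w \<bullet> h2"
    and z1: "z1 \<bullet> g1 = 0" "z1 \<bullet> h1 = 0" "0 < z1 \<bullet> m"
    and z2: "z2 \<bullet> g2 = 0" "z2 \<bullet> h2 = 0" "0 < z2 \<bullet> m"
begin

text \<open>A member \<open>h\<close> of a diametral pair is a boundary point of the dual. If it is on the near side of both
  chords, it is on one of the sides from \<open>m\<close> to \<open>g1\<close> and from \<open>m\<close> to \<open>g2\<close>. Inside these sides there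
  are no diametral pairs by the choice of \<open>g1\<close> and \<open>g2\<close>, and at \<open>g1\<close> and \<open>g2\<close> the partners are
  \<open>h1\<close> and \<open>h2\<close>. The position of \<open>h\<close> is expressed by its coordinates \<open>a\<close>, \<open>b\<close>, \<open>e\<close> with respect to
  \<open>g1\<close>, \<open>g2\<close> and \<open>m\<close>; the sign of \<open>e\<close> tells on which side of the chord \<open>g1 g2\<close> it is.\<close>

lemma no_pair_near_corner:
  assumes p: "pair h g" and h: "0 \<le> z1 \<bullet> h" "0 \<le> z2 \<bullet> h" and g: "z1 \<bullet> g < 0" "z2 \<bullet> g < 0"
  shows False
proof -
  interpret swap: corner R c s m x2 x1 g2 h2 g1 h1 by (rule swapped)
  let ?y = "foot h g"
  note P = pairD[OF p] and F = pair_foot[OF p]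
  note P1 = pairD[OF pair1(1)] and P2 = pairD[OF pair2(1)]
  have xg: "x1 \<bullet> g1 = 0" "x2 \<bullet> g2 = 0"
    using pair_foot(3)[OF pair1(1)] pair_foot(3)[OF pair2(1)] pair1(2) pair2(2) by (simp_all add: inner_commute)
  have x2g1: "0 < x2 \<bullet> g1" by (rule edge_coordinates(6))
  have x1g2: "0 < x1 \<bullet> g2" by (rule swap.edge_coordinates(6))
  define a b where "a = (x2 \<bullet> h) / (x2 \<bullet> g1)" and "b = (x1 \<bullet> h) / (x1 \<bullet> g2)"
  define e where "e = m \<bullet> (h - a *\<^sub>R g1 - b *\<^sub>R g2)"
  have "0 \<le> x1 \<bullet> h" "0 \<le> x2 \<bullet> h"
    using dual_nonneg[OF P(1) x_in_R(1)] dual_nonneg[OF P(1) x_in_R(2)] by (simp_all add: inner_commute)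
  then have ab: "0 \<le> a" "0 \<le> b" using x2g1 x1g2 by (simp_all add: a_def b_def)
  have xm: "x1 \<bullet> m = 0" "x2 \<bullet> m = 0" using mx by (simp_all add: inner_commute)
  define v where "v = h - a *\<^sub>R g1 - b *\<^sub>R g2"
  have "x1 \<bullet> v = 0" using x1g2 by (simp add: v_def inner_lin xg b_def)
  moreover have "x2 \<bullet> v = 0" using x2g1 by (simp add: v_def inner_lin xg a_def)
  moreover have "m \<bullet> v = e" by (simp add: v_def e_def)
  ultimately have "v - e *\<^sub>R m = 0"
    by (intro orthogonal_to_edges_and_corner) (simp_all add: inner_lin xm m_unit)
  then have h_eq: "h = a *\<^sub>R g1 + b *\<^sub>R g2 + e *\<^sub>R m" by (simp add: v_def algebra_simps)
  have nn: "0 \<le> g1 \<bullet> ?y" "0 \<le> g2 \<bullet> ?y" "0 \<le> m \<bullet> ?y" using dual_nonneg P1 P2 m F(1) by blast+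
  have wy: "0 < w \<bullet> ?y" using wpos[OF F(1)] .
  have hy: "a * (g1 \<bullet> ?y) + b * (g2 \<bullet> ?y) + e * (m \<bullet> ?y) = 0"
    using F(3) by (subst (asm) h_eq) (simp add: inner_lin)
  consider "0 < e" | "e = 0" | "e < 0" by linarith
  then show False
  proof cases
    case 1
    have "0 \<le> a * (g1 \<bullet> ?y)" "0 \<le> b * (g2 \<bullet> ?y)" "0 \<le> e * (m \<bullet> ?y)" using ab 1 nn by simp_all
    then have 0: "a * (g1 \<bullet> ?y) = 0" "b * (g2 \<bullet> ?y) = 0" "e * (m \<bullet> ?y) = 0" using hy by linarith+
    consider "a = 0" "b = 0" | "a = 0" "0 < b" | "0 < a" "b = 0" | "0 < a" "0 < b" using ab by linarith
    then show False
    proof cases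
      case 1
      then have "h = e *\<^sub>R m" using h_eq by simp
      then have "h = m" using unit_multiple[OF m_unit(1) P(5) _ less_imp_le[OF \<open>0 < e\<close>]] by blast
      then show False using far[OF P(2)] P(3) by simp
    next
      case 2
      have "h = b *\<^sub>R g2 + e *\<^sub>R m" using h_eq 2 by simp
      then show False using swap.not_nearer_on_edge[OF p] 2 \<open>0 < e\<close> by blast
    next
      case 3
      have "h = a *\<^sub>R g1 + e *\<^sub>R m" using h_eq 3 by simp
      then show False using not_nearer_on_edge[OF p] 3 \<open>0 < e\<close> by blast
    next
      case 4
      then have "g1 \<bullet> ?y = 0" "g2 \<bullet> ?y = 0" "m \<bullet> ?y = 0" using 0 \<open>0 < e\<close> by simp_all
      then have "w \<bullet> ?y = 0" unfolding wm(1) by (simp add: inner_lin)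
      then show False using wy by simp
    qed
  next
    case 2
    have "0 \<le> a * (g1 \<bullet> ?y)" "0 \<le> b * (g2 \<bullet> ?y)" using ab nn by simp_all
    moreover have "a * (g1 \<bullet> ?y) + b * (g2 \<bullet> ?y) = 0" using hy 2 by simp
    ultimately have 0: "a * (g1 \<bullet> ?y) = 0" "b * (g2 \<bullet> ?y) = 0" by linarith+
    consider "a = 0" | "b = 0" | "0 < a" "0 < b" using ab by linarith
    then show False
    proof cases
      case 1
      then have "h = b *\<^sub>R g2" using h_eq 2 by simp
      then have "h = g2" using unit_multiple[OF P2(5) P(5)] ab by blast
      then have "g = h2" using pair_unique p pair2(1) by blast
      then show False using z2 g by simp
    next
      case 2
      then have "h = a *\<^sub>R g1" using h_eq \<open>e = 0\<close> by simp
      then have "h = g1" using unit_multiple[OF P1(5) P(5)] ab by blast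
      then have "g = h1" using pair_unique p pair1(1) by blast
      then show False using z1 g by simp
    next
      case 3
      then have "g1 \<bullet> ?y = 0" "g2 \<bullet> ?y = 0" using 0 by simp_all
      then have "w \<bullet> ?y = - (d * (m \<bullet> ?y))" unfolding wm(1) by (simp add: inner_lin)
      moreover have "0 \<le> d * (m \<bullet> ?y)" using wm(4) nn by simp
      ultimately show False using wy by simp
    qed
  next
    case 3
    \<comment> \<open>Here \<open>h\<close> is beyond the chord \<open>g1 g2\<close>, in the triangle of \<open>g1\<close>, \<open>g2\<close> and \<open>w\<close>.\<close>
    have "z1 \<bullet> w = 0" unfolding w1(1) using z1 by (simp add: inner_lin)
    moreover have "z2 \<bullet> w = 0" unfolding w2(1) using z2 by (simp add: inner_lin)
    ultimately have e1: "a2 * (z1 \<bullet> g2) = d * (z1 \<bullet> m)" and e2: "a1 * (z2 \<bullet> g1) = d * (z2 \<bullet> m)"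
      unfolding wm(1) using z1 z2 by (simp_all add: inner_lin)
    have zh: "z1 \<bullet> h = b * (z1 \<bullet> g2) + e * (z1 \<bullet> m)" "z2 \<bullet> h = a * (z2 \<bullet> g1) + e * (z2 \<bullet> m)"
      using z1 z2 by (subst h_eq, simp add: inner_lin)+
    have "a2 * (z1 \<bullet> h) = (b * d + a2 * e) * (z1 \<bullet> m)" unfolding zh using e1 by algebra
    moreover have "0 \<le> a2 * (z1 \<bullet> h)" using h(1) wm(3) by simp
    ultimately have b2: "0 \<le> b * d + a2 * e" using z1(3) by (simp add: zero_le_mult_iff)
    have "a1 * (z2 \<bullet> h) = (a * d + a1 * e) * (z2 \<bullet> m)" unfolding zh using e2 by algebra
    moreover have "0 \<le> a1 * (z2 \<bullet> h)" using h(2) wm(2) by simp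
    ultimately have b1: "0 \<le> a * d + a1 * e" using z2(3) by (simp add: zero_le_mult_iff)
    have "d * (h \<bullet> ?y) = (- e) * (w \<bullet> ?y) + (a * d + a1 * e) * (g1 \<bullet> ?y) + (b * d + a2 * e) * (g2 \<bullet> ?y)"
      unfolding wm(1) by (subst h_eq) (simp add: inner_lin algebra_simps)
    then have "(- e) * (w \<bullet> ?y) + (a * d + a1 * e) * (g1 \<bullet> ?y) + (b * d + a2 * e) * (g2 \<bullet> ?y) = 0"
      using F(3) by simp
    moreover have "0 < (- e) * (w \<bullet> ?y)" using mult_neg_pos[OF 3 wy] by simp
    moreover have "0 \<le> (a * d + a1 * e) * (g1 \<bullet> ?y)" "0 \<le> (b * d + a2 * e) * (g2 \<bullet> ?y)"
      using b1 b2 nn by simp_all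
    ultimately show False by linarith
  qed
qed

text \<open>A supporting line at the point \<open>q\<close> where the ray from \<open>m\<close> through \<open>w\<close> leaves the dual belongs to
  an extreme point \<open>e\<close> of the body and thus to a diametral pair with a member on that line.\<close>

lemma contradiction: False
proof -
  interpret swap: corner R c s m x2 x1 g2 h2 g1 h1 by (rule swapped)
  obtain r x where x: "x \<in> R" "m \<bullet> x = r * (w \<bullet> x)" and max: "\<And>y. y \<in> R \<Longrightarrow> m \<bullet> y \<le> r * (w \<bullet> y)"
    using ratio_attains_max[OF body wpos] by metis
  obtain y where y: "y \<in> R" "m \<bullet> y \<noteq> 0" using body_not_in_great_circle[OF body m_unit(1)] by blast
  have "0 < m \<bullet> y" using dual_nonneg[OF m y(1)] y(2) by simp
  then have "0 < r * (w \<bullet> y)" using max[OF y(1)] by simp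
  then have r: "0 < r" using wpos[OF y(1)] by (simp add: zero_less_mult_iff)
  define \<kappa> where "\<kappa> = 1 / r"
  define q where "q = w - \<kappa> *\<^sub>R m"
  have k: "0 < \<kappa>" using r by (simp add: \<kappa>_def)
  have q0: "0 \<le> q \<bullet> v" if "v \<in> R" for v
    using max[OF that] r by (simp add: q_def \<kappa>_def inner_lin field_simps)
  have qx: "q \<bullet> x = 0" using x(2) r by (simp add: q_def \<kappa>_def inner_lin)
  have "z1 \<bullet> w = 0" unfolding w1(1) using z1 by (simp add: inner_lin)
  then have "z1 \<bullet> q \<noteq> 0" using z1(3) k by (simp add: q_def inner_lin)
  then have "q \<noteq> 0" by auto
  then obtain e where e: "sph_extreme R e" "q \<bullet> e = 0" using extreme_point_of_face[OF body _ q0 x(1) qx] by blast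
  obtain g h where p: "pair g h" "foot g h = e" using feet[OF e(1)] by blast
  have qe: "q \<bullet> foot g h = 0" using p(2) e(2) by simp
  have "z1 \<bullet> g < 0"
  proof (rule ccontr)
    assume "\<not> z1 \<bullet> g < 0"
    then have "q \<bullet> foot h1 g1 = 0"
      using exit_point_on_opposite_side[OF pair1(1) w1 wpos z1 _ q_def k q0 p(1) qe] mx pair1(2) by simp
    then show False
      using perpendicular_chord_too_long[OF pair1(1) w1 acute(1,2) m _ m_ne(1) edge_coordinates(3) q_def q0] mx pair1(2)
      by simp
  qed
  moreover have "z2 \<bullet> g < 0"
  proof (rule ccontr)
    assume "\<not> z2 \<bullet> g < 0"
    then have "q \<bullet> foot h2 g2 = 0"
      using exit_point_on_opposite_side[OF pair2(1) w2 wpos z2 _ q_def k q0 p(1) qe] mx pair2(2) by simp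
    then show False
      using perpendicular_chord_too_long[OF pair2(1) w2 acute(3,4) m _ m_ne(2) swap.edge_coordinates(3) q_def q0] mx pair2(2)
      by simp
  qed
  moreover have "0 \<le> z1 \<bullet> h"
    using diametral_pair_not_on_one_side[OF p(1) pair1(1) z1(1,2)] calculation by force
  moreover have "0 \<le> z2 \<bullet> h"
    using diametral_pair_not_on_one_side[OF p(1) pair2(1) z2(1,2)] calculation by force
  ultimately show False using no_pair_near_corner[OF pair_sym[OF p(1)]] by blast
qed

end

section \<open>Crossing chords at a corner\<close>

context corner
begin

text \<open>On the great circle of the chord \<open>g1 h1\<close> lies also the arc from \<open>x1\<close> to \<open>foot h1 g1\<close>, which is
  contained in the body, and the same holds for the other chord. The inner products of \<open>w\<close> with \<open>h1\<close> and
  \<open>g1\<close> are its coordinates with respect to the end points of this arc, up to the factor \<open>s\<close>. The arcs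
  cross at \<open>w\<close>, since each of them has its end points in the lune that belongs to the other.\<close>

lemma crossing_point_on_arc:
  assumes w1: "w = l1 *\<^sub>R g1 + u1 *\<^sub>R h1" and w2: "w = l2 *\<^sub>R g2 + u2 *\<^sub>R h2"
    and g: "0 \<le> w \<bullet> g1" "0 \<le> w \<bullet> g2"
  shows "0 \<le> w \<bullet> h1"
proof (rule ccontr)
  assume neg: "\<not> 0 \<le> w \<bullet> h1"
  note P1 = pairD[OF pair1(1)] and P2 = pairD[OF pair2(1)]
  note F1 = pair_foot[OF pair1(1), unfolded pair1(2)] and F2 = pair_foot[OF pair2(1), unfolded pair2(2)]
  note F1' = pair_foot[OF pair_sym[OF pair1(1)]] and F2' = pair_foot[OF pair_sym[OF pair2(1)]]
  let ?y1 = "foot h1 g1" and ?y2 = "foot h2 g2"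
  have decomp: "s *\<^sub>R (l *\<^sub>R g + u *\<^sub>R h) = (u + c * l) *\<^sub>R x + (l + c * u) *\<^sub>R y"
    if "h = s *\<^sub>R x + c *\<^sub>R g" "y = s *\<^sub>R g - c *\<^sub>R x" for l u and g h x y :: "real ^ 3"
  proof -
    have "(u + c * l) *\<^sub>R x + (l + c * u) *\<^sub>R y = (u * (1 - c\<^sup>2)) *\<^sub>R x + (s * (l + c * u)) *\<^sub>R g"
      unfolding that(2) by (simp add: power2_eq_square scaleR_lin algebra_simps)
    also have "\<dots> = s *\<^sub>R (l *\<^sub>R g + u *\<^sub>R h)"
      unfolding that(1) s(2)[symmetric] by (simp add: power2_eq_square scaleR_lin algebra_simps)
    finally show ?thesis by simp
  qed
  have wg: "w \<bullet> g1 = l1 + c * u1" "w \<bullet> h1 = u1 + c * l1"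
    unfolding w1 by (simp_all add: inner_lin P1 algebra_simps)
  have wg': "w \<bullet> g2 = l2 + c * u2" "w \<bullet> h2 = u2 + c * l2"
    unfolding w2 by (simp_all add: inner_lin P2 algebra_simps)
  have sw1: "s *\<^sub>R w = (w \<bullet> h1) *\<^sub>R x1 + (w \<bullet> g1) *\<^sub>R ?y1"
    unfolding wg by (subst w1) (rule decomp[OF F1(5,6)])
  have sw2: "s *\<^sub>R w = (w \<bullet> h2) *\<^sub>R x2 + (w \<bullet> g2) *\<^sub>R ?y2"
    unfolding wg' by (subst w2) (rule decomp[OF F2(5,6)])
  have e1: "s * (w \<bullet> h1) = (w \<bullet> h2) * (x2 \<bullet> h1) + (w \<bullet> g2) * (?y2 \<bullet> h1)"
    using arg_cong[OF sw2, of "\<lambda>v. v \<bullet> h1"] by (simp add: inner_lin)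
  have e2: "s * (w \<bullet> h2) = (w \<bullet> h1) * (x1 \<bullet> h2) + (w \<bullet> g1) * (?y1 \<bullet> h2)"
    using arg_cong[OF sw1, of "\<lambda>v. v \<bullet> h2"] by (simp add: inner_lin)
  have nn: "0 \<le> x2 \<bullet> h1" "0 \<le> ?y2 \<bullet> h1" "0 \<le> x1 \<bullet> h2" "0 \<le> ?y1 \<bullet> h2" "0 \<le> x2 \<bullet> g1" "0 \<le> x1 \<bullet> g2"
    using dual_nonneg[OF P1(2) x_in_R(2)] dual_nonneg[OF P1(2) F2'(1)] dual_nonneg[OF P2(2) x_in_R(1)]
      dual_nonneg[OF P2(2) F1'(1)] dual_nonneg[OF P1(1) x_in_R(2)] dual_nonneg[OF P2(1) x_in_R(1)]
    by (simp_all add: inner_commute)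
  have "\<bar>x1 \<bullet> x2\<bar> < 1" using indep by (simp add: abs_square_less_1)
  then have sg: "s * (x1 \<bullet> x2) < s" using s(1) by simp
  have "x2 \<bullet> h1 = s * (x1 \<bullet> x2) + c * (x2 \<bullet> g1)" by (subst F1(5)) (simp add: inner_lin inner_commute)
  moreover have "c * (x2 \<bullet> g1) \<le> 0" using c(1) nn by (simp add: mult_nonpos_nonneg)
  ultimately have b1: "x2 \<bullet> h1 < s" using sg by linarith
  have "x1 \<bullet> h2 = s * (x1 \<bullet> x2) + c * (x1 \<bullet> g2)" by (subst F2(5)) (simp add: inner_lin)
  moreover have "c * (x1 \<bullet> g2) \<le> 0" using c(1) nn by (simp add: mult_nonpos_nonneg)
  ultimately have b2: "x1 \<bullet> h2 < s" using sg by linarith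
  have X1: "w \<bullet> h1 < 0" using neg by simp
  show False
  proof (cases "0 \<le> w \<bullet> h2")
    case True
    then have "0 \<le> s * (w \<bullet> h1)" unfolding e1 using nn g by simp
    then show False using X1 s(1) by (simp add: zero_le_mult_iff)
  next
    case False
    have "s * (w \<bullet> h2) < (x2 \<bullet> h1) * (w \<bullet> h2)" using b1 False by (simp add: mult_strict_right_mono_neg)
    also have "\<dots> \<le> s * (w \<bullet> h1)" unfolding e1 using nn g by (simp add: mult.commute)
    also have "\<dots> < (x1 \<bullet> h2) * (w \<bullet> h1)" using b2 X1 by (simp add: mult_strict_right_mono_neg)
    also have "\<dots> \<le> s * (w \<bullet> h2)" unfolding e2 using nn g by (simp add: mult.commute)
    finally show False by simp
  qed
qed

text \<open>In the body, \<open>m\<close> would be the only point orthogonal to \<open>g1\<close> and \<open>h1\<close>, hence extreme and the foot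
  of a diametral pair \<open>g\<close>, \<open>h\<close>. But such a \<open>g\<close> is orthogonal to \<open>m\<close>, \<open>x1\<close> and \<open>x2\<close>.\<close>

lemma corner_notin_body:
  assumes "m \<in> R" "m \<bullet> g1 = 0" "m \<bullet> h1 = 0"
  shows False
proof -
  note P1 = pairD[OF pair1(1)]
  have x1m: "x1 \<bullet> m = 0" "x2 \<bullet> m = 0" using mx by (simp_all add: inner_commute)
  have "sph_extreme R m"
    unfolding sph_extreme_def
  proof (intro conjI ballI allI impI)
    show "m \<in> R" by fact
    fix a b u v assume ab: "a \<in> R" "b \<in> R" and uv: "0 < u \<and> 0 < v \<and> m = u *\<^sub>R a + v *\<^sub>R b"
    have zero: "a \<bullet> f = 0" if f: "f \<in> dual R" "m \<bullet> f = 0" for f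
    proof -
      have "u * (a \<bullet> f) + v * (b \<bullet> f) = m \<bullet> f" using uv by (simp add: inner_lin)
      moreover have "0 \<le> u * (a \<bullet> f)" "0 \<le> v * (b \<bullet> f)"
        using uv dual_nonneg[OF f(1) ab(1)] dual_nonneg[OF f(1) ab(2)] by (simp_all add: inner_commute)
      ultimately have "u * (a \<bullet> f) = 0" using f(2) by linarith
      then show ?thesis using uv by simp
    qed
    let ?d = "a - (a \<bullet> m) *\<^sub>R m"
    have "?d = 0"
      by (rule orthogonal_to_plane_and_normal[OF P1(5,6), where w = m])
         (use c_square P1(3) zero[OF P1(1) assms(2)] zero[OF P1(2) assms(3)] assms m_unit in \<open>auto simp: inner_lin\<close>)
    then have "a = (a \<bullet> m) *\<^sub>R m" by simp
    moreover have "0 \<le> a \<bullet> m" using dual_nonneg[OF m ab(1)] by (simp add: inner_commute)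
    ultimately show "a = m" using unit_multiple[OF m_unit(1) R_unit[OF ab(1)]] by blast
  qed
  then obtain g h where p: "pair g h" "foot g h = m" using feet by blast
  note P = pairD[OF p(1)] and F = pair_foot[OF p(1), unfolded p(2)]
  have z: "x \<bullet> g = 0" if x: "x \<in> R" "x \<bullet> m = 0" for x
  proof -
    have "0 \<le> x \<bullet> h" "0 \<le> x \<bullet> g" using dual_nonneg[OF P(2) x(1)] dual_nonneg[OF P(1) x(1)] by (simp_all add: inner_commute)
    moreover have "x \<bullet> h = c * (x \<bullet> g)" by (subst F(5)) (simp add: inner_lin x(2))
    ultimately show ?thesis using c(1) by (simp add: zero_le_mult_iff)
  qed
  have "g = 0"
    by (rule orthogonal_to_edges_and_corner)
       (use z[OF x_in_R(1) x1m(1)] z[OF x_in_R(2) x1m(2)] F(3) in \<open>simp_all add: inner_commute\<close>)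
  then show False using P(5) by simp
qed

text \<open>If \<open>g1\<close> and \<open>g2\<close> are both at right angles from \<open>m\<close>, then the foot of the first pair on \<open>h1\<close> lies on
  the arc \<open>x1 x2\<close>. Together with the inequality \<open>0 \<le> x1 \<bullet> h2\<close> this forces the length of the arc to
  be the distance of the two feet, so that the two chords coincide.\<close>

lemma sides_at_right_angles:
  assumes "m \<bullet> g1 = 0" "m \<bullet> g2 = 0"
  shows "h1 = g2"
proof -
  interpret swap: corner R c s m x2 x1 g2 h2 g1 h1 by (rule swapped)
  note P1 = pairD[OF pair1(1)] and P2 = pairD[OF pair2(1)]
  note F1 = pair_foot[OF pair1(1), unfolded pair1(2)] and F2 = pair_foot[OF pair2(1), unfolded pair2(2)]
  note F1' = pair_foot[OF pair_sym[OF pair1(1)]]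
  define r S where "r = x1 \<bullet> x2" and "S = 1 - r\<^sup>2"
  have rs: "x2 \<bullet> x1 = r" by (simp add: r_def inner_commute)
  have S: "0 < S" using indep by (simp add: S_def r_def)
  define q1 where "q1 = (x2 \<bullet> g1) / S"
  define q2 where "q2 = (x1 \<bullet> g2) / S"
  have 1: "g1 = q1 *\<^sub>R (x2 - r *\<^sub>R x1)" "0 < q1" "q1\<^sup>2 * S = 1"
    using edge_coordinates assms(1) unfolding q1_def S_def r_def by simp_all
  have 2: "g2 = q2 *\<^sub>R (x1 - r *\<^sub>R x2)" "0 < q2" "q2\<^sup>2 * S = 1" "x1 \<bullet> g2 = q2 * S"
    using swap.edge_coordinates assms(2) unfolding q2_def S_def rs[symmetric] by simp_all
  have "q1\<^sup>2 = q2\<^sup>2" using 1(3) 2(3) S by (metis mult_right_cancel less_irrefl)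
  then have q: "q2 = q1" using 1(2) 2(2) by (simp add: power2_eq_iff_nonneg)
  have "0 \<le> x1 \<bullet> h2" using dual_nonneg[OF P2(2) x_in_R(1)] by (simp add: inner_commute)
  also have "x1 \<bullet> h2 = s * r + c * (x1 \<bullet> g2)" by (subst F2(5)) (simp add: inner_lin r_def)
  finally have A: "0 \<le> s * r + c * (q1 * S)" using 2(4) q by simp
  let ?y = "foot h1 g1"
  have y: "?y = s *\<^sub>R g1 - c *\<^sub>R x1" by (rule F1(6))
  have "m \<bullet> ?y = 0" unfolding y using assms(1) mx by (simp add: inner_lin)
  then obtain a b where ab: "0 \<le> a" "?y = a *\<^sub>R x1 + b *\<^sub>R x2" using face[OF F1'(1)] by blast
  have "(- c - s * q1 * r - a) *\<^sub>R x1 + (s * q1 - b) *\<^sub>R x2 = 0"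
  proof -
    have "s *\<^sub>R g1 - c *\<^sub>R x1 = a *\<^sub>R x1 + b *\<^sub>R x2" using y ab(2) by simp
    then show ?thesis unfolding 1(1) by (simp add: scaleR_lin algebra_simps)
  qed
  then have "- c - s * q1 * r - a = 0"
    using independent_combination_zero[OF x_unit(1,2) less_imp_neq[OF indep]] by blast
  then have "0 \<le> - c - s * q1 * r" using ab(1) by simp
  then have "0 \<le> (q1 * S) * (- c - s * q1 * r)" using 1(2) S by simp
  also have "\<dots> = - (c * (q1 * S)) - s * r * (q1\<^sup>2 * S)" by (simp add: power2_eq_square algebra_simps)
  finally have B: "s * r = - (c * (q1 * S))" using A 1(3) by simp
  have sr: "(s * r)\<^sup>2 = c\<^sup>2 * S" unfolding B using 1(3) by (simp add: power2_eq_square)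
  have sS: "s\<^sup>2 = S" using sr s(2) S_def by algebra
  have "(s * q1)\<^sup>2 = 1" using sS 1(3) by (simp add: power_mult_distrib mult.commute)
  then have sq: "s * q1 = 1" using mult_pos_pos[OF s(1) 1(2)] by (auto simp: power2_eq_1_iff)
  have xx: "x1 \<bullet> g2 = q1 * S" using 2(4) q by simp
  have x2g2: "x2 \<bullet> g2 = 0" using F2(3) by (simp add: inner_commute)
  have g12: "g1 \<bullet> g2 = - r * q1\<^sup>2 * S"
    unfolding 1(1) using xx x2g2 by (simp add: inner_lin power2_eq_square)
  have "h1 \<bullet> g2 = s * (x1 \<bullet> g2) + c * (g1 \<bullet> g2)" by (subst F1(5)) (simp add: inner_lin)
  also have "\<dots> = s * (q1 * S) - c * r" unfolding xx g12 using 1(3) by (simp add: algebra_simps)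
  also have "\<dots> = 1"
  proof -
    have "s * (s * (q1 * S) - c * r) = s\<^sup>2 * (q1 * S) - c * (s * r)" by (simp add: power2_eq_square algebra_simps)
    also have "\<dots> = s\<^sup>2 * (q1 * S) + c\<^sup>2 * (q1 * S)" unfolding B by (simp add: power2_eq_square)
    also have "\<dots> = q1 * S" unfolding s(2) by (simp add: algebra_simps)
    also have "\<dots> = s * (s * q1)" unfolding sS[symmetric] by (simp add: power2_eq_square)
    finally show ?thesis using s(1) sq by simp
  qed
  finally show ?thesis using unit_eqI[OF P1(6) P2(5)] by simp
qed

text \<open>It remains to find the crossing point. In the basis \<open>m\<close>, \<open>x1\<close>, \<open>x2\<close> the intersection of the planes
  of the two chords and its coefficients result from Cramer's rule. If \<open>g1\<close> and \<open>g2\<close> are both at right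
  angles from \<open>m\<close>, the planes coincide and the midpoint of the common chord serves as crossing point.\<close>

lemma impossible: False
proof (cases "m \<bullet> g1 = 0 \<and> m \<bullet> g2 = 0")
  case True
  note P1 = pairD[OF pair1(1)] and P2 = pairD[OF pair2(1)]
  have h1: "h1 = g2" using sides_at_right_angles True by blast
  have h2: "h2 = g1" using pair_unique[OF _ pair_sym[OF pair1(1)]] pair2(1) h1 by blast
  have g12: "g1 \<bullet> g2 = c" "g2 \<bullet> g1 = c" using P1 h1 by simp_all
  have "crossing_chords R c s m x1 x2 g1 h1 g2 h2 (g1 + g2) m m 1 1 1 1 1 1 0"
  proof (unfold_locales)
    fix y assume y: "y \<in> R"
    have nn: "0 \<le> g1 \<bullet> y" "0 \<le> g2 \<bullet> y" using dual_nonneg P1 P2 y by blast+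
    show "0 < (g1 + g2) \<bullet> y"
    proof (rule ccontr)
      assume "\<not> 0 < (g1 + g2) \<bullet> y"
      then have 0: "g1 \<bullet> y = 0" "g2 \<bullet> y = 0" using nn by (simp_all add: inner_lin)
      have sx1: "g2 = s *\<^sub>R x1 + c *\<^sub>R g1" using pair_foot(5)[OF pair1(1)] pair1(2) h1 by simp
      have sx2: "g1 = s *\<^sub>R x2 + c *\<^sub>R g2" using pair_foot(5)[OF pair2(1)] pair2(2) h2 by simp
      have "s * (x1 \<bullet> y) = 0" using arg_cong[OF sx1, of "\<lambda>v. v \<bullet> y"] 0 by (simp add: inner_lin)
      moreover have "s * (x2 \<bullet> y) = 0" using arg_cong[OF sx2, of "\<lambda>v. v \<bullet> y"] 0 by (simp add: inner_lin)
      ultimately have "y = m" using orthogonal_to_edges[OF y] s(1) by simp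
      then show False using corner_notin_body y True h1 by simp
    qed
  qed (use True h1 h2 P1 P2 g12 c m_unit in \<open>simp_all add: inner_lin add.commute\<close>)
  then interpret crossing_chords R c s m x1 x2 g1 h1 g2 h2 "g1 + g2" m m 1 1 1 1 1 1 0 .
  show False by (rule contradiction)
next
  case False
  interpret swap: corner R c s m x2 x1 g2 h2 g1 h1 by (rule swapped)
  note P1 = pairD[OF pair1(1)] and P2 = pairD[OF pair2(1)]
  note F1 = pair_foot[OF pair1(1), unfolded pair1(2)] and F2 = pair_foot[OF pair2(1), unfolded pair2(2)]
  define r S where "r = x1 \<bullet> x2" and "S = 1 - r\<^sup>2"
  have rs: "x2 \<bullet> x1 = r" by (simp add: r_def inner_commute)
  have S: "0 < S" using indep by (simp add: S_def r_def)
  have xm: "x1 \<bullet> m = 0" "x2 \<bullet> m = 0" using mx by (simp_all add: inner_commute)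
  obtain p1 q1 where g1: "g1 = p1 *\<^sub>R m + q1 *\<^sub>R (x2 - r *\<^sub>R x1)" and q1: "0 < q1" and p1: "0 \<le> p1"
    and mg1: "m \<bullet> g1 = p1" and x2g1: "x2 \<bullet> g1 = q1 * S"
    using edge_coordinates unfolding S_def r_def by metis
  obtain p2 q2 where g2: "g2 = p2 *\<^sub>R m + q2 *\<^sub>R (x1 - r *\<^sub>R x2)" and q2: "0 < q2" and p2: "0 \<le> p2"
    and mg2: "m \<bullet> g2 = p2" and x1g2: "x1 \<bullet> g2 = q2 * S"
    using swap.edge_coordinates unfolding S_def rs[symmetric] by metis
  have h1: "h1 = s *\<^sub>R x1 + c *\<^sub>R g1" and h2: "h2 = s *\<^sub>R x2 + c *\<^sub>R g2" using F1(5) F2(5) .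
  have xg: "x1 \<bullet> g1 = 0" "x2 \<bullet> g2 = 0" using F1(3) F2(3) by (simp_all add: inner_commute)
  have "0 \<le> x1 \<bullet> h2" using dual_nonneg[OF P2(2) x_in_R(1)] by (simp add: inner_commute)
  also have "x1 \<bullet> h2 = s * r + c * (q2 * S)" unfolding h2 by (simp add: inner_lin r_def x1g2)
  finally have "- (c * (q2 * S)) \<le> s * r" by simp
  moreover have "c * (q2 * S) < 0" using c(1) q2 S by (simp add: mult_neg_pos)
  ultimately have "0 < s * r" by linarith
  then have r: "0 < r" using s(1) by (simp add: zero_less_mult_iff)
  define E G where "E = q1 * p2 + r * p1 * q2" and "G = q2 * p1 + r * p2 * q1"
  have "0 < p1 \<or> 0 < p2" using False p1 p2 mg1 mg2 by auto
  then have EG: "0 < E" "0 < G"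
    unfolding E_def G_def using r q1 q2 p1 p2 by (auto intro: add_pos_nonneg add_nonneg_pos)
  define w where "w = s *\<^sub>R ((p1 * p2) *\<^sub>R m + (p1 * q2) *\<^sub>R x1 + (p2 * q1) *\<^sub>R x2)"
  define l1 l2 where "l1 = s * p2 - c * G" and "l2 = s * p1 - c * E"
  have "c * G < 0" "c * E < 0" using c(1) EG by (simp_all add: mult_neg_pos)
  moreover have "0 \<le> s * p1" "0 \<le> s * p2" using s(1) p1 p2 by simp_all
  ultimately have l: "0 < l1" "0 < l2" unfolding l1_def l2_def by linarith+
  have w1: "w = l1 *\<^sub>R g1 + G *\<^sub>R h1"
  proof -
    have "l1 *\<^sub>R g1 + G *\<^sub>R h1 = (s * p2) *\<^sub>R g1 + (G * s) *\<^sub>R x1"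
      unfolding l1_def h1 by (simp add: scaleR_lin algebra_simps)
    also have "\<dots> = w" unfolding g1 G_def w_def by (simp add: scaleR_lin algebra_simps)
    finally show ?thesis by simp
  qed
  have w2: "w = l2 *\<^sub>R g2 + E *\<^sub>R h2"
  proof -
    have "l2 *\<^sub>R g2 + E *\<^sub>R h2 = (s * p1) *\<^sub>R g2 + (E * s) *\<^sub>R x2"
      unfolding l2_def h2 by (simp add: scaleR_lin algebra_simps)
    also have "\<dots> = w" unfolding g2 E_def w_def by (simp add: scaleR_lin algebra_simps)
    finally show ?thesis by simp
  qed
  have wg: "w \<bullet> g1 = s * p2" "w \<bullet> g2 = s * p1"
    unfolding l1_def l2_def by (simp add: w1 inner_lin P1 l1_def, simp add: w2 inner_lin P2 l2_def)
  have acute: "0 \<le> w \<bullet> g1" "0 \<le> w \<bullet> g2" unfolding wg using s(1) p1 p2 by simp_all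
  define a1 a2 d where "a1 = s * E / (q1 * S)" and "a2 = s * G / (q2 * S)" and "d = s * (E * G) / (q1 * q2 * S)"
  have a: "0 < a1" "0 < a2" "0 \<le> d" unfolding a1_def a2_def d_def using s(1) EG q1 q2 S by simp_all
  have wm: "w = a1 *\<^sub>R g1 + a2 *\<^sub>R g2 - d *\<^sub>R m"
  proof -
    have "q1 \<noteq> 0" "q2 \<noteq> 0" "S \<noteq> 0" using q1 q2 S by auto
    then have cm: "a1 * p1 + a2 * p2 - d = s * (p1 * p2)" and c1: "a2 * q2 - a1 * q1 * r = s * (p1 * q2)"
      and c2: "a1 * q1 - a2 * q2 * r = s * (p2 * q1)"
      unfolding a1_def a2_def d_def E_def G_def
      by (simp_all add: field_simps) (simp_all add: S_def power2_eq_square algebra_simps)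
    have "a1 *\<^sub>R g1 + a2 *\<^sub>R g2 - d *\<^sub>R m =
        (a1 * p1 + a2 * p2 - d) *\<^sub>R m + (a2 * q2 - a1 * q1 * r) *\<^sub>R x1 + (a1 * q1 - a2 * q2 * r) *\<^sub>R x2"
      unfolding g1 g2 by (simp add: scaleR_lin algebra_simps)
    then show ?thesis unfolding cm c1 c2 w_def by (simp add: scaleR_lin algebra_simps)
  qed
  define z1 z2 where "z1 = q1 *\<^sub>R m - (p1 / S) *\<^sub>R (x2 - r *\<^sub>R x1)" and "z2 = q2 *\<^sub>R m - (p2 / S) *\<^sub>R (x1 - r *\<^sub>R x2)"
  have z1: "z1 \<bullet> g1 = 0" "z1 \<bullet> x1 = 0" "z1 \<bullet> m = q1"
    unfolding z1_def using S by (simp_all add: inner_lin mg1 x2g1 xg mx xm m_unit x_unit rs)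
  have z2: "z2 \<bullet> g2 = 0" "z2 \<bullet> x2 = 0" "z2 \<bullet> m = q2"
    unfolding z2_def using S by (simp_all add: inner_lin mg2 x1g2 xg mx xm m_unit x_unit r_def)
  have wpos: "0 < w \<bullet> y" if y: "y \<in> R" for y
  proof (rule ccontr)
    assume n: "\<not> 0 < w \<bullet> y"
    have nn: "0 \<le> g1 \<bullet> y" "0 \<le> g2 \<bullet> y" "0 \<le> h1 \<bullet> y" "0 \<le> h2 \<bullet> y" using dual_nonneg P1 P2 y by blast+
    have "l1 * (g1 \<bullet> y) + G * (h1 \<bullet> y) \<le> 0" using n unfolding w1 by (simp add: inner_lin)
    moreover have "0 \<le> l1 * (g1 \<bullet> y)" "0 \<le> G * (h1 \<bullet> y)" using l EG nn by simp_all
    ultimately have "l1 * (g1 \<bullet> y) = 0" "G * (h1 \<bullet> y) = 0" by linarith+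
    then have 1: "g1 \<bullet> y = 0" "h1 \<bullet> y = 0" using l EG by simp_all
    have "l2 * (g2 \<bullet> y) + E * (h2 \<bullet> y) \<le> 0" using n unfolding w2 by (simp add: inner_lin)
    moreover have "0 \<le> l2 * (g2 \<bullet> y)" "0 \<le> E * (h2 \<bullet> y)" using l EG nn by simp_all
    ultimately have "l2 * (g2 \<bullet> y) = 0" "E * (h2 \<bullet> y) = 0" by linarith+
    then have 2: "g2 \<bullet> y = 0" "h2 \<bullet> y = 0" using l EG by simp_all
    have "s * (x1 \<bullet> y) = 0" "s * (x2 \<bullet> y) = 0" using 1 2 unfolding h1 h2 by (simp_all add: inner_lin)
    then have "y = m" using orthogonal_to_edges[OF y] s(1) by simp
    then show False using 1 2 False by (simp add: inner_commute)
  qed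
  have "crossing_chords R c s m x1 x2 g1 h1 g2 h2 w z1 z2 l1 G l2 E a1 a2 d"
  proof (unfold_locales)
    show "0 \<le> w \<bullet> h1" by (rule crossing_point_on_arc[OF w1 w2 acute])
    show "0 \<le> w \<bullet> h2" by (rule swap.crossing_point_on_arc[OF w2 w1 acute(2,1)])
    show "z1 \<bullet> h1 = 0" unfolding h1 using z1 by (simp add: inner_lin)
    show "z2 \<bullet> h2 = 0" unfolding h2 using z2 by (simp add: inner_lin)
    show "0 < z1 \<bullet> m" "0 < z2 \<bullet> m" using z1 z2 q1 q2 by simp_all
  qed (fact w1 w2 l EG wm a wpos acute z1 z2)+
  then interpret crossing_chords R c s m x1 x2 g1 h1 g2 h2 w z1 z2 l1 G l2 E a1 a2 d .
  show False by (rule contradiction)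
qed

end

section \<open>The width of a reduced body along a boundary arc\<close>

text \<open>The diametral pairs with a given foot \<open>x\<close> form a compact set, because the partner of \<open>g\<close> can only
  be \<open>s *\<^sub>R x + c *\<^sub>R g\<close>.\<close>

lemma (in thin_body) nearest_pair_with_foot:
  assumes p: "pair g0 h0" "foot g0 h0 = x"
  obtains g h where "pair g h" "foot g h = x" "\<And>g' h'. pair g' h' \<Longrightarrow> foot g' h' = x \<Longrightarrow> m \<bullet> g' \<le> m \<bullet> g"
proof -
  define A where "A = dual R \<inter> ({g. x \<bullet> g = 0} \<inter> (\<lambda>g. s *\<^sub>R x + c *\<^sub>R g) -` dual R)"
  have inA: "g \<in> A" if "pair g h" "foot g h = x" for g h
  proof -
    note P = pairD[OF that(1)] and F = pair_foot[OF that(1), unfolded that(2)]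
    show ?thesis using P(1,2) F(3) F(5) by (simp add: A_def inner_commute)
  qed
  have outA: "pair g (s *\<^sub>R x + c *\<^sub>R g) \<and> foot g (s *\<^sub>R x + c *\<^sub>R g) = x" if "g \<in> A" for g
  proof -
    have g: "g \<in> dual R" "g \<bullet> x = 0" "s *\<^sub>R x + c *\<^sub>R g \<in> dual R"
      using that by (simp_all add: A_def inner_commute)
    have "g \<bullet> (s *\<^sub>R x + c *\<^sub>R g) = c"
      using g(2) unit_inner_self[OF dual_unit[OF g(1)]] by (simp add: inner_lin)
    then have "pair g (s *\<^sub>R x + c *\<^sub>R g)" using g by (simp add: pair_def)
    moreover from this have "s *\<^sub>R foot g (s *\<^sub>R x + c *\<^sub>R g) = s *\<^sub>R x" using pair_foot(5) by (metis add_right_cancel)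
    ultimately show ?thesis using s(1) by simp
  qed
  have "closed ((\<lambda>g. s *\<^sub>R x + c *\<^sub>R g) -` dual R)"
    by (intro closed_vimage compact_imp_closed[OF compact_dual] continuous_intros)
  then have "closed ({g. x \<bullet> g = 0} \<inter> (\<lambda>g. s *\<^sub>R x + c *\<^sub>R g) -` dual R)"
    using closed_hyperplane closed_Int by blast
  then have "compact A" unfolding A_def by (rule compact_Int_closed[OF compact_dual])
  moreover have "A \<noteq> {}" using inA[OF p] by blast
  moreover have "continuous_on A (\<lambda>g. m \<bullet> g)" by (intro continuous_intros)
  ultimately obtain g where g: "g \<in> A" "\<forall>g'\<in>A. m \<bullet> g' \<le> m \<bullet> g" using continuous_attains_sup by blast
  show ?thesis using that outA[OF g(1)] g(2) inA by blast
qed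

text \<open>A point of the arc is never a positive combination of points of the body outside the arc, and
  within the arc the end point is extreme by linear independence of \<open>x\<close> and \<open>x'\<close>.\<close>

lemma arc_end_extreme:
  assumes C: "sph_convex_body C" and m: "m \<in> dual C" and x: "x \<in> C" "m \<bullet> x = 0" "norm x' = 1"
    and indep: "(x \<bullet> x')\<^sup>2 < 1"
    and face: "\<And>y. y \<in> C \<Longrightarrow> m \<bullet> y = 0 \<Longrightarrow> \<exists>u v. 0 \<le> u \<and> 0 \<le> v \<and> y = u *\<^sub>R x + v *\<^sub>R x'"
  shows "sph_extreme C x"
  unfolding sph_extreme_def
proof (intro conjI ballI allI impI)
  show "x \<in> C" by fact
  fix a b s t assume ab: "a \<in> C" "b \<in> C" and st: "0 < s \<and> 0 < t \<and> x = s *\<^sub>R a + t *\<^sub>R b"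
  have xn: "norm x = 1" using body_unit[OF C x(1)] .
  have "s * (m \<bullet> a) + t * (m \<bullet> b) = m \<bullet> x" using st by (simp add: inner_lin)
  moreover have "0 \<le> s * (m \<bullet> a)" "0 \<le> t * (m \<bullet> b)" using st dual_nonneg[OF m] ab by simp_all
  ultimately have "s * (m \<bullet> a) = 0" "t * (m \<bullet> b) = 0" using x(2) by linarith+
  then have "m \<bullet> a = 0" "m \<bullet> b = 0" using st by auto
  then obtain u v u' v' where a: "0 \<le> u" "0 \<le> v" "a = u *\<^sub>R x + v *\<^sub>R x'"
    and b: "0 \<le> u'" "0 \<le> v'" "b = u' *\<^sub>R x + v' *\<^sub>R x'" using face ab by metis
  have x_eq: "x = s *\<^sub>R a + t *\<^sub>R b" using st by blast
  define A B where "A = s * u + t * u'" and "B = s * v + t * v'"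
  have "s *\<^sub>R a + t *\<^sub>R b = A *\<^sub>R x + B *\<^sub>R x'"
    unfolding a(3) b(3) A_def B_def by (simp add: scaleR_lin algebra_simps)
  then have e: "A *\<^sub>R x + B *\<^sub>R x' = x" using x_eq by simp
  have "(A - 1) *\<^sub>R x + B *\<^sub>R x' = (A *\<^sub>R x + B *\<^sub>R x') - x" by (simp add: scaleR_lin)
  also have "\<dots> = 0" unfolding e by simp
  finally have "B = 0"
    using independent_combination_zero[OF xn x(3) less_imp_neq[OF indep]] by blast
  then have "s * v + t * v' = 0" by (simp add: B_def)
  moreover have "0 \<le> s * v" "0 \<le> t * v'" using st a b by simp_all
  ultimately have "s * v = 0" by linarith
  then have "a = u *\<^sub>R x" using a(3) st by simp
  then show "a = x" using unit_multiple[OF xn body_unit[OF C ab(1)]] a(1) by blast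
qed

theorem theorem2p2:
  fixes R M :: "(real ^ 3) set" and x1 x2 :: "real ^ 3"
  assumes "sph_reduced R"
    and "thickness R < pi / 2"
    and "supports M R"
    and "x1 \<in> S2" and "x2 \<in> S2" and "x1 \<noteq> x2" and "x1 \<noteq> - x2"
    and "bd M \<inter> bd R = great_arc x1 x2"
  shows "width M R = thickness R \<and>
    (\<forall>Mstar. is_star R M Mstar \<longrightarrow> semicircle_center M Mstar \<in> great_arc x1 x2)"
proof -
  have C: "sph_convex_body R" using assms(1) by (simp add: sph_reduced_def)
  obtain m where mS: "m \<in> support_centres R" and M: "M = hemisphere_at m"
    using assms(3) supports_iff[OF C] by blast
  have md: "m \<in> dual R" using mS support_centres_subset_dual by blast
  note mn = dual_unit[OF md]
  obtain g0 h0 where gh0: "diametral R g0 h0" and thick: "thickness R = arccos (- (g0 \<bullet> h0))"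
    and neg: "g0 \<bullet> h0 < 0" using thickness_dual[OF C assms(2)] by blast
  define c where "c = g0 \<bullet> h0"
  define s where "s = sqrt (1 - c\<^sup>2)"
  note d0 = diametralD[OF gh0]
  have "g0 \<noteq> h0" using neg unit_inner_self[OF dual_unit[OF d0(1)]] by auto
  then have c2: "c\<^sup>2 < 1" unfolding c_def using dual_pair_strict[OF C d0(1,2)] by blast
  interpret thin_body R c s
  proof
    show "c < 0" using neg by (simp add: c_def)
    show "- 1 < c" using c2 by (simp add: abs_square_less_1)
    show "0 < s" "s\<^sup>2 = 1 - c\<^sup>2" using c2 by (simp_all add: s_def)
  qed (use C d0(3) c_def in simp_all)
  have arc: "y \<in> great_arc x1 x2" if "y \<in> R" "m \<bullet> y = 0" for y
  proof -
    have "y \<in> bd R" using contact_in_bd[OF C md that] .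
    moreover have "y \<in> bd M" unfolding M bd_hemisphere_iff[OF mn] using that body_unit[OF C] by blast
    ultimately show ?thesis using assms(8) by blast
  qed
  have face: "\<exists>u v. 0 \<le> u \<and> 0 \<le> v \<and> y = u *\<^sub>R x1 + v *\<^sub>R x2" if "y \<in> R" "m \<bullet> y = 0" for y
    using arc[OF that] unfolding great_arc_def by blast
  have xn: "norm x1 = 1" "norm x2 = 1" using assms(4,5) by simp_all
  have "x1 = 1 *\<^sub>R x1 + 0 *\<^sub>R x2" "x2 = 0 *\<^sub>R x1 + 1 *\<^sub>R x2" by simp_all
  then have "x1 \<in> great_arc x1 x2" "x2 \<in> great_arc x1 x2"
    unfolding great_arc_def using assms(4,5) by (metis (mono_tags, lifting) mem_Collect_eq zero_le_one order_refl)+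
  then have "x1 \<in> bd M" "x1 \<in> bd R" "x2 \<in> bd M" "x2 \<in> bd R" using assms(8) by blast+
  then have x: "x1 \<in> R" "x2 \<in> R" "m \<bullet> x1 = 0" "m \<bullet> x2 = 0"
    using bd_subset_body[OF C] unfolding M bd_hemisphere_iff[OF mn] by blast+
  have indep: "(x1 \<bullet> x2)\<^sup>2 < 1" using unit_inner_strict[OF xn assms(6,7)] .
  have feet: "\<exists>g h. pair g h \<and> foot g h = e" if ext: "sph_extreme R e" for e
  proof -
    obtain g h where gh: "diametral R g h" "foot g h = e"
      using extreme_point_is_foot[OF assms(1,2) ext] by blast
    note d = diametralD[OF gh(1)]
    have "g \<bullet> h = c" using d(3)[OF d0(1,2)] d0(3)[OF d(1,2)] by (simp add: c_def)
    then show ?thesis using d gh(2) unfolding pair_def by blast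
  qed
  \<comment> \<open>Equivalently, \<open>m\<close> belongs to a diametral pair; this is the first claim.\<close>
  have "\<exists>h\<in>dual R. m \<bullet> h = c"
  proof (rule ccontr)
    assume "\<not> (\<exists>h\<in>dual R. m \<bullet> h = c)"
    then have far: "m \<bullet> h \<noteq> c" if "h \<in> dual R" for h using that by blast
    have "sph_extreme R x1" by (rule arc_end_extreme[OF C md x(1,3) xn(2) indep face])
    then obtain g h where "pair g h" "foot g h = x1" using feet by blast
    then obtain g1 h1 where p1: "pair g1 h1" "foot g1 h1 = x1"
      and near1: "\<And>g h. pair g h \<Longrightarrow> foot g h = x1 \<Longrightarrow> m \<bullet> g \<le> m \<bullet> g1"
      using nearest_pair_with_foot[of g h x1 m] by metis
    have "(x2 \<bullet> x1)\<^sup>2 < 1" using indep by (simp add: inner_commute)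
    moreover have "\<exists>u v. 0 \<le> u \<and> 0 \<le> v \<and> y = u *\<^sub>R x2 + v *\<^sub>R x1" if "y \<in> R" "m \<bullet> y = 0" for y
      using face[OF that] by (metis add.commute)
    ultimately have "sph_extreme R x2" using arc_end_extreme[OF C md x(2,4) xn(1)] by blast
    then obtain g' h' where "pair g' h'" "foot g' h' = x2" using feet by blast
    then obtain g2 h2 where p2: "pair g2 h2" "foot g2 h2 = x2"
      and near2: "\<And>g h. pair g h \<Longrightarrow> foot g h = x2 \<Longrightarrow> m \<bullet> g \<le> m \<bullet> g2"
      using nearest_pair_with_foot[of g' h' x2 m] by metis
    interpret corner R c s m x1 x2 g1 h1 g2 h2
      by unfold_locales (fact md x indep face far feet p1 p2 near1 near2)+
    show False by (rule impossible)
  qed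
  then obtain h where h: "h \<in> dual R" "m \<bullet> h = c" by blast
  have "pair m h" using md h by (simp add: pair_def)
  then have "foot h m \<in> R" "h \<bullet> foot h m = 0" using pair_foot(1,3) pair_sym by blast+
  then have hS: "h \<in> support_centres R" using h(1) by (auto simp: support_centres_def)
  have "width M R = arccos (- (m \<bullet> h))"
    unfolding M
  proof (rule width_eq[OF C mS hS])
    show "m \<bullet> h \<le> m \<bullet> h'" if "h' \<in> support_centres R" for h'
      using h(2) dual_min[OF md] that support_centres_subset_dual by blast
  qed
  then have "width M R = thickness R" using thick h(2) by (simp add: c_def)
  moreover have "semicircle_center M K \<in> great_arc x1 x2" if star: "is_star R M K" for K
  proof -
    obtain k where k: "k \<in> support_centres R" "K = hemisphere_at k" and min: "m \<bullet> k \<le> m \<bullet> h"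
      using star[unfolded M is_star_iff[OF C mS]] hS by blast
    have kd: "k \<in> dual R" using k support_centres_subset_dual by blast
    have "m \<bullet> k = c" using min h(2) dual_min[OF md kd] by simp
    then have p: "pair m k" using md kd by (simp add: pair_def)
    note P = pairD[OF p] and F = pair_foot[OF p]
    have "semicircle_center M K = foot m k"
      unfolding M k(2) by (rule semicircle_center_eq[OF P(5,6)]) (use P(3) c_square in simp)
    then show ?thesis using arc[OF F(1,3)] by simp
  qed
  ultimately show ?thesis by blast
qed

end
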